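(* Consider any cell-probe data structure for the partial-sums problem on an array of $n$ integers, with cell size $b$ bits and update arguments of $\delta$ bits, which may use amortization and Las Vegas randomization. Let $t_u$, $t_q$, $t_s$ denote the (amortized, expected) running times of \texttt{update}, \texttt{sum} and \texttt{select}, respectively. If $\delta = \Omega(b)$, then the following trade-offs hold: $$t_q \lg(t_u/t_q) = \Omega(\lg n),\qquad t_u \lg(t_q/t_u) = \Omega(\lg n),$$ $$t_s \lg(t_u/t_s) = \Omega(\lg n),\qquad t_u \lg(t_s/t_u) = \Omega(\lg n).$$
   Context: Throughout, $\lg x$ denotes $\log_2(2+x)$. The partial-sums problem asks to maintain an array $A[1..n]$ of integers under: $\texttt{update}(k,\Delta)$, which sets $A[k]\gets\Delta$; $\texttt{sum}(k)$, which returns $\sum_{i=1}^k A[i]$; $\texttt{select}(\sigma)$, which returns the index $i$ with $\texttt{sum}(i-1)<\sigma\le\texttt{sum}(i)$ (for \texttt{select} it is required that $A[i]>0$ for all $i$). Every array element and every partial sum fits in a cell; $b=\Omega(\lg n)$; $\delta\le b$ is the number of bits needed to represent an argument $\Delta$ of \texttt{update}. Cell-probe model: memory consists of at most $2^b$ cells of $b$ bits each; an operation may read and write cells, all computation is free, no state is retained between operations, and the cost of an operation is the number of cells it reads or writes. Las Vegas randomization: a fixed subset of cells is initialized with uniformly random values when the structure is created, after which everything is deterministic and answers are always correct; running times are measured in expectation (and may be amortized over the sequence of operations). *)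

theory Defs
  imports "HOL-Probability.Probability"
begin

definition lg :: "real \<Rightarrow> real" where
  "lg x = log 2 (2 + x)"

section \<open>The cell-probe model\<close>

type_synonym memory = "nat \<Rightarrow> nat"

text \<open>
  An operation is an adaptive sequence of probes. Since computation is free, its next step is an
  arbitrary function of the contents read so far (and of the arguments of the operation, on which
  the whole tree may depend). No state survives the execution of a tree except the memory.
\<close>

datatype prog = Done int | Read nat "nat \<Rightarrow> prog" | Write nat nat prog

text \<open>All addresses and all values written are \<open>b\<close>-bit numbers.\<close>

primrec wf_prog :: "nat \<Rightarrow> prog \<Rightarrow> bool" where
  "wf_prog b (Done r) = True"
| "wf_prog b (Read a f) = (a < 2 ^ b \<and> (\<forall>v < 2 ^ b. wf_prog b (f v)))"
| "wf_prog b (Write a v p) = (a < 2 ^ b \<and> v < 2 ^ b \<and> wf_prog b p)"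

primrec run :: "prog \<Rightarrow> memory \<Rightarrow> int \<times> memory" where
  "run (Done r) = (\<lambda>M. (r, M))"
| "run (Read a f) = (\<lambda>M. run (f (M a)) M)"
| "run (Write a v p) = (\<lambda>M. run p (M(a := v)))"

primrec probed :: "prog \<Rightarrow> memory \<Rightarrow> nat set" where
  "probed (Done r) = (\<lambda>M. {})"
| "probed (Read a f) = (\<lambda>M. insert a (probed (f (M a)) M))"
| "probed (Write a v p) = (\<lambda>M. insert a (probed p (M(a := v))))"

text \<open>
  Distinct cells are counted, so a cell that is read and written several times by one operation is
  charged once; counting every single access would only give a larger cost.
\<close>

definition cost :: "prog \<Rightarrow> memory \<Rightarrow> nat" where
  "cost p M = card (probed p M)"

section \<open>The partial-sums problem\<close>

datatype query_kind = Sums | Selects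

datatype operation =
    is_update: Update nat int
  | is_sum: Sum nat
  | is_select: Select int

text \<open>
  Arrays are indexed by \<open>{1..n}\<close>; values outside this range are irrelevant. The set \<open>Q\<close> of query
  kinds says which of \<open>sum\<close> and \<open>select\<close> the structure has to support besides \<open>update\<close>.
  Numbers that fit in a cell are the integers in \<open>{0..<2 ^ b}\<close>, and \<open>\<delta>\<close>-bit arguments of updates
  are the integers in \<open>{0..<2 ^ \<delta>}\<close>. A structure for signed integers in two's complement
  representation is in particular one for the nonnegative ones, with one bit less.
\<close>

definition psum :: "(nat \<Rightarrow> int) \<Rightarrow> nat \<Rightarrow> int" where
  "psum A k = (\<Sum>i=1..k. A i)"

definition legal_array :: "query_kind set \<Rightarrow> nat \<Rightarrow> nat \<Rightarrow> (nat \<Rightarrow> int) \<Rightarrow> bool" where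
  "legal_array Q n b A \<longleftrightarrow>
     (\<forall>i\<in>{1..n}. 0 \<le> A i \<and> A i < 2 ^ b) \<and>
     (\<forall>k\<in>{1..n}. 0 \<le> psum A k \<and> psum A k < 2 ^ b) \<and>
     (Selects \<in> Q \<longrightarrow> (\<forall>i\<in>{1..n}. A i > 0))"

fun legal_op ::
  "query_kind set \<Rightarrow> nat \<Rightarrow> nat \<Rightarrow> nat \<Rightarrow> (nat \<Rightarrow> int) \<Rightarrow> operation \<Rightarrow> bool" where
  "legal_op Q n b \<delta> A (Update k \<Delta>) \<longleftrightarrow>
     k \<in> {1..n} \<and> 0 \<le> \<Delta> \<and> \<Delta> < 2 ^ \<delta> \<and> legal_array Q n b (A(k := \<Delta>))"
| "legal_op Q n b \<delta> A (Sum k) \<longleftrightarrow> Sums \<in> Q \<and> k \<in> {1..n}"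
| "legal_op Q n b \<delta> A (Select \<sigma>) \<longleftrightarrow> Selects \<in> Q \<and> 0 < \<sigma> \<and> \<sigma> \<le> psum A n"

fun apply_op :: "(nat \<Rightarrow> int) \<Rightarrow> operation \<Rightarrow> (nat \<Rightarrow> int)" where
  "apply_op A (Update k \<Delta>) = A(k := \<Delta>)"
| "apply_op A (Sum k) = A"
| "apply_op A (Select \<sigma>) = A"

fun correct_answer :: "nat \<Rightarrow> (nat \<Rightarrow> int) \<Rightarrow> operation \<Rightarrow> int \<Rightarrow> bool" where
  "correct_answer n A (Update k \<Delta>) r \<longleftrightarrow> True"
| "correct_answer n A (Sum k) r \<longleftrightarrow> r = psum A k"
| "correct_answer n A (Select \<sigma>) r \<longleftrightarrow>
     (\<exists>i\<in>{1..n}. r = int i \<and> psum A (i - 1) < \<sigma> \<and> \<sigma> \<le> psum A i)"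

primrec legal_seq ::
  "query_kind set \<Rightarrow> nat \<Rightarrow> nat \<Rightarrow> nat \<Rightarrow> operation list \<Rightarrow> (nat \<Rightarrow> int) \<Rightarrow> bool" where
  "legal_seq Q n b \<delta> [] = (\<lambda>A. True)"
| "legal_seq Q n b \<delta> (x # xs) =
     (\<lambda>A. legal_op Q n b \<delta> A x \<and> legal_seq Q n b \<delta> xs (apply_op A x))"

text \<open>
  \<open>\<delta>\<close> is the number of bits needed to represent an argument of an update: besides the bound
  \<open>\<Delta> < 2 ^ \<delta>\<close> imposed by \<^const>\<open>legal_op\<close>, some legal update has an argument that really needs
  \<open>\<delta>\<close> bits. Without \<open>select\<close> this just says \<open>1 \<le> \<delta> \<le> b\<close> (for \<open>n \<ge> 1\<close>). With \<open>select\<close> it rules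
  out the degenerate case where positivity and the bound \<open>2 ^ b\<close> on the sums leave (almost) no
  freedom, e.g. \<open>2 ^ b = n + 1\<close>, where every element must be \<open>1\<close>.
\<close>

definition bits_needed :: "query_kind set \<Rightarrow> nat \<Rightarrow> nat \<Rightarrow> nat \<Rightarrow> bool" where
  "bits_needed Q n b \<delta> \<longleftrightarrow>
     (\<exists>A k \<Delta>. legal_array Q n b A \<and> legal_op Q n b \<delta> A (Update k \<Delta>) \<and> 2 ^ (\<delta> - 1) \<le> \<Delta>)"

section \<open>Data structures, correctness and running times\<close>

record data_structure =
  op_prog :: "operation \<Rightarrow> prog"
  random_cells :: "nat set"
  fixed_content :: memory

definition initial_memories :: "nat \<Rightarrow> data_structure \<Rightarrow> memory set" where
  "initial_memories b D =
     {M. (\<forall>a \<in> random_cells D. M a < 2 ^ b) \<and>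
         (\<forall>a. a \<notin> random_cells D \<longrightarrow> M a = fixed_content D a)}"

definition wf_structure :: "nat \<Rightarrow> data_structure \<Rightarrow> bool" where
  "wf_structure b D \<longleftrightarrow>
     (\<forall>x. wf_prog b (op_prog D x)) \<and>
     random_cells D \<subseteq> {..<2 ^ b} \<and>
     (\<forall>a < 2 ^ b. fixed_content D a < 2 ^ b)"

primrec correct_seq ::
  "nat \<Rightarrow> (operation \<Rightarrow> prog) \<Rightarrow> operation list \<Rightarrow> (nat \<Rightarrow> int) \<Rightarrow> memory \<Rightarrow> bool" where
  "correct_seq n P [] = (\<lambda>A M. True)"
| "correct_seq n P (x # xs) =
     (\<lambda>A M. correct_answer n A x (fst (run (P x) M)) \<and>
            correct_seq n P xs (apply_op A x) (snd (run (P x) M)))"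

primrec seq_cost :: "(operation \<Rightarrow> prog) \<Rightarrow> operation list \<Rightarrow> memory \<Rightarrow> nat" where
  "seq_cost P [] = (\<lambda>M. 0)"
| "seq_cost P (x # xs) = (\<lambda>M. cost (P x) M + seq_cost P xs (snd (run (P x) M)))"

text \<open>
  \<open>D\<close> maintains an array that initially is \<open>A\<^sub>0\<close>. Las Vegas: the answers are correct for every
  outcome of the random initialization.
\<close>

definition solves_partial_sums ::
  "query_kind set \<Rightarrow> nat \<Rightarrow> nat \<Rightarrow> nat \<Rightarrow> (nat \<Rightarrow> int) \<Rightarrow> data_structure \<Rightarrow> bool" where
  "solves_partial_sums Q n b \<delta> A\<^sub>0 D \<longleftrightarrow>
     wf_structure b D \<and> legal_array Q n b A\<^sub>0 \<and>
     (\<forall>xs. legal_seq Q n b \<delta> xs A\<^sub>0 \<longrightarrow>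
       (\<forall>M \<in> initial_memories b D. correct_seq n (op_prog D) xs A\<^sub>0 M))"

definition expected_cost :: "nat \<Rightarrow> data_structure \<Rightarrow> operation list \<Rightarrow> real" where
  "expected_cost b D xs =
     measure_pmf.expectation (pmf_of_set (initial_memories b D))
       (\<lambda>M. real (seq_cost (op_prog D) xs M))"

text \<open>
  Amortized expected running times \<open>t\<^sub>u\<close>, \<open>t\<^sub>q\<close>, \<open>t\<^sub>s\<close> of \<open>update\<close>, \<open>sum\<close> and \<open>select\<close>. The time of
  a query kind outside \<open>Q\<close> is immaterial.
\<close>

definition running_times ::
  "query_kind set \<Rightarrow> nat \<Rightarrow> nat \<Rightarrow> nat \<Rightarrow> (nat \<Rightarrow> int) \<Rightarrow> data_structure \<Rightarrow>
     real \<Rightarrow> real \<Rightarrow> real \<Rightarrow> bool" where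
  "running_times Q n b \<delta> A\<^sub>0 D t\<^sub>u t\<^sub>q t\<^sub>s \<longleftrightarrow>
     (\<forall>xs. legal_seq Q n b \<delta> xs A\<^sub>0 \<longrightarrow>
       expected_cost b D xs \<le>
         t\<^sub>u * real (length (filter is_update xs)) +
         t\<^sub>q * real (length (filter is_sum xs)) +
         t\<^sub>s * real (length (filter is_select xs)))"

end

theory Submission
  imports Defs
begin

text \<open>
  Averaging over rounds of random updates reduces the claim to a single round that starts from a
  fixed memory. Time is organised as a tree of degree \<open>B\<close>, a power of two just above the ratio of
  the two running times, with updates and queries in digit-reversed order. If \<open>W\<close> and \<open>R\<close> are
  the cells probed during two adjacent time intervals, the queries of the second interval determine
  the updates of the first one that they separate, although they only see them through \<open>W \<inter> R\<close>.
  So \<open>W \<inter> R\<close> is large, provided that a decoder can simulate the second interval. As the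
  arguments and answers of the queries are unknown, the decoder tests all candidates for a prefix
  sum; a random labelling of cells, biased according to \<open>B\<close>, tells it when a wrong candidate has
  touched a cell of \<open>W - R\<close>. Every pair of consecutive probes of a cell contributes to \<open>W \<inter> R\<close>
  at one node of the tree only, so the contributions of the levels add up.
\<close>

section \<open>Executions of programs\<close>

text \<open>One kind of operation occurs at every time step, the other at every \<open>B\<close>-th.
  A node of height \<open>h\<close> thus holds \<open>B ^ h\<close> frequent operations, and its
  parent, \<open>B\<close> times as long, holds \<open>B ^ h\<close> rare ones: both sides of a
  transfer are equally rich although their intervals differ in length by a factor up to
  \<open>B\<close>. This is the obstacle. On one level the nodes together have as many probes as the
  round, say \<open>C\<close>, but their siblings have up to \<open>B * C\<close>, and naming the
  cells of the long intervals at a constant price would be ruinous. With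
  \<open>B = 2 ^ \<beta>\<close>, the bias charges about \<open>\<beta>\<close> for a cell of the
  short interval and \<open>2 / B\<close> for one of the long interval, so a level costs about
  \<open>\<beta> * C\<close> and all levels about \<open>\<beta> * D * C\<close>. This is at most of
  order \<open>b * C\<close>, the price of the transferred contents themselves. What remains is that
  on each of \<open>D - 1\<close> levels order \<open>B ^ D\<close> values of \<open>m\<close> bits
  pass through \<open>b\<close>-bit cells, which needs order \<open>D * B ^ D * m / b\<close> probes
  for \<open>B ^ D\<close> frequent and \<open>B ^ (D - 1)\<close> rare operations. With
  \<open>m\<close> proportional to \<open>b\<close>, \<open>\<beta> * D\<close> of order
  \<open>lg n\<close>, and \<open>B\<close> balancing the two running times, the time of the
  frequent operation is at least of order \<open>lg n / \<beta>\<close>.\<close>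

lemma run_cong:
  assumes "probed p M \<subseteq> R" "\<And>a. a \<in> R \<Longrightarrow> M a = M' a"
  shows "fst (run p M) = fst (run p M') \<and> (\<forall>a\<in>R. snd (run p M) a = snd (run p M') a)"
  using assms
proof (induction p arbitrary: M M')
  case (Read c f)
  then have "M c = M' c" by auto
  then show ?case using Read by auto
next
  case (Write c v p)
  have "fst (run p (M(c := v))) = fst (run p (M'(c := v))) \<and>
      (\<forall>a\<in>R. snd (run p (M(c := v))) a = snd (run p (M'(c := v))) a)"
  proof (rule Write.IH)
    show "probed p (M(c := v)) \<subseteq> R" using Write.prems by simp
  qed (use Write.prems in simp)
  then show ?case by simp
qed auto

lemma run_unprobed: "a \<notin> probed p M \<Longrightarrow> snd (run p M) a = M a"
  by (induction p arbitrary: M) auto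

lemma finite_probed: "finite (probed p M)"
  by (induction p arbitrary: M) auto

text \<open>Only \<open>Done\<close> probes nothing. This is what later forces every update and
  every tested query to have positive cost.\<close>

lemma probed_empty_run:
  assumes "probed p M = {}"
  shows "run p M' = (fst (run p M), M')"
  using assms by (cases p) auto

definition cells_fit :: "nat \<Rightarrow> memory \<Rightarrow> bool" where
  "cells_fit b M \<longleftrightarrow> (\<forall>a < 2 ^ b. M a < 2 ^ b)"

lemma cells_fit_run:
  assumes "wf_prog b p" "cells_fit b M"
  shows "cells_fit b (snd (run p M))"
  using assms
proof (induction p arbitrary: M)
  case (Write c v p)
  then have "cells_fit b (M(c := v))" by (auto simp: cells_fit_def)
  then show ?case using Write by auto
qed (auto simp: cells_fit_def)

lemma probed_bound:
  assumes "wf_prog b p" "cells_fit b M"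
  shows "probed p M \<subseteq> {..<2 ^ b}"
  using assms
proof (induction p arbitrary: M)
  case (Write c v p)
  then have "cells_fit b (M(c := v))" by (auto simp: cells_fit_def)
  then show ?case using Write by auto
qed (auto simp: cells_fit_def)

primrec memory_at :: "(nat \<Rightarrow> prog) \<Rightarrow> memory \<Rightarrow> nat \<Rightarrow> memory" where
  "memory_at p M 0 = M"
| "memory_at p M (Suc t) = snd (run (p t) (memory_at p M t))"

definition probes_at :: "(nat \<Rightarrow> prog) \<Rightarrow> memory \<Rightarrow> nat \<Rightarrow> nat set" where
  "probes_at p M t = probed (p t) (memory_at p M t)"

lemma finite_probes_at [simp]: "finite (probes_at p M t)"
  by (simp add: probes_at_def finite_probed)

lemma memory_at_cong:
  assumes "\<And>i. i < t \<Longrightarrow> p i = p' i"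
  shows "memory_at p M t = memory_at p' M t"
  using assms by (induction t) auto

lemma memory_at_unprobed:
  assumes "i \<le> j" "\<And>t. t \<in> {i..<j} \<Longrightarrow> a \<notin> probes_at p M t"
  shows "memory_at p M j a = memory_at p M i a"
  using assms
  by (induction j rule: dec_induct) (auto simp: run_unprobed probes_at_def)

lemma cells_fit_memory_at:
  assumes "\<And>t. wf_prog b (p t)" "cells_fit b M"
  shows "cells_fit b (memory_at p M t)"
  using assms by (induction t) (auto simp: cells_fit_run)

lemma probes_at_bound:
  assumes "\<And>t. wf_prog b (p t)" "cells_fit b M"
  shows "probes_at p M t \<subseteq> {..<2 ^ b}"
  unfolding probes_at_def using assms by (intro probed_bound cells_fit_memory_at)

section \<open>Information transfer between adjacent intervals\<close>

text \<open>Convexity of \<open>exp\<close> in the form \<open>exp y >= 1 + y\<close> at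
  \<open>y = s - c x\<close>. The shift \<open>s = ln (card X / Z)\<close> scales the sum of
  exponentials to at most \<open>card X\<close>, so the constant terms cancel. It does the work of
  an entropy bound.\<close>

lemma sum_ge_of_sum_exp_le:
  fixes c :: "'a \<Rightarrow> real"
  assumes "finite X" "X \<noteq> {}" "Z > 0" "(\<Sum>x\<in>X. exp (- c x)) \<le> Z"
  shows "(\<Sum>x\<in>X. c x) \<ge> real (card X) * ln (real (card X) / Z)"
proof -
  define n where "n = real (card X)"
  have n: "n > 0" using assms by (simp add: n_def card_gt_0_iff)
  define s where "s = ln (n / Z)"
  have "(\<Sum>x\<in>X. 1 + (s - c x)) \<le> (\<Sum>x\<in>X. exp (s - c x))"
    by (intro sum_mono exp_ge_add_one_self)
  also have "\<dots> = exp s * (\<Sum>x\<in>X. exp (- c x))"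
    by (simp add: sum_distrib_left flip: exp_add)
  also have "\<dots> \<le> exp s * Z" using assms by simp
  also have "\<dots> = n" using n assms by (simp add: s_def)
  finally have "n + n * s - (\<Sum>x\<in>X. c x) \<le> n"
    by (simp add: sum.distrib sum_subtractf n_def)
  then show ?thesis by (simp add: n_def s_def)
qed

text \<open>
  A labelling of the cells replaces the encoder's message: it tells the decoder to use a given
  content, to reject the simulated query, or to use the content from before the left interval.
  A rejected cell can only be met while simulating a query with a wrong candidate answer.
\<close>

datatype label = Content nat | Reject | Old

text \<open>\<open>Reject\<close> is never allowed on \<open>R\<close> and \<open>Old\<close> never
  on \<open>W\<close>, so the label of a cell used by one run restricts every other run compatible
  with the same labelling. Cells outside both sets may carry either label, which keeps their total
  weight close to 1.\<close>

definition allowed :: "nat set \<Rightarrow> nat set \<Rightarrow> memory \<Rightarrow> nat \<Rightarrow> label set" where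
  "allowed W R M a = (if a \<in> W then (if a \<in> R then {Content (M a)} else {Reject})
     else (if a \<in> R then {Old} else {Reject, Old}))"

lemma allowed_Content: "Content v \<in> allowed W R M a \<Longrightarrow> v = M a"
  and allowed_Old: "Old \<in> allowed W R M a \<Longrightarrow> a \<notin> W"
  by (auto simp: allowed_def split: if_splits)

text \<open>\<open>P t d \<sigma>\<close> performs the update of time \<open>t\<close> with argument
  \<open>d\<close> and tests the candidate \<open>\<sigma>\<close>; \<open>s t x\<close> is the true
  answer when the updates are given by \<open>x\<close>. \<open>s_cong\<close> is causality.
  \<open>verify\<close> is demanded only for candidates \<open>s t x'\<close> that are true for some
  other input, because testing an arbitrary number may be an illegal operation.\<close>

locale verified_steps =
  fixes P :: "nat \<Rightarrow> int \<Rightarrow> int \<Rightarrow> prog" and s :: "nat \<Rightarrow> (nat \<Rightarrow> int) \<Rightarrow> int"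
    and M\<^sub>0 :: memory and b N :: nat and U :: "nat set" and V :: "int set"
  assumes wf: "\<And>t d \<sigma>. wf_prog b (P t d \<sigma>)"
    and fit: "cells_fit b M\<^sub>0"
    and b: "b \<ge> 1"
    and V: "finite V" "V \<noteq> {}"
    and U: "finite U"
    and s_cong: "\<And>x x' t. x \<in> (U \<rightarrow>\<^sub>E V) \<Longrightarrow> x' \<in> (U \<rightarrow>\<^sub>E V) \<Longrightarrow> t < N \<Longrightarrow>
      (\<And>i. i \<le> t \<Longrightarrow> x i = x' i) \<Longrightarrow> s t x = s t x'"
    and verify: "\<And>x x' t. x \<in> (U \<rightarrow>\<^sub>E V) \<Longrightarrow> x' \<in> (U \<rightarrow>\<^sub>E V) \<Longrightarrow> t < N \<Longrightarrow>
      fst (run (P t (x t) (s t x')) (memory_at (\<lambda>t. P t (x t) (s t x)) M\<^sub>0 t)) = 1 \<longleftrightarrow> s t x' = s t x"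
begin

abbreviation "X \<equiv> U \<rightarrow>\<^sub>E V"

definition mem :: "(nat \<Rightarrow> int) \<Rightarrow> nat \<Rightarrow> memory" where
  "mem x = memory_at (\<lambda>t. P t (x t) (s t x)) M\<^sub>0"

definition probes :: "(nat \<Rightarrow> int) \<Rightarrow> nat \<Rightarrow> nat set" where
  "probes x = probes_at (\<lambda>t. P t (x t) (s t x)) M\<^sub>0"

lemma finite_X: "finite X" and X_nonempty: "X \<noteq> {}"
  using V U by (auto simp: finite_PiE PiE_eq_empty_iff)

lemma probes_subset: "probes x t \<subseteq> {..<2 ^ b}"
  unfolding probes_def by (intro probes_at_bound wf fit)

lemma mem_bound: "a < 2 ^ b \<Longrightarrow> mem x t a < 2 ^ b"
  using cells_fit_memory_at[OF wf fit] by (simp add: mem_def cells_fit_def)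

text \<open>
  Both memories agree at time \<open>i\<^sub>1\<close> on all cells that the correct run for \<open>x\<close> touches in the right
  interval, hence this run passes its tests in both of them.
\<close>

lemma compatible_unique:
  assumes "i\<^sub>0 \<le> i\<^sub>1" "i\<^sub>1 \<le> i\<^sub>2" "i\<^sub>2 \<le> N" "Y \<subseteq> {i\<^sub>0..<i\<^sub>1}"
    and x: "x \<in> X" "x' \<in> X" "\<And>i. i \<notin> Y \<Longrightarrow> x i = x' i"
    and f: "\<And>a. a < 2 ^ b \<Longrightarrow>
        f a \<in> allowed (\<Union>(probes x ` {i\<^sub>0..<i\<^sub>1})) (\<Union>(probes x ` {i\<^sub>1..<i\<^sub>2})) (mem x i\<^sub>1) a"
      "\<And>a. a < 2 ^ b \<Longrightarrow>
        f a \<in> allowed (\<Union>(probes x' ` {i\<^sub>0..<i\<^sub>1})) (\<Union>(probes x' ` {i\<^sub>1..<i\<^sub>2})) (mem x' i\<^sub>1) a"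
  shows "\<forall>t\<in>{i\<^sub>1..<i\<^sub>2}. s t x = s t x'"
proof -
  define R where "R = \<Union>(probes x ` {i\<^sub>1..<i\<^sub>2})"
  have before: "mem x i\<^sub>0 = mem x' i\<^sub>0"
    unfolding mem_def
  proof (rule memory_at_cong)
    fix i assume i: "i < i\<^sub>0"
    have "x i = x' i" using i assms(4) by (intro x) auto
    moreover have "s i x = s i x'"
      using i assms by (intro s_cong x) auto
    ultimately show "P i (x i) (s i x) = P i (x' i) (s i x')" by simp
  qed
  have old: "mem z i\<^sub>1 a = mem z i\<^sub>0 a" if "a \<notin> \<Union>(probes z ` {i\<^sub>0..<i\<^sub>1})" for z a
    unfolding mem_def by (rule memory_at_unprobed) (use that assms(1) in \<open>auto simp: probes_def\<close>)
  have start: "mem x i\<^sub>1 a = mem x' i\<^sub>1 a" if "a \<in> R" for a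
  proof -
    have a: "a < 2 ^ b" using that probes_subset by (auto simp: R_def)
    note fx = f(1)[OF a, unfolded R_def[symmetric]] and fx' = f(2)[OF a]
    show ?thesis
    proof (cases "a \<in> \<Union>(probes x ` {i\<^sub>0..<i\<^sub>1})")
      case True
      then have "f a = Content (mem x i\<^sub>1 a)"
        using fx that unfolding allowed_def by (simp only: if_True singleton_iff)
      then show ?thesis using fx' by (metis allowed_Content)
    next
      case False
      then have "f a = Old"
        using fx that unfolding allowed_def by (simp only: if_False if_True singleton_iff)
      \<comment> \<open>Had the other run touched \<open>a\<close> in its left interval, the label
        would be \<open>Content\<close> or \<open>Reject\<close>. So both runs still hold the
        content from before that interval.\<close>
      then have "a \<notin> \<Union>(probes x' ` {i\<^sub>0..<i\<^sub>1})"
        using fx' by (metis allowed_Old)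
      then show ?thesis
        using False old[of a x] old[of a x'] before by simp
    qed
  qed
  have "(\<forall>a\<in>R. mem x t a = mem x' t a) \<and> (\<forall>t'\<in>{i\<^sub>1..<t}. s t' x = s t' x')"
    if "i\<^sub>1 \<le> t" "t \<le> i\<^sub>2" for t
    using that
  proof (induction t rule: dec_induct)
    case base
    then show ?case using start by auto
  next
    case (step t)
    then have IH: "\<And>a. a \<in> R \<Longrightarrow> mem x t a = mem x' t a" "\<forall>t'\<in>{i\<^sub>1..<t}. s t' x = s t' x'"
      and t: "t \<in> {i\<^sub>1..<i\<^sub>2}" "t < N" using assms by auto
    have "x t = x' t" using t assms(4) by (intro x) auto
    note run = run_cong[of "P t (x t) (s t x)" "mem x t" R "mem x' t"]
    have "probed (P t (x t) (s t x)) (mem x t) \<subseteq> R"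
      using t by (auto simp: R_def probes_def probes_at_def mem_def)
    note run = run[OF this IH(1)]
    have "fst (run (P t (x t) (s t x)) (mem x t)) = 1"
      using verify[OF x(1) x(1) t(2)] by (simp add: mem_def)
    \<comment> \<open>The step that accepts the answer of \<open>x\<close> runs identically on the
      memory of \<open>x'\<close>, where \<open>verify\<close> leaves the true answer for
      \<open>x'\<close> as the only accepted candidate.\<close>
    then have "fst (run (P t (x' t) (s t x)) (mem x' t)) = 1"
      using run \<open>x t = x' t\<close> by simp
    then have "s t x = s t x'"
      using verify[OF x(2) x(1) t(2)] by (simp add: mem_def)
    moreover have "\<forall>a\<in>R. mem x (Suc t) a = mem x' (Suc t) a"
      using run \<open>x t = x' t\<close> \<open>s t x = s t x'\<close> by (simp add: mem_def)
    ultimately show ?case using IH(2) by (auto simp: less_Suc_eq)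
  qed
  from this[of i\<^sub>2] show ?thesis using assms by auto
qed

text \<open>
  Cells receive independent random labels, with probabilities \<open>1 / 8 ^ b\<close> for each content,
  \<open>w\<^sub>r\<close> for rejection and \<open>w\<^sub>o\<close> for the old content. At most one \<open>x\<close> per choice of the values
  outside \<open>Y\<close> is compatible with a labelling, and convexity turns this into a bound on the mean of
  the negative logarithm of the probability of compatibility.
\<close>

lemma information_transfer:
  assumes i: "i\<^sub>0 \<le> i\<^sub>1" "i\<^sub>1 \<le> i\<^sub>2" "i\<^sub>2 \<le> N" and Y: "Y \<subseteq> {i\<^sub>0..<i\<^sub>1}" "Y \<subseteq> U"
    and inj: "\<And>x x'. x \<in> X \<Longrightarrow> x' \<in> X \<Longrightarrow> (\<And>i. i \<notin> Y \<Longrightarrow> x i = x' i) \<Longrightarrow>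
        (\<And>t. t \<in> {i\<^sub>1..<i\<^sub>2} \<Longrightarrow> s t x = s t x') \<Longrightarrow> x = x'"
    and w: "w\<^sub>r > 0" "w\<^sub>o > 0" "w\<^sub>r + w\<^sub>o = 1 - 1 / 4 ^ b"
  shows "real (card X) * (real (card Y) * ln (real (card V)) - ln 2) \<le>
     (\<Sum>x\<in>X. let W = \<Union>(probes x ` {i\<^sub>0..<i\<^sub>1}); R = \<Union>(probes x ` {i\<^sub>1..<i\<^sub>2}) in
        real (card (W \<inter> R)) * (3 * real b * ln 2) + real (card (W - R)) * (- ln w\<^sub>r) + real (card (R - W)) * (- ln w\<^sub>o))"
proof -
  define C where "C = {..<(2::nat) ^ b}"
  define L where "L = Content ` C \<union> {Reject, Old}"
  define w where "w l = (case l of Content _ \<Rightarrow> 1 / 8 ^ b | Reject \<Rightarrow> w\<^sub>r | Old \<Rightarrow> w\<^sub>o)" for l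
  define W where "W x = \<Union>(probes x ` {i\<^sub>0..<i\<^sub>1})" for x
  define R where "R x = \<Union>(probes x ` {i\<^sub>1..<i\<^sub>2})" for x
  define F where "F x = PiE C (allowed (W x) (R x) (mem x i\<^sub>1))" for x
  define cst where "cst x = real (card (W x \<inter> R x)) * (3 * real b * ln 2) +
     real (card (W x - R x)) * (- ln w\<^sub>r) + real (card (R x - W x)) * (- ln w\<^sub>o)" for x
  have fC: "finite C" and cC: "card C = 2 ^ b" by (auto simp: C_def)
  have fL: "finite L" by (simp add: L_def fC)
  have WC: "W x \<subseteq> C" "R x \<subseteq> C" for x
    using probes_subset by (fastforce simp: W_def R_def C_def)+
  have w_pos: "w l > 0" for l using w by (auto simp: w_def split: label.split)
  \<comment> \<open>The \<open>2 ^ b\<close> contents take \<open>2 ^ b / 8 ^ b = 1 / 4 ^ b\<close>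
    of the probability: little enough to be lost on every unprobed cell, while a transferred content
    costs only \<open>3 * b * ln 2\<close>.\<close>
  have w_sum: "(\<Sum>l\<in>L. w l) = 1"
  proof -
    have "(\<Sum>l\<in>L. w l) = (\<Sum>l\<in>Content ` C. w l) + (\<Sum>l\<in>{Reject, Old}. w l)"
      unfolding L_def by (intro sum.union_disjoint) (auto simp: fC)
    also have "(\<Sum>l\<in>Content ` C. w l) = 2 ^ b / 8 ^ b"
      by (subst sum.reindex) (auto simp: inj_on_def w_def cC)
    also have "\<dots> = (1 / 4 ^ b :: real)"
      by (simp flip: power_divide power_one_over)
    also have "(\<Sum>l\<in>{Reject, Old}. w l) = w\<^sub>r + w\<^sub>o" by (simp add: w_def)
    finally show ?thesis using w by simp
  qed
  have allowed_L: "allowed (W x) (R x) (mem x i\<^sub>1) a \<subseteq> L" if "a \<in> C" for x a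
    using that mem_bound by (auto simp: allowed_def L_def C_def)
  have F_L: "F x \<subseteq> PiE C (\<lambda>_. L)" for x
    unfolding F_def by (intro PiE_mono allowed_L)
  have fF: "finite (PiE C (\<lambda>_. L))" using fC fL by (intro finite_PiE) auto
  have weight: "exp (- cst x) / 2 \<le> (\<Sum>f\<in>F x. \<Prod>a\<in>C. w (f a))" for x
  proof -
    define g where "g a = (\<Sum>l\<in>allowed (W x) (R x) (mem x i\<^sub>1) a. w l)" for a
    \<comment> \<open>Independence of the labels turns the probability of compatibility into a
      product over cells, which is split according to membership in \<open>W x\<close> and
      \<open>R x\<close>.\<close>
    have "(\<Sum>f\<in>F x. \<Prod>a\<in>C. w (f a)) = (\<Prod>a\<in>C. g a)"
      unfolding F_def g_def by (rule prod_sum_PiE[symmetric]) (auto simp: fC allowed_def)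
    also have "prod g C = prod g (((W x \<inter> R x) \<union> (W x - R x)) \<union> ((R x - W x) \<union> (C - W x - R x)))"
      using WC[of x] by (intro arg_cong[of _ _ "prod g"]) blast
    also have "\<dots> = (prod g (W x \<inter> R x) * prod g (W x - R x)) * (prod g (R x - W x) * prod g (C - W x - R x))"
    proof -
      have fin: "finite (W x)" "finite (R x)" using WC[of x] fC by (auto intro: finite_subset)
      show ?thesis
        using fin fC by (subst prod.union_disjoint;
          (subst prod.union_disjoint prod.union_disjoint)?; blast?)+
    qed
    also have "prod g (W x \<inter> R x) = (1 / 8 ^ b) ^ card (W x \<inter> R x)"
      by (simp add: g_def allowed_def w_def)
    also have "prod g (W x - R x) = w\<^sub>r ^ card (W x - R x)"
      by (simp add: g_def allowed_def w_def)
    also have "prod g (R x - W x) = w\<^sub>o ^ card (R x - W x)"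
      by (simp add: g_def allowed_def w_def)
    also have "prod g (C - W x - R x) = (1 - 1 / 4 ^ b) ^ card (C - W x - R x)"
      using w by (simp add: g_def allowed_def w_def)
    finally have eq: "(\<Sum>f\<in>F x. \<Prod>a\<in>C. w (f a)) = (1 / 8 ^ b) ^ card (W x \<inter> R x) * w\<^sub>r ^ card (W x - R x) *
        (w\<^sub>o ^ card (R x - W x) * (1 - 1 / 4 ^ b) ^ card (C - W x - R x))" .
    have p1: "(1 / 8 ^ b) ^ k = exp (- (real k * (3 * real b * ln 2)))" for k
    proof -
      have "(8::real) = exp (3 * ln 2)"
        by (simp add: exp_of_nat_mult[of 3, simplified])
      then have "(8::real) ^ b = exp (3 * real b * ln 2)"
        by (metis exp_of_nat_mult mult.assoc mult.commute)
      then show ?thesis by (simp add: exp_minus exp_of_nat_mult power_one_over inverse_eq_divide)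
    qed
    have p2: "v ^ k = exp (- (real k * (- ln v)))" if "v > 0" for v :: real and k
      using that by (simp add: exp_of_nat_mult)
    \<comment> \<open>At most \<open>2 ^ b\<close> cells are unprobed, each with weight
      \<open>1 - 1 / 4 ^ b\<close>. Bernoulli's inequality keeps their product at least
      \<open>1 / 2\<close>; this is the origin of the \<open>- ln 2\<close> in the
      statement.\<close>
    have "1 / 2 \<le> 1 + real (card (C - W x - R x)) * (- 1 / 4 ^ b)"
    proof -
      have "card (C - W x - R x) \<le> card C"
        by (intro card_mono fC) blast
      then have "real (card (C - W x - R x)) \<le> 2 ^ b"
        unfolding cC by (simp flip: of_nat_le_iff)
      then have "real (card (C - W x - R x)) * (1 / 4 ^ b) \<le> 2 ^ b * (1 / 4 ^ b)"
        by (intro mult_right_mono) auto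
      also have "\<dots> = 1 / 2 ^ b" by (simp add: field_simps flip: power_mult_distrib)
      also have "\<dots> \<le> 1 / 2" using b power_increasing[of 1 b "2::real"] by (simp add: field_simps)
      finally show ?thesis by simp
    qed
    also have "\<dots> \<le> (1 + (- 1 / 4 ^ b)) ^ card (C - W x - R x)"
      by (intro Bernoulli_inequality) (simp add: field_simps)
    finally have B: "1 / 2 \<le> (1 - 1 / 4 ^ b :: real) ^ card (C - W x - R x)" by simp
    have "exp (- cst x) / 2 = (1 / 8 ^ b) ^ card (W x \<inter> R x) * w\<^sub>r ^ card (W x - R x) *
        (w\<^sub>o ^ card (R x - W x) * (1 / 2))"
      unfolding p1 p2[OF w(1)] p2[OF w(2)] cst_def by (simp add: minus_add exp_add[symmetric])
    also have "\<dots> \<le> (\<Sum>f\<in>F x. \<Prod>a\<in>C. w (f a))"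
      unfolding eq using B w by (intro mult_left_mono) auto
    finally show ?thesis .
  qed
  \<comment> \<open>By \<open>compatible_unique\<close> a common labelling forces equal answers, and
    by \<open>inj\<close> equal answers force equal inputs, once the values outside \<open>Y\<close>
    are fixed.\<close>
  have uniq: "card {x \<in> X. f \<in> F x} \<le> card V ^ (card U - card Y)" for f
  proof -
    have "inj_on (\<lambda>x. restrict x (U - Y)) {x \<in> X. f \<in> F x}"
    proof (rule inj_onI)
      fix x x' assume x: "x \<in> {x \<in> X. f \<in> F x}" "x' \<in> {x \<in> X. f \<in> F x}"
        and eq: "restrict x (U - Y) = restrict x' (U - Y)"
      have xf: "x \<in> X" "x' \<in> X" "f \<in> F x" "f \<in> F x'" using x by simp_all
      have agree: "x i = x' i" if "i \<notin> Y" for i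
      proof (cases "i \<in> U")
        case True
        then show ?thesis using that fun_cong[OF eq, of i] by simp
      next
        case False
        then show ?thesis using xf(1,2) by (simp add: PiE_arb[of _ U])
      qed
      have "\<forall>t\<in>{i\<^sub>1..<i\<^sub>2}. s t x = s t x'"
      proof (rule compatible_unique[OF i Y(1) xf(1,2) agree])
        fix a :: nat assume "a < 2 ^ b"
        then have "a \<in> C" by (simp add: C_def)
        then show "f a \<in> allowed (\<Union>(probes x ` {i\<^sub>0..<i\<^sub>1})) (\<Union>(probes x ` {i\<^sub>1..<i\<^sub>2})) (mem x i\<^sub>1) a"
          and "f a \<in> allowed (\<Union>(probes x' ` {i\<^sub>0..<i\<^sub>1})) (\<Union>(probes x' ` {i\<^sub>1..<i\<^sub>2})) (mem x' i\<^sub>1) a"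
          using xf(3,4) by (simp_all only: F_def PiE_iff W_def R_def)
      qed
      then show "x = x'" by (intro inj xf agree) simp_all
    qed
    moreover have "(\<lambda>x. restrict x (U - Y)) ` {x \<in> X. f \<in> F x} \<subseteq> (U - Y) \<rightarrow>\<^sub>E V"
      by auto
    ultimately have "card {x \<in> X. f \<in> F x} \<le> card ((U - Y) \<rightarrow>\<^sub>E V)"
      using U V by (intro card_inj_on_le) (auto intro: finite_PiE)
    also have "\<dots> = card V ^ (card U - card Y)"
      using U Y by (simp add: card_PiE card_Diff_subset finite_subset)
    finally show ?thesis .
  qed
  have "(\<Sum>x\<in>X. exp (- cst x)) = 2 * (\<Sum>x\<in>X. exp (- cst x) / 2)"
    by (simp flip: sum_divide_distrib)
  also have "\<dots> \<le> 2 * (\<Sum>x\<in>X. \<Sum>f\<in>F x. \<Prod>a\<in>C. w (f a))"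
    using weight by (intro mult_left_mono sum_mono) auto
  also have "(\<Sum>x\<in>X. \<Sum>f\<in>F x. \<Prod>a\<in>C. w (f a)) =
      (\<Sum>x\<in>X. \<Sum>f\<in>PiE C (\<lambda>_. L). if f \<in> F x then \<Prod>a\<in>C. w (f a) else 0)"
  proof (rule sum.cong)
    fix x
    show "(\<Sum>f\<in>F x. \<Prod>a\<in>C. w (f a)) = (\<Sum>f\<in>PiE C (\<lambda>_. L). if f \<in> F x then \<Prod>a\<in>C. w (f a) else 0)"
      using F_L[of x] fF by (simp add: sum.inter_restrict[symmetric] Int_absorb1)
  qed simp
  \<comment> \<open>Double counting: the inner sum becomes the number of inputs compatible with a
    random labelling, which \<open>uniq\<close> bounds pointwise.\<close>
  also have "\<dots> = (\<Sum>f\<in>PiE C (\<lambda>_. L). \<Sum>x\<in>X. if f \<in> F x then \<Prod>a\<in>C. w (f a) else 0)"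
    by (rule sum.swap)
  also have "\<dots> = (\<Sum>f\<in>PiE C (\<lambda>_. L). real (card {x \<in> X. f \<in> F x}) * (\<Prod>a\<in>C. w (f a)))"
    using finite_X by (intro sum.cong refl) (simp add: sum.inter_filter[symmetric])
  also have "\<dots> \<le> (\<Sum>f\<in>PiE C (\<lambda>_. L). real (card V ^ (card U - card Y)) * (\<Prod>a\<in>C. w (f a)))"
    using uniq w_pos by (intro sum_mono mult_right_mono prod_nonneg of_nat_mono) (auto intro: less_imp_le)
  also have "\<dots> = real (card V ^ (card U - card Y)) * (\<Prod>a\<in>C. \<Sum>l\<in>L. w l)"
    using fC fL by (subst prod_sum_PiE) (auto simp: sum_distrib_left)
  also have "\<dots> = real (card V ^ (card U - card Y))"
    by (simp add: w_sum)
  finally have main: "(\<Sum>x\<in>X. exp (- cst x)) \<le> 2 * real (card V ^ (card U - card Y))" by simp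
  have cV: "card V > 0" using V by (simp add: card_gt_0_iff)
  have cY: "card Y \<le> card U" using U Y by (simp add: card_mono)
  have q1: "real (card X) / (2 * real (card V ^ (card U - card Y))) = real (card V) ^ card Y / 2"
  proof -
    have "card X = card V ^ card U" using U by (simp add: card_PiE)
    also have "\<dots> = card V ^ card Y * card V ^ (card U - card Y)"
      using cY by (simp flip: power_add)
    finally show ?thesis using cV by simp
  qed
  have q2: "ln (real (card V) ^ card Y / 2) = real (card Y) * ln (real (card V)) - ln 2"
    using cV by (simp add: ln_div ln_realpow)
  have "real (card X) * (real (card Y) * ln (real (card V)) - ln 2) \<le> (\<Sum>x\<in>X. cst x)"
    using sum_ge_of_sum_exp_le[OF finite_X X_nonempty _ main, unfolded q1 q2] cV by simp
  then show ?thesis by (simp add: cst_def W_def R_def Let_def)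
qed

end

section \<open>Digit reversal\<close>

primrec digit_rev :: "nat \<Rightarrow> nat \<Rightarrow> nat \<Rightarrow> nat" where
  "digit_rev B 0 i = 0"
| "digit_rev B (Suc d) i = (i mod B) * B ^ d + digit_rev B d (i div B)"

lemma two_digits_less:
  fixes q i B m :: nat
  assumes "q < m" "i < B"
  shows "q * B + i < m * B"
proof -
  have "q * B + i < Suc q * B" using assms by simp
  also have "\<dots> \<le> m * B" using assms by (intro mult_right_mono) auto
  finally show ?thesis .
qed

lemma digit_rev_less: "B > 0 \<Longrightarrow> digit_rev B d i < B ^ d"
  by (induction d arbitrary: i) (auto simp: two_digits_less)

text \<open>Reversal exchanges the two blocks of digits: the low \<open>h\<close> digits of a time,
  its place inside a node of height \<open>h\<close>, choose the slot, and the high digits, which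
  name the node, give the offset within the slot.\<close>

lemma digit_rev_add:
  "digit_rev B (h + k) i = digit_rev B h (i mod B ^ h) * B ^ k + digit_rev B k (i div B ^ h)"
proof (induction h arbitrary: i)
  case (Suc h)
  have "i mod (B * B ^ h) mod B = i mod B"
    by (simp add: mod_mod_cancel)
  moreover have "i mod (B * B ^ h) div B = i div B mod B ^ h"
    by (cases "B = 0") (simp_all add: mod_mult2_eq)
  moreover have "i div (B * B ^ h) = i div B div B ^ h"
    by (simp add: div_mult2_eq)
  ultimately show ?case
    using Suc[of "i div B"] by (simp add: algebra_simps power_add)
qed auto

lemma digit_rev_inj:
  assumes "B > 0"
  shows "inj_on (digit_rev B d) {..<B ^ d}"
proof (induction d)
  case (Suc d)
  show ?case
  proof (rule inj_onI)
    fix i j assume ij: "i \<in> {..<B ^ Suc d}" "j \<in> {..<B ^ Suc d}"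
      and eq: "digit_rev B (Suc d) i = digit_rev B (Suc d) j"
    note less = digit_rev_less[OF assms, of d "i div B"] digit_rev_less[OF assms, of d "j div B"]
    have "i mod B = digit_rev B (Suc d) i div B ^ d" "j mod B = digit_rev B (Suc d) j div B ^ d"
      using less assms by simp_all
    then have 1: "i mod B = j mod B" using eq by simp
    then have "digit_rev B d (i div B) = digit_rev B d (j div B)" using eq by simp
    moreover have "i div B < B ^ d" "j div B < B ^ d"
      using ij by (simp_all add: less_mult_imp_div_less mult.commute)
    ultimately have "i div B = j div B" using Suc by (auto dest: inj_onD)
    with 1 show "i = j" by (metis div_mult_mod_eq)
  qed
qed (auto simp: inj_on_def)

lemma digit_rev_surj:
  assumes "B > 0" "g < B ^ d"
  shows "\<exists>i < B ^ d. digit_rev B d i = g"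
proof -
  have "digit_rev B d ` {..<B ^ d} = {..<B ^ d}"
    using digit_rev_less[OF assms(1)] by (intro endo_inj_surj digit_rev_inj assms) auto
  then show ?thesis using assms(2) by (metis (full_types) imageE lessThan_iff)
qed

lemma digit_rev_mod:
  assumes "i < B ^ Suc h"
  shows "digit_rev B (Suc h) i mod B = i div B ^ h"
proof -
  have "i div B ^ h < B" using assms by (simp add: less_mult_imp_div_less)
  then show ?thesis using digit_rev_add[of B h 1 i] by simp
qed

text \<open>For two interleaved progressions of step \<open>W\<close>, the offsets shift the
  comparison of slots by 0 or 1. This shift is the \<open>e\<close> of both separation lemmas
  below.\<close>

lemma slot_le_iff:
  fixes g g' W r s :: nat
  assumes "r < W" "s < W"
  shows "g * W + r \<le> g' * W + s \<longleftrightarrow> g + (if r \<le> s then 0 else 1) \<le> g'"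
proof (cases "g < g'")
  case True
  then have "g * W + r < g' * W" using assms(1) by (rule two_digits_less)
  then show ?thesis using True by simp
next
  case False
  show ?thesis
  proof (cases "g = g'")
    case False
    then have "g' * W + s < g * W" using \<open>\<not> g < g'\<close> assms(2) by (intro two_digits_less) auto
    then show ?thesis using False \<open>\<not> g < g'\<close> by simp
  qed auto
qed

lemma card_last_digit_ge:
  fixes B :: nat
  assumes "B > 0" "h \<ge> 1" "S \<subseteq> {..<B}" "2 * card S \<ge> B"
  shows "B ^ h \<le> 2 * card {g. g < B ^ h \<and> g mod B \<in> S}"
proof -
  obtain h' where h: "h = Suc h'" using assms(2) by (cases h) auto
  have fin: "finite S" using assms(3) finite_subset by blast
  have "B ^ h \<le> B ^ h' * (2 * card S)" using assms(4) by (simp add: h)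
  also have "\<dots> = 2 * card ({..<B ^ h'} \<times> S)" by (simp add: card_cartesian_product)
  also have "card ({..<B ^ h'} \<times> S) \<le> card {g. g < B ^ h \<and> g mod B \<in> S}"
  proof (rule card_inj_on_le)
    show "inj_on (\<lambda>(q, i). q * B + i) ({..<B ^ h'} \<times> S)"
    proof (rule inj_onI, clarify)
      fix q i q' i' assume "i \<in> S" "i' \<in> S" and eq: "q * B + i = q' * B + i'"
      then have "i < B" "i' < B" using assms(3) by auto
      then have "q = (q * B + i) div B" "q' = (q' * B + i') div B"
          "i = (q * B + i) mod B" "i' = (q' * B + i') mod B" by simp_all
      then show "q = q' \<and> i = i'" using eq by metis
    qed
    show "(\<lambda>(q, i). q * B + i) ` ({..<B ^ h'} \<times> S) \<subseteq> {g. g < B ^ h \<and> g mod B \<in> S}"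
      using assms(3) two_digits_less[of _ "B ^ h'" _ B] by (fastforce simp: h mult.commute)
  qed simp
  finally show ?thesis by simp
qed

text \<open>
  Time steps run through \<open>{..<B ^ D}\<close>. The operation kind that occurs at every step uses the
  positions \<open>dense_pos\<close>; the other kind occurs at the multiples of \<open>B\<close> only and uses \<open>sparse_pos\<close>.
\<close>

definition dense_pos :: "nat \<Rightarrow> nat \<Rightarrow> nat \<Rightarrow> nat" where
  "dense_pos B D t = digit_rev B D t"

text \<open>For a multiple \<open>t\<close> of \<open>B\<close> the plain reversal of all
  \<open>D\<close> digits would stay below \<open>B ^ (D - 1)\<close>; the factor \<open>B\<close>
  spreads the sparse positions over the whole range.\<close>

definition sparse_pos :: "nat \<Rightarrow> nat \<Rightarrow> nat \<Rightarrow> nat" where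
  "sparse_pos B D t = digit_rev B (D - 1) (t div B) * B"

lemma dense_pos_less: "B > 0 \<Longrightarrow> dense_pos B D t < B ^ D"
  by (simp add: dense_pos_def digit_rev_less)

lemma sparse_pos_less:
  assumes "B > 0" "D > 0"
  shows "sparse_pos B D t < B ^ D"
  using two_digits_less[OF digit_rev_less[OF assms(1), of "D - 1" "t div B"] assms(1)] assms
  by (cases D) (auto simp: sparse_pos_def mult.commute)

lemma dense_pos_inj: "B > 0 \<Longrightarrow> inj_on (dense_pos B D) {..<B ^ D}"
  unfolding dense_pos_def by (rule digit_rev_inj)

lemma sparse_pos_inj:
  assumes "B > 0" "D > 0"
  shows "inj_on (sparse_pos B D) {t \<in> {..<B ^ D}. B dvd t}"
proof (rule inj_onI)
  fix t t' assume t: "t \<in> {t \<in> {..<B ^ D}. B dvd t}" "t' \<in> {t \<in> {..<B ^ D}. B dvd t}"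
    and eq: "sparse_pos B D t = sparse_pos B D t'"
  have "B ^ D = B ^ (D - 1) * B" using assms by (cases D) auto
  then have "t div B < B ^ (D - 1)" "t' div B < B ^ (D - 1)"
    using t by (auto simp: less_mult_imp_div_less)
  then have "t div B = t' div B"
    using eq assms digit_rev_inj[OF assms(1), of "D - 1"]
    by (auto simp: sparse_pos_def dest: inj_onD)
  then show "t = t'" using t by (metis (lifting) dvd_mult_div_cancel mem_Collect_eq)
qed

text \<open>The prefix sums asked at the times \<open>T\<close> form a triangular system in the
  updates made at the times \<open>Y\<close>; \<open>up\<close> and \<open>qp\<close> give the
  positions of updates and queries.\<close>

definition separates :: "(nat \<Rightarrow> nat) \<Rightarrow> (nat \<Rightarrow> nat) \<Rightarrow> nat set \<Rightarrow> nat set \<Rightarrow> bool" where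
  "separates up qp Y T \<longleftrightarrow>
     (\<forall>y\<in>Y. \<exists>t\<in>T. up y \<le> qp t \<and> (\<forall>y'\<in>Y. up y' \<le> qp t \<longrightarrow> up y' \<le> up y))"

text \<open>
  Below, \<open>u\<close> is the \<open>u\<close>-th node of height \<open>h\<close> in the time tree. The positions used within its
  parent are spread over \<open>B ^ h\<close> slots of width \<open>W\<close>: the dense ones in the node hit every slot at
  offset \<open>r\<close>, and the sparse ones in the parent hit every slot at offset \<open>s\<close>, where the
  slot modulo \<open>B\<close> is the index of the child.
\<close>

context
  fixes B h k u r s W :: nat and time :: "nat \<Rightarrow> nat"
  assumes B: "B > 0" and h: "h \<ge> 1"
  defines "W \<equiv> B ^ Suc k" and "r \<equiv> digit_rev B (Suc k) u" and "s \<equiv> digit_rev B k (u div B) * B"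
    and "time \<equiv> \<lambda>g. SOME i. i < B ^ h \<and> digit_rev B h i = g"
begin

text \<open>\<open>digit_rev B h\<close> permutes \<open>{..<B ^ h}\<close> and \<open>time\<close>
  inverts it. The leading digit of a time, which decides the child that contains a sparse operation
  of the parent, is the last digit of its slot.\<close>

lemma time:
  assumes "g < B ^ h"
  shows "time g < B ^ h" "digit_rev B h (time g) = g" "time g div B ^ (h - 1) = g mod B"
proof -
  show t: "time g < B ^ h" "digit_rev B h (time g) = g"
    using someI_ex[OF digit_rev_surj[OF B assms]] by (auto simp: time_def)
  show "time g div B ^ (h - 1) = g mod B"
    using digit_rev_mod[of "time g" B "h - 1"] t h by simp
qed

lemma residues_less: "r < W" "s < W"
  using digit_rev_less[OF B, of "Suc k" u]
    two_digits_less[OF digit_rev_less[OF B, of k "u div B"] B]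
  by (auto simp: r_def s_def W_def mult.commute)

lemma dense_pos_time:
  assumes "g < B ^ h"
  shows "dense_pos B (h + Suc k) (u * B ^ h + time g) = g * W + r"
  unfolding dense_pos_def digit_rev_add W_def r_def
  using time[OF assms] B by (simp del: digit_rev.simps power_Suc)

lemma sparse_pos_time:
  assumes "g < B ^ h"
  shows "sparse_pos B (h + Suc k) (B * ((u div B) * B ^ h + time g)) = g * W + s"
  using time[OF assms] B
  by (simp add: sparse_pos_def digit_rev_add W_def s_def algebra_simps)

lemma dense_time: "g < B ^ h \<Longrightarrow> u * B ^ h + time g \<in> {u * B ^ h..<(u + 1) * B ^ h}"
  using time(1)[of g] by simp

lemma power_h: "B ^ h = B * B ^ (h - 1)"
  using h by (cases h) auto

lemma sparse_time_right:
  assumes "g < B ^ h" "u mod B < g mod B"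
  shows "B * ((u div B) * B ^ h + time g) \<in> {(u + 1) * B ^ h..<(u div B + 1) * B ^ (h + 1)}"
proof -
  have "u + 1 \<le> B * (u div B) + g mod B"
    using mult_div_mod_eq[of B u] assms by linarith
  then have "(u + 1) * B ^ h \<le> (B * (u div B) + g mod B) * B ^ h"
    by (rule mult_right_mono) simp
  also have "\<dots> = B * ((u div B) * B ^ h + (time g div B ^ (h - 1)) * B ^ (h - 1))"
    using time(3)[OF assms(1)] power_h by (simp add: algebra_simps)
  also have "\<dots> \<le> B * ((u div B) * B ^ h + time g)"
    by (intro mult_left_mono add_left_mono div_times_less_eq_dividend) auto
  finally have 1: "(u + 1) * B ^ h \<le> B * ((u div B) * B ^ h + time g)" .
  have "B * ((u div B) * B ^ h + time g) < B * ((u div B) * B ^ h + B ^ h)"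
    using time(1)[OF assms(1)] B by simp
  then show ?thesis using 1 by (simp add: algebra_simps)
qed

lemma sparse_time_left:
  assumes "g < B ^ h" "g mod B < u mod B"
  shows "B * ((u div B) * B ^ h + time g) \<in> {(u div B) * B ^ (h + 1)..<u * B ^ h}"
proof -
  have "time g < (time g div B ^ (h - 1) + 1) * B ^ (h - 1)"
    using B by (simp add: dividend_less_div_times)
  also have "\<dots> \<le> (u mod B) * B ^ (h - 1)"
    using assms time(3)[OF assms(1)] by (intro mult_right_mono) auto
  finally have "B * ((u div B) * B ^ h + time g) < B * ((u div B) * B ^ h + (u mod B) * B ^ (h - 1))"
    using B by simp
  also have "\<dots> = (B * (u div B) + u mod B) * B ^ h"
    unfolding power_h by (simp only: algebra_simps)
  also have "\<dots> = u * B ^ h" by (simp only: mult_div_mod_eq)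
  finally show ?thesis by (simp add: algebra_simps)
qed

text \<open>The usable slots are those hit by a query in a later sibling; for \<open>u\<close> in
  the left half of its siblings they are at least half of all slots. Each such query is paired with
  the largest update position of the node that its prefix covers, \<open>e\<close> slots further
  left.\<close>

lemma separated_dense_updates:
  assumes j: "2 * (u mod B) + 2 \<le> B"
  obtains Y where "Y \<subseteq> {u * B ^ h..<(u + 1) * B ^ h}" "B ^ h \<le> 2 * card Y"
    "separates (dense_pos B (h + Suc k)) (sparse_pos B (h + Suc k)) Y
       {t \<in> {(u + 1) * B ^ h..<(u div B + 1) * B ^ (h + 1)}. B dvd t}"
proof -
  define e where "e = (if r \<le> s then 0 else 1 :: nat)"
  define G where "G = {g. g < B ^ h \<and> g mod B \<in> {u mod B<..<B}}"
  define Y where "Y = (\<lambda>g. u * B ^ h + time (g - e)) ` G"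
  \<comment> \<open>\<open>1 \<le> g\<close> keeps \<open>g - e\<close> from being truncated: the
    last digit of \<open>g\<close> exceeds \<open>u mod B\<close> and is therefore positive.\<close>
  have G: "g < B ^ h" "u mod B < g mod B" "1 \<le> g" if "g \<in> G" for g
    using that by (auto simp: G_def Suc_le_eq intro: gr0I)
  have e: "e \<le> 1" by (simp add: e_def)
  have cmp: "dense_pos B (h + Suc k) (u * B ^ h + time g) \<le>
      sparse_pos B (h + Suc k) (B * ((u div B) * B ^ h + time g')) \<longleftrightarrow> g + e \<le> g'"
    if "g < B ^ h" "g' < B ^ h" for g g'
    unfolding dense_pos_time[OF that(1)] sparse_pos_time[OF that(2)] e_def
    by (rule slot_le_iff) (rule residues_less)+
  have "inj_on (\<lambda>g. u * B ^ h + time (g - e)) G"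
  proof (rule inj_onI)
    fix g g' assume g: "g \<in> G" "g' \<in> G" and "u * B ^ h + time (g - e) = u * B ^ h + time (g' - e)"
    then have "digit_rev B h (time (g - e)) = digit_rev B h (time (g' - e))" by simp
    moreover have "g - e < B ^ h" "g' - e < B ^ h" using G(1)[of g] G(1)[of g'] g by linarith+
    ultimately have "g - e = g' - e" by (simp only: time(2))
    then show "g = g'" using G(3)[of g] G(3)[of g'] g e by simp
  qed
  then have "card Y = card G" unfolding Y_def by (rule card_image)
  moreover have "B ^ h \<le> 2 * card G"
    unfolding G_def using j by (intro card_last_digit_ge B h) auto
  ultimately have "B ^ h \<le> 2 * card Y" by simp
  moreover have "Y \<subseteq> {u * B ^ h..<(u + 1) * B ^ h}"
    unfolding Y_def
  proof safe
    fix g assume "g \<in> G"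
    then have "g - e < B ^ h" using G(1)[of g] by linarith
    then show "u * B ^ h + time (g - e) \<in> {u * B ^ h..<(u + 1) * B ^ h}" by (rule dense_time)
  qed
  moreover have "separates (dense_pos B (h + Suc k)) (sparse_pos B (h + Suc k)) Y
       {t \<in> {(u + 1) * B ^ h..<(u div B + 1) * B ^ (h + 1)}. B dvd t}"
    unfolding separates_def
  proof
    fix y assume "y \<in> Y"
    then obtain g where g: "g \<in> G" and y: "y = u * B ^ h + time (g - e)" by (auto simp: Y_def)
    note Gg = G[OF g]
    have ge: "g - e < B ^ h" "g - e + e = g" using Gg e by linarith+
    let ?t = "B * ((u div B) * B ^ h + time g)"
    have 1: "?t \<in> {t \<in> {(u + 1) * B ^ h..<(u div B + 1) * B ^ (h + 1)}. B dvd t}"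
      using sparse_time_right[OF Gg(1,2)] by simp
    have 2: "dense_pos B (h + Suc k) y \<le> sparse_pos B (h + Suc k) ?t"
      unfolding y cmp[OF ge(1) Gg(1)] using ge by simp
    have 3: "dense_pos B (h + Suc k) y' \<le> dense_pos B (h + Suc k) y"
      if y': "y' \<in> Y" and le: "dense_pos B (h + Suc k) y' \<le> sparse_pos B (h + Suc k) ?t" for y'
    proof -
      obtain g' where g': "g' \<in> G" and y': "y' = u * B ^ h + time (g' - e)"
        using y' by (auto simp: Y_def)
      have ge': "g' - e < B ^ h" using G(1)[OF g'] by linarith
      have "g' - e \<le> g - e" using le ge unfolding y' cmp[OF ge' Gg(1)] by linarith
      then show ?thesis unfolding y y' dense_pos_time[OF ge'] dense_pos_time[OF ge(1)] by simp
    qed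
    show "\<exists>t\<in>{t \<in> {(u + 1) * B ^ h..<(u div B + 1) * B ^ (h + 1)}. B dvd t}.
        dense_pos B (h + Suc k) y \<le> sparse_pos B (h + Suc k) t \<and>
        (\<forall>y'\<in>Y. dense_pos B (h + Suc k) y' \<le> sparse_pos B (h + Suc k) t \<longrightarrow>
           dense_pos B (h + Suc k) y' \<le> dense_pos B (h + Suc k) y)"
      using 1 2 3 by blast
  qed
  ultimately show ?thesis using that by blast
qed

text \<open>Mirror image: the usable slots are those hit by an update in an earlier sibling, and
  each of these is paired with the smallest query position of the node that reaches it,
  \<open>e\<close> slots further right.\<close>

lemma separated_sparse_updates:
  assumes j: "B \<le> 2 * (u mod B)"
  obtains Y where "Y \<subseteq> {t \<in> {(u div B) * B ^ (h + 1)..<u * B ^ h}. B dvd t}" "B ^ h \<le> 2 * card Y"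
    "separates (sparse_pos B (h + Suc k)) (dense_pos B (h + Suc k)) Y {u * B ^ h..<(u + 1) * B ^ h}"
proof -
  define e where "e = (if s \<le> r then 0 else 1 :: nat)"
  define G where "G = {g. g < B ^ h \<and> g mod B \<in> {..<u mod B}}"
  define f where "f g = B * ((u div B) * B ^ h + time g)" for g
  define Y where "Y = f ` G"
  have uB: "u mod B < B" using B by simp
  have G: "g < B ^ h" "g mod B < u mod B" "g + e < B ^ h" if "g \<in> G" for g
  proof -
    show g: "g < B ^ h" "g mod B < u mod B" using that by (auto simp: G_def)
    \<comment> \<open>The last slot has last digit \<open>B - 1\<close>, so no update of an earlier
      sibling hits it, and the shift by \<open>e\<close> stays in range.\<close>
    have "g + 1 \<noteq> B ^ h"
    proof
      assume "g + 1 = B ^ h"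
      then have "B dvd g + 1" using power_h by simp
      then have "Suc (g mod B) mod B = 0" by (simp add: mod_Suc_eq)
      then show False using g(2) uB by simp
    qed
    then show "g + e < B ^ h" using g(1) by (simp add: e_def)
  qed
  have cmp: "sparse_pos B (h + Suc k) (f g) \<le> dense_pos B (h + Suc k) (u * B ^ h + time g') \<longleftrightarrow> g + e \<le> g'"
    if "g < B ^ h" "g' < B ^ h" for g g'
    unfolding dense_pos_time[OF that(2)] sparse_pos_time[OF that(1)] e_def f_def
    by (rule slot_le_iff) (rule residues_less)+
  have "inj_on f G"
  proof (rule inj_onI)
    fix g g' assume g: "g \<in> G" "g' \<in> G" and "f g = f g'"
    then have "digit_rev B h (time g) = digit_rev B h (time g')" using B by (simp add: f_def)
    then show "g = g'" by (simp only: time(2) G(1) g)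
  qed
  then have "card Y = card G" unfolding Y_def by (rule card_image)
  moreover have "B ^ h \<le> 2 * card G"
    unfolding G_def using j uB by (intro card_last_digit_ge B h) auto
  ultimately have "B ^ h \<le> 2 * card Y" by simp
  moreover have "Y \<subseteq> {t \<in> {(u div B) * B ^ (h + 1)..<u * B ^ h}. B dvd t}"
    unfolding Y_def f_def using sparse_time_left G by auto
  moreover have "separates (sparse_pos B (h + Suc k)) (dense_pos B (h + Suc k)) Y {u * B ^ h..<(u + 1) * B ^ h}"
    unfolding separates_def
  proof
    fix y assume "y \<in> Y"
    then obtain g where g: "g \<in> G" and y: "y = f g" by (auto simp: Y_def)
    note Gg = G[OF g]
    let ?t = "u * B ^ h + time (g + e)"
    have 1: "?t \<in> {u * B ^ h..<(u + 1) * B ^ h}"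
      using dense_time[OF Gg(3)] .
    have 2: "sparse_pos B (h + Suc k) y \<le> dense_pos B (h + Suc k) ?t"
      unfolding y cmp[OF Gg(1,3)] by simp
    have 3: "sparse_pos B (h + Suc k) y' \<le> sparse_pos B (h + Suc k) y"
      if y': "y' \<in> Y" and le: "sparse_pos B (h + Suc k) y' \<le> dense_pos B (h + Suc k) ?t" for y'
    proof -
      obtain g' where g': "g' \<in> G" and y': "y' = f g'"
        using y' by (auto simp: Y_def)
      have "g' \<le> g" using le unfolding y' cmp[OF G(1)[OF g'] Gg(3)] by linarith
      then show ?thesis
        unfolding y y' f_def sparse_pos_time[OF G(1)[OF g']] sparse_pos_time[OF Gg(1)] by simp
    qed
    show "\<exists>t\<in>{u * B ^ h..<(u + 1) * B ^ h}.
        sparse_pos B (h + Suc k) y \<le> dense_pos B (h + Suc k) t \<and>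
        (\<forall>y'\<in>Y. sparse_pos B (h + Suc k) y' \<le> dense_pos B (h + Suc k) t \<longrightarrow>
           sparse_pos B (h + Suc k) y' \<le> sparse_pos B (h + Suc k) y)"
      using 1 2 3 by blast
  qed
  ultimately show ?thesis using that by blast
qed

end

section \<open>The time tree\<close>

lemma in_block_iff:
  fixes t u m :: nat
  assumes "m > 0"
  shows "t \<in> {u * m..<(u + 1) * m} \<longleftrightarrow> t div m = u"
proof
  assume "t \<in> {u * m..<(u + 1) * m}"
  then show "t div m = u" using assms by (intro div_nat_eqI) (auto simp: mult.commute)
next
  assume "t div m = u"
  then show "t \<in> {u * m..<(u + 1) * m}"
    using assms dividend_less_div_times[of m t] div_times_less_eq_dividend[of t m] by auto
qed

text \<open>
  Each pair of consecutive probes of a cell is counted only at the lowest common ancestor of the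
  two time steps in the time tree.
\<close>

lemma sum_transfers_le:
  fixes pr :: "nat \<Rightarrow> nat set" and T :: "nat \<Rightarrow> nat \<Rightarrow> nat set"
  assumes B: "B > 0" and fin: "\<And>t. finite (pr t)" and E: "\<And>h. E h \<subseteq> {..<B ^ (D - h)}"
    and sel: "\<And>S. finite S \<Longrightarrow> S \<noteq> {} \<Longrightarrow> sel S \<in> S"
      "\<And>S s. finite S \<Longrightarrow> s \<in> S \<Longrightarrow> \<not> beyond s (sel S)"
    and T: "\<And>h u. T h u \<subseteq> \<Union>(pr ` {u * B ^ h..<(u + 1) * B ^ h})"
      "\<And>h u c. c \<in> T h u \<Longrightarrow> \<exists>t'. t' div B ^ (h + 1) = u div B \<and> c \<in> pr t' \<and>
          (\<forall>t\<in>{u * B ^ h..<(u + 1) * B ^ h}. beyond t' t)"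
  shows "(\<Sum>h\<in>{1..<D}. \<Sum>u\<in>E h. card (T h u)) \<le> (\<Sum>t<B ^ D. card (pr t))"
proof -
  define L where "L h u c = {t \<in> {u * B ^ h..<(u + 1) * B ^ h}. c \<in> pr t}" for h u c
  \<comment> \<open>A transferred cell is charged to its probe in the node that is extremal towards
    the other interval: the last one for later siblings, the first one for earlier siblings.\<close>
  define tag where "tag h u c = sel (L h u c)" for h u c
  define S where "S = (SIGMA (h, u) : Sigma {1..<D} E. T h u)"
  define f where "f = (\<lambda>((h, u), c). (tag h u c, c))"
  have pos: "B ^ h > 0" for h using B by simp
  have finE: "finite (E h)" for h using E finite_subset by blast
  have finL: "finite (L h u c)" for h u c by (simp add: L_def)
  have finT: "finite (T h u)" for h u
    by (rule finite_subset[OF T(1)]) (simp add: fin)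
  have L: "tag h u c \<in> L h u c" if "c \<in> T h u" for h u c
    unfolding tag_def by (intro sel(1) finL) (use subsetD[OF T(1) that] in \<open>unfold L_def, blast\<close>)
  have tag: "tag h u c div B ^ h = u" "c \<in> pr (tag h u c)" if "c \<in> T h u" for h u c
    using L[OF that] in_block_iff[OF pos, of "tag h u c" u h] unfolding L_def by blast+
  have S: "((h, u), c) \<in> S \<longleftrightarrow> 1 \<le> h \<and> h < D \<and> u \<in> E h \<and> c \<in> T h u" for h u c
    by (auto simp: S_def)
  have "card S = (\<Sum>(h, u)\<in>Sigma {1..<D} E. card (T h u))"
    unfolding S_def using finE finT
    by (subst card_SigmaI) (auto intro!: sum.cong)
  also have "\<dots> = (\<Sum>h\<in>{1..<D}. \<Sum>u\<in>E h. card (T h u))"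
    by (rule sum.Sigma[symmetric]) (auto simp: finE)
  finally have "(\<Sum>h\<in>{1..<D}. \<Sum>u\<in>E h. card (T h u)) = card S" by simp
  also have "card S \<le> card (Sigma {..<B ^ D} pr)"
  proof (rule card_inj_on_le)
    show "finite (Sigma {..<B ^ D} pr)" using fin by auto
    show "f ` S \<subseteq> Sigma {..<B ^ D} pr"
    proof
      fix z assume "z \<in> f ` S"
      then obtain h u c where huc: "((h, u), c) \<in> S" and z: "z = (tag h u c, c)"
        by (auto simp: f_def)
      then have h: "h < D" "c \<in> T h u" and u: "u < B ^ (D - h)" using E[of h] by (auto simp: S)
      have "tag h u c < (u + 1) * B ^ h"
        using L[OF h(2)] by (simp add: L_def)
      also have "\<dots> \<le> B ^ (D - h) * B ^ h"
        using u by (intro mult_right_mono) auto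
      also have "\<dots> = B ^ D" using h by (simp flip: power_add)
      finally show "z \<in> Sigma {..<B ^ D} pr" using tag(2)[OF h(2)] by (simp add: z)
    qed
    \<comment> \<open>If one probe were charged at two heights, the higher node would contain the
      whole parent of the lower one. It would then contain the probe \<open>t'\<close> of the same
      cell, and the charged probe would not be extremal in it.\<close>
    have key: False
      if c: "c \<in> T h u" "c \<in> T h' u'" and eq: "tag h u c = tag h' u' c" and less: "h < h'"
      for h u h' u' c
    proof -
      obtain t' where t': "t' div B ^ (h + 1) = u div B" "c \<in> pr t'" "beyond t' (tag h u c)"
        using T(2)[OF c(1)] L[OF c(1)] unfolding L_def by blast
      have "tag h u c div B ^ (h + 1) = u div B"
        using tag(1)[OF c(1)] by (simp only: power_add power_one_right div_mult2_eq)
      moreover obtain d where d: "h' = h + 1 + d" using less by (metis Suc_eq_plus1 Suc_leI le_Suc_ex)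
      ultimately have "t' div B ^ h' = tag h' u' c div B ^ h'"
        using t'(1) eq by (simp only: d power_add[of B "h + 1" d] div_mult2_eq)
      then have "t' div B ^ h' = u'" using tag(1)[OF c(2)] by simp
      then have "t' \<in> L h' u' c"
        using t'(2) in_block_iff[OF pos, of t' u' h'] by (simp only: L_def mem_Collect_eq)
      then show False using sel(2)[OF finL] t'(3) eq by (simp add: tag_def)
    qed
    show "inj_on f S"
    proof (rule inj_onI)
      fix z z' assume z: "z \<in> S" "z' \<in> S" "f z = f z'"
      obtain h u c where z1: "z = ((h, u), c)" by (metis surj_pair)
      obtain h' u' c' where z2: "z' = ((h', u'), c')" by (metis surj_pair)
      have cc: "c' = c" and eq: "tag h u c = tag h' u' c" and c: "c \<in> T h u" "c \<in> T h' u'"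
        using z by (auto simp: z1 z2 f_def S)
      have "h = h'"
      proof (rule ccontr)
        assume "h \<noteq> h'"
        then consider "h < h'" | "h' < h" by linarith
        then show False
          by cases (use key[OF c eq] key[OF c(2,1) eq[symmetric]] in simp_all)
      qed
      moreover have "u = u'"
      proof -
        have "u = tag h u c div B ^ h" by (rule tag(1)[OF c(1), symmetric])
        also have "\<dots> = tag h' u' c div B ^ h'" by (simp only: eq) (simp only: \<open>h = h'\<close>)
        also have "\<dots> = u'" by (rule tag(1)[OF c(2)])
        finally show ?thesis .
      qed
      ultimately show "z = z'" by (simp add: z1 z2 cc)
    qed
  qed
  also have "\<dots> = (\<Sum>t<B ^ D. card (pr t))" using fin by (simp add: card_SigmaI)
  finally show ?thesis .
qed

lemma sum_transfers_right_le:
  fixes pr :: "nat \<Rightarrow> nat set"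
  assumes B: "B > 0" and "\<And>t. finite (pr t)" "\<And>h. E h \<subseteq> {..<B ^ (D - h)}"
  shows "(\<Sum>h\<in>{1..<D}. \<Sum>u\<in>E h. card (\<Union>(pr ` {u * B ^ h..<(u + 1) * B ^ h}) \<inter>
            \<Union>(pr ` {(u + 1) * B ^ h..<(u div B + 1) * B ^ (h + 1)}))) \<le> (\<Sum>t<B ^ D. card (pr t))"
proof (rule sum_transfers_le[where sel = Max and beyond = "\<lambda>t' t. t < t'", OF assms])
  fix h u c
  assume "c \<in> \<Union>(pr ` {u * B ^ h..<(u + 1) * B ^ h}) \<inter>
            \<Union>(pr ` {(u + 1) * B ^ h..<(u div B + 1) * B ^ (h + 1)})"
  then obtain t' where t': "(u + 1) * B ^ h \<le> t'" "t' < (u div B + 1) * B ^ (h + 1)" "c \<in> pr t'"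
    by auto
  have "(u div B) * B ^ (h + 1) \<le> u * B ^ h"
    using div_times_less_eq_dividend[of u B] by (simp flip: mult.assoc)
  also have "\<dots> \<le> (u + 1) * B ^ h" by simp
  finally have "(u div B) * B ^ (h + 1) \<le> t'" using t'(1) by simp
  then have "t' div B ^ (h + 1) = u div B"
    using t'(2) in_block_iff[of "B ^ (h + 1)" t' "u div B"] B by simp
  then show "\<exists>t'. t' div B ^ (h + 1) = u div B \<and> c \<in> pr t' \<and>
      (\<forall>t\<in>{u * B ^ h..<(u + 1) * B ^ h}. t < t')"
    using t' by (intro exI[of _ t']) auto
qed (auto dest: Max_ge leD)

lemma sum_transfers_left_le:
  fixes pr :: "nat \<Rightarrow> nat set"
  assumes B: "B > 0" and "\<And>t. finite (pr t)" "\<And>h. E h \<subseteq> {..<B ^ (D - h)}"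
  shows "(\<Sum>h\<in>{1..<D}. \<Sum>u\<in>E h. card (\<Union>(pr ` {(u div B) * B ^ (h + 1)..<u * B ^ h}) \<inter>
            \<Union>(pr ` {u * B ^ h..<(u + 1) * B ^ h}))) \<le> (\<Sum>t<B ^ D. card (pr t))"
proof (rule sum_transfers_le[where sel = Min and beyond = "\<lambda>t' t. t' < t", OF assms])
  fix h u c
  assume "c \<in> \<Union>(pr ` {(u div B) * B ^ (h + 1)..<u * B ^ h}) \<inter>
            \<Union>(pr ` {u * B ^ h..<(u + 1) * B ^ h})"
  then obtain t' where t': "(u div B) * B ^ (h + 1) \<le> t'" "t' < u * B ^ h" "c \<in> pr t'"
    by auto
  have "u < (u div B + 1) * B"
    using dividend_less_div_times[OF B, of u] by simp
  then have "u * B ^ h < ((u div B + 1) * B) * B ^ h"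
    using B by (intro mult_strict_right_mono) auto
  then have "t' < (u div B + 1) * B ^ (h + 1)"
    using t'(2) by (simp add: algebra_simps)
  then have "t' div B ^ (h + 1) = u div B"
    using t'(1) in_block_iff[of "B ^ (h + 1)" t' "u div B"] B by simp
  then show "\<exists>t'. t' div B ^ (h + 1) = u div B \<and> c \<in> pr t' \<and>
      (\<forall>t\<in>{u * B ^ h..<(u + 1) * B ^ h}. t' < t)"
    using t' by (intro exI[of _ t']) auto
qed (auto dest: Min_le leD)

section \<open>Probe counts over the intervals of one level\<close>

lemma sum_blocks:
  fixes f :: "nat \<Rightarrow> 'a :: comm_monoid_add"
  assumes "h \<le> D"
  shows "(\<Sum>u<B ^ (D - h). \<Sum>t\<in>{u * B ^ h..<(u + 1) * B ^ h}. f t) = (\<Sum>t<B ^ D. f t)"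
proof -
  have "B ^ (D - h) * B ^ h = B ^ D" using assms by (simp flip: power_add)
  then show ?thesis
    using sum.nat_group[of f "B ^ h" "B ^ (D - h)"] by (simp add: add.commute)
qed

text \<open>Each block of height \<open>h + 1\<close> is counted once for each of its
  \<open>B\<close> children. This factor is what the biased label weights have to absorb.\<close>

lemma sum_parent_blocks:
  fixes f :: "nat \<Rightarrow> nat"
  assumes "h < D" "B > 0"
  shows "(\<Sum>u<B ^ (D - h). \<Sum>t\<in>{(u div B) * B ^ (h + 1)..<(u div B + 1) * B ^ (h + 1)}. f t)
    = B * (\<Sum>t<B ^ D. f t)"
proof -
  define F where "F a = (\<Sum>t\<in>{a * B ^ (h + 1)..<(a + 1) * B ^ (h + 1)}. f t)" for a
  have eq: "B ^ (D - h) = B ^ (D - (h + 1)) * B"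
  proof -
    have "D - h = Suc (D - (h + 1))" using Suc_diff_Suc[OF assms(1)] by simp
    then show ?thesis by (simp only: power_Suc2)
  qed
  have "(\<Sum>u<B ^ (D - h). F (u div B)) = (\<Sum>a<B ^ (D - (h + 1)). \<Sum>u\<in>{a * B..<a * B + B}. F (u div B))"
    unfolding eq by (rule sum.nat_group[symmetric])
  also have "\<dots> = (\<Sum>a<B ^ (D - (h + 1)). \<Sum>u\<in>{a * B..<a * B + B}. F a)"
  proof (intro sum.cong refl)
    fix a u assume "u \<in> {a * B..<a * B + B}"
    then show "F (u div B) = F a" using in_block_iff[OF assms(2), of u a] by (simp add: add.commute)
  qed
  also have "\<dots> = B * (\<Sum>a<B ^ (D - (h + 1)). F a)" by (simp add: sum_distrib_left)
  also have "(\<Sum>a<B ^ (D - (h + 1)). F a) = (\<Sum>t<B ^ D. f t)"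
    unfolding F_def using assms by (intro sum_blocks) auto
  finally show ?thesis by (simp add: F_def)
qed

lemma card_Union_probes_le:
  fixes pr :: "nat \<Rightarrow> nat set"
  assumes "\<And>t. finite (pr t)" "S \<subseteq> \<Union>(pr ` I)" "finite I"
  shows "card S \<le> (\<Sum>t\<in>I. card (pr t))"
proof -
  have "card S \<le> card (\<Union>(pr ` I))" using assms by (intro card_mono) auto
  also have "\<dots> \<le> (\<Sum>t\<in>I. card (pr t))" using assms(3) by (rule card_UN_le)
  finally show ?thesis .
qed

lemma block_bounds:
  fixes B :: nat
  assumes B: "B > 0" and "h < D" "u < B ^ (D - h)"
  shows "(u div B) * B ^ (h + 1) \<le> u * B ^ h" "(u + 1) * B ^ h \<le> (u div B + 1) * B ^ (h + 1)"
    "(u div B + 1) * B ^ (h + 1) \<le> B ^ D"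
proof -
  show "(u div B) * B ^ (h + 1) \<le> u * B ^ h"
    using div_times_less_eq_dividend[of u B] by (simp flip: mult.assoc)
  have "u < (u div B + 1) * B"
    using dividend_less_div_times[OF B, of u] by simp
  then have "(u + 1) * B ^ h \<le> ((u div B + 1) * B) * B ^ h"
    by (intro mult_right_mono) auto
  then show "(u + 1) * B ^ h \<le> (u div B + 1) * B ^ (h + 1)"
    by (simp only: power_add power_one_right mult.assoc mult.commute[of B "B ^ h"])
  have "D - h = Suc (D - (h + 1))" using Suc_diff_Suc[OF assms(2)] by simp
  then have "u < B ^ (D - (h + 1)) * B" using assms(3) by (simp only: power_Suc2)
  then have "u div B < B ^ (D - (h + 1))" by (rule less_mult_imp_div_less)
  then have "(u div B + 1) * B ^ (h + 1) \<le> B ^ (D - (h + 1)) * B ^ (h + 1)"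
    by (intro mult_right_mono) auto
  also have "\<dots> = B ^ D" using assms(2) by (subst power_add[symmetric]) simp
  finally show "(u div B + 1) * B ^ (h + 1) \<le> B ^ D" .
qed

lemma sum_card_blocks_le:
  fixes pr :: "nat \<Rightarrow> nat set"
  assumes "\<And>t. finite (pr t)" "h \<le> D" "E \<subseteq> {..<B ^ (D - h)}"
    "\<And>u. S u \<subseteq> \<Union>(pr ` {u * B ^ h..<(u + 1) * B ^ h})"
  shows "(\<Sum>u\<in>E. card (S u)) \<le> (\<Sum>t<B ^ D. card (pr t))"
proof -
  have "(\<Sum>u\<in>E. card (S u)) \<le> (\<Sum>u\<in>E. \<Sum>t\<in>{u * B ^ h..<(u + 1) * B ^ h}. card (pr t))"
    by (rule sum_mono, rule card_Union_probes_le[where pr = pr]) (simp_all only: assms(1,4) finite_atLeastLessThan)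
  also have "\<dots> \<le> (\<Sum>u<B ^ (D - h). \<Sum>t\<in>{u * B ^ h..<(u + 1) * B ^ h}. card (pr t))"
    by (rule sum_mono2[OF finite_lessThan assms(3)]) simp
  also have "\<dots> = (\<Sum>t<B ^ D. card (pr t))" by (rule sum_blocks[OF assms(2)])
  finally show ?thesis .
qed

lemma sum_card_parent_blocks_le:
  fixes pr :: "nat \<Rightarrow> nat set"
  assumes "\<And>t. finite (pr t)" "h < D" "B > 0" "E \<subseteq> {..<B ^ (D - h)}"
    "\<And>u. u \<in> E \<Longrightarrow> S u \<subseteq> \<Union>(pr ` {(u div B) * B ^ (h + 1)..<(u div B + 1) * B ^ (h + 1)})"
  shows "(\<Sum>u\<in>E. card (S u)) \<le> B * (\<Sum>t<B ^ D. card (pr t))"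
proof -
  have "(\<Sum>u\<in>E. card (S u)) \<le>
      (\<Sum>u\<in>E. \<Sum>t\<in>{(u div B) * B ^ (h + 1)..<(u div B + 1) * B ^ (h + 1)}. card (pr t))"
    by (rule sum_mono, rule card_Union_probes_le[where pr = pr]) (simp_all only: assms(1,5) finite_atLeastLessThan)
  also have "\<dots> \<le> (\<Sum>u<B ^ (D - h).
      \<Sum>t\<in>{(u div B) * B ^ (h + 1)..<(u div B + 1) * B ^ (h + 1)}. card (pr t))"
    by (rule sum_mono2[OF finite_lessThan assms(4)]) simp
  also have "\<dots> = B * (\<Sum>t<B ^ D. card (pr t))" by (rule sum_parent_blocks[OF assms(2,3)])
  finally show ?thesis .
qed

text \<open>On one level at most \<open>C\<close> cells belong to short intervals and
  \<open>B * C\<close> to long ones, where \<open>C\<close> is the total probe count. At prices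
  \<open>\<beta> + 1\<close> and \<open>2 / B\<close> they cost at most
  \<open>(\<beta> + 3) * C\<close> together. \<open>\<beta> \<le> b\<close> makes the
  \<open>1 / 4 ^ b\<close> lost to contents smaller than the weight
  \<open>1 / (2 * B)\<close>.\<close>

lemma bias_weights:
  fixes \<beta> b :: nat
  assumes "\<beta> \<ge> 1" "\<beta> \<le> b"
  defines "B \<equiv> (2::real) ^ \<beta>"
  defines "w \<equiv> 1 / (2 * B)" and "w' \<equiv> 1 - 1 / 4 ^ b - 1 / (2 * B)"
  shows "w > 0" "w' > 0" "- ln w \<le> real \<beta> + 1" "- ln w' \<le> 2 / B" "- ln w' \<ge> 0" "- ln w \<ge> 0"
proof -
  have B: "B \<ge> 2" using assms(1) power_increasing[of 1 \<beta> "2::real"] by (simp add: B_def)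
  show "w > 0" using B by (simp add: w_def)
  have "2 * B \<le> 2 ^ (2 * b)"
    using assms power_increasing[of "Suc \<beta>" "2 * b" "2::real"] by (simp add: B_def)
  also have "\<dots> = 4 ^ b" by (simp add: power_mult)
  finally have "1 / 4 ^ b \<le> 1 / (2 * B)" using B by (intro divide_left_mono) auto
  then have w': "w' \<ge> 1 - 1 / B" by (simp add: w'_def)
  have half: "1 / B \<le> 1 / 2" using B by (intro divide_left_mono) auto
  show "w' > 0" using w' half by linarith
  have "ln (2 * B) = (real \<beta> + 1) * ln 2"
    using B by (simp add: ln_mult B_def ln_realpow algebra_simps)
  also have "\<dots> \<le> (real \<beta> + 1) * 1" using ln_le_minus_one[of "2::real"] by (intro mult_left_mono) auto
  finally show "- ln w \<le> real \<beta> + 1" using B by (simp add: w_def ln_div)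
  have "- (1 / B) - 2 * (1 / B)\<^sup>2 \<le> ln (1 - 1 / B)"
    using half B by (intro ln_one_minus_pos_lower_bound) auto
  moreover have "2 * (1 / B)\<^sup>2 \<le> 1 / B"
    using half B mult_right_mono[of "1 / B" "1 / 2" "2 / B"] by (simp add: power2_eq_square)
  moreover have "ln (1 - 1 / B) \<le> ln w'"
    using w' half by (subst ln_le_cancel_iff) auto
  ultimately show "- ln w' \<le> 2 / B" by simp
  have "0 \<le> 1 / 4 ^ b + 1 / (2 * B)" using B by (intro add_nonneg_nonneg) auto
  then have "w' \<le> 1" by (simp add: w'_def)
  then show "- ln w' \<ge> 0" using \<open>w' > 0\<close> by simp
  show "- ln w \<ge> 0" using \<open>w > 0\<close> B by (simp add: w_def)
qed

section \<open>Accumulation over all nodes of the time tree\<close>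

context verified_steps
begin

lemma finite_probes: "finite (probes x t)"
  by (simp add: probes_def)

text \<open>Sums \<open>information_transfer\<close> over the nodes \<open>E h\<close> of all
  levels. A level gains order \<open>B ^ D * m\<close>, since at least half of its nodes are used
  and each of them recovers at least \<open>B ^ h / 2\<close> updates. A probe pays for a
  transferred content at most once over all levels, but for the penalties once per level.\<close>

lemma total_probes_ge:
  fixes l c r :: "nat \<Rightarrow> nat \<Rightarrow> nat" and E :: "nat \<Rightarrow> nat set"
  assumes N: "N = B ^ D" and B: "B = 2 ^ \<beta>" and \<beta>: "\<beta> \<ge> 1" "\<beta> * D \<le> b"
    and m: "card V = 2 ^ m" "m \<ge> 2"
    and w: "w\<^sub>r > 0" "w\<^sub>o > 0" "w\<^sub>r + w\<^sub>o = 1 - 1 / 4 ^ b"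
    and E: "\<And>h. h \<in> {1..<D} \<Longrightarrow> E h \<subseteq> {..<B ^ (D - h)}"
      "\<And>h. h \<in> {1..<D} \<Longrightarrow> B ^ (D - h) \<le> 2 * card (E h)"
    and intervals: "\<And>h u. h \<in> {1..<D} \<Longrightarrow> u \<in> E h \<Longrightarrow> l h u \<le> c h u \<and> c h u \<le> r h u \<and> r h u \<le> N"
    and recoverable: "\<And>h u. h \<in> {1..<D} \<Longrightarrow> u \<in> E h \<Longrightarrow>
        \<exists>Y. Y \<subseteq> {l h u..<c h u} \<and> Y \<subseteq> U \<and> B ^ h \<le> 2 * card Y \<and>
          (\<forall>x\<in>X. \<forall>x'\<in>X. (\<forall>i. i \<notin> Y \<longrightarrow> x i = x' i) \<longrightarrow> (\<forall>t\<in>{c h u..<r h u}. s t x = s t x') \<longrightarrow> x = x')"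
    and transfers: "\<And>x. (\<Sum>h\<in>{1..<D}. \<Sum>u\<in>E h.
        card (\<Union>(probes x ` {l h u..<c h u}) \<inter> \<Union>(probes x ` {c h u..<r h u}))) \<le> (\<Sum>t<N. card (probes x t))"
    and penalty: "\<And>x h. h \<in> {1..<D} \<Longrightarrow> (\<Sum>u\<in>E h.
        real (card (\<Union>(probes x ` {l h u..<c h u}) - \<Union>(probes x ` {c h u..<r h u}))) * (- ln w\<^sub>r) +
        real (card (\<Union>(probes x ` {c h u..<r h u}) - \<Union>(probes x ` {l h u..<c h u}))) * (- ln w\<^sub>o))
        \<le> (real \<beta> + 3) * real (\<Sum>t<N. card (probes x t))"
  shows "real (card X) * (real (D - 1) * real (B ^ D) * real m) \<le>
      128 * real b * (\<Sum>x\<in>X. real (\<Sum>t<N. card (probes x t)))"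
proof -
  define C where "C x = real (\<Sum>t<N. card (probes x t))" for x
  define W where "W x h u = \<Union>(probes x ` {l h u..<c h u})" for x h u
  define R where "R x h u = \<Union>(probes x ` {c h u..<r h u})" for x h u
  define T where "T x h u = real (card (W x h u \<inter> R x h u)) * (3 * real b * ln 2)" for x h u
  define pen where "pen x h u = real (card (W x h u - R x h u)) * (- ln w\<^sub>r) + real (card (R x h u - W x h u)) * (- ln w\<^sub>o)" for x h u
  have ln2: "1 / 2 \<le> ln (2::real)" "ln (2::real) \<le> 1"
    using ln_le_minus_one[of "2::real"] ln_le_minus_one[of "1 / 2 :: real"] by (simp_all add: ln_div)
  have B2: "B \<ge> 2" using \<beta> power_increasing[of 1 \<beta> "2::nat"] by (simp add: B)
  have C0: "C x \<ge> 0" for x unfolding C_def by (rule of_nat_0_le_iff)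
  have one: "real (card X) * (real (B ^ h) * real m * ln 2 / 4) \<le> (\<Sum>x\<in>X. T x h u + pen x h u)"
    if hu: "h \<in> {1..<D}" "u \<in> E h" for h u
  proof -
    obtain Y where Y: "Y \<subseteq> {l h u..<c h u}" "Y \<subseteq> U" "B ^ h \<le> 2 * card Y"
      and inj: "\<forall>x\<in>X. \<forall>x'\<in>X. (\<forall>i. i \<notin> Y \<longrightarrow> x i = x' i) \<longrightarrow>
          (\<forall>t\<in>{c h u..<r h u}. s t x = s t x') \<longrightarrow> x = x'"
      using recoverable[OF hu] by (elim exE conjE)
    have "real (B ^ h) \<le> 2 * real (card Y)" using Y(3) by linarith
    then have 1: "real (B ^ h) * (real m * ln 2) \<le> 2 * real (card Y) * (real m * ln 2)"
      using ln2 by (intro mult_right_mono) auto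
    \<comment> \<open>With \<open>m \<ge> 2\<close> this makes the information recovered at a node
      at least \<open>2 * ln 2\<close>, so the loss of \<open>ln 2\<close> takes at most half of
      it.\<close>
    have "2 \<le> B ^ h" using B2 hu power_increasing[of 1 h B] by simp
    then have "2 * 2 \<le> real (B ^ h) * real m"
      using m(2) by (intro mult_mono) (simp_all flip: of_nat_power)
    then have 2: "2 * 2 * ln 2 \<le> real (B ^ h) * real m * ln 2"
      using ln2 by (intro mult_right_mono) simp_all
    have "ln (real (card V)) = real m * ln 2" by (simp add: m ln_realpow)
    then have "real (B ^ h) * real m * ln 2 / 4 \<le> real (card Y) * ln (real (card V)) - ln 2"
      using 1 2 by (simp only:)
    then have "real (card X) * (real (B ^ h) * real m * ln 2 / 4) \<le>
        real (card X) * (real (card Y) * ln (real (card V)) - ln 2)"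
      by (intro mult_left_mono) auto
    also have "\<dots> \<le> (\<Sum>x\<in>X. let W = \<Union>(probes x ` {l h u..<c h u}); R = \<Union>(probes x ` {c h u..<r h u}) in
        real (card (W \<inter> R)) * (3 * real b * ln 2) + real (card (W - R)) * (- ln w\<^sub>r) + real (card (R - W)) * (- ln w\<^sub>o))"
    proof (rule information_transfer[OF _ _ _ Y(1,2) _ w])
      fix x x' assume x: "x \<in> X" "x' \<in> X" "\<And>i. i \<notin> Y \<Longrightarrow> x i = x' i" "\<And>t. t \<in> {c h u..<r h u} \<Longrightarrow> s t x = s t x'"
      show "x = x'"
        using bspec[OF bspec[OF inj x(1)] x(2)] x(3,4) by simp
    qed (use intervals[OF hu] in simp_all)
    also have "\<dots> = (\<Sum>x\<in>X. T x h u + pen x h u)"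
      by (simp only: Let_def T_def pen_def W_def R_def add.assoc)
    finally show ?thesis .
  qed
  have level: "real (card X) * (real (B ^ D) * real m * ln 2 / 8) \<le> (\<Sum>u\<in>E h. \<Sum>x\<in>X. T x h u + pen x h u)"
    if h: "h \<in> {1..<D}" for h
  proof -
    have "B ^ D = B ^ (D - h) * B ^ h" using h by (simp flip: power_add)
    also have "\<dots> \<le> 2 * card (E h) * B ^ h" using E(2)[OF h] by (intro mult_right_mono) auto
    finally have "real (B ^ D) \<le> 2 * real (card (E h)) * real (B ^ h)"
      by (metis (mono_tags) of_nat_le_iff of_nat_mult of_nat_numeral)
    then have "real (B ^ D) * (real (card X) * real m * ln 2 / 8) \<le>
        2 * real (card (E h)) * real (B ^ h) * (real (card X) * real m * ln 2 / 8)"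
      using ln2 by (intro mult_right_mono) auto
    also have "\<dots> = (\<Sum>u\<in>E h. real (card X) * (real (B ^ h) * real m * ln 2 / 4))" by simp
    also have "\<dots> \<le> (\<Sum>u\<in>E h. \<Sum>x\<in>X. T x h u + pen x h u)"
      using h by (intro sum_mono one)
    finally show ?thesis by (simp add: algebra_simps)
  qed
  have "real (card X) * (real (D - 1) * real (B ^ D) * real m) * (ln 2 / 8) =
      (\<Sum>h\<in>{1..<D}. real (card X) * (real (B ^ D) * real m * ln 2 / 8))" by simp
  also have "\<dots> \<le> (\<Sum>h\<in>{1..<D}. \<Sum>u\<in>E h. \<Sum>x\<in>X. T x h u + pen x h u)"
    by (intro sum_mono level)
  also have "\<dots> = (\<Sum>h\<in>{1..<D}. \<Sum>x\<in>X. \<Sum>u\<in>E h. T x h u + pen x h u)"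
    by (intro sum.cong refl sum.swap)
  also have "\<dots> = (\<Sum>x\<in>X. \<Sum>h\<in>{1..<D}. \<Sum>u\<in>E h. T x h u + pen x h u)"
    by (rule sum.swap)
  also have "\<dots> \<le> (\<Sum>x\<in>X. 7 * real b * C x)"
  proof (rule sum_mono)
    fix x
    have "(\<Sum>h\<in>{1..<D}. \<Sum>u\<in>E h. T x h u) =
        real (\<Sum>h\<in>{1..<D}. \<Sum>u\<in>E h. card (W x h u \<inter> R x h u)) * (3 * real b * ln 2)"
      by (simp add: T_def sum_distrib_right)
    also have "\<dots> \<le> C x * (3 * real b * ln 2)"
      using transfers[of x] ln2 unfolding C_def W_def R_def
      by (intro mult_right_mono of_nat_mono) auto
    also have "\<dots> \<le> C x * (3 * real b * 1)"
      using ln2 C0 by (intro mult_left_mono) auto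
    finally have 1: "(\<Sum>h\<in>{1..<D}. \<Sum>u\<in>E h. T x h u) \<le> 3 * real b * C x" by (simp add: mult_ac)
    have "(\<Sum>h\<in>{1..<D}. \<Sum>u\<in>E h. pen x h u) \<le> (\<Sum>h\<in>{1..<D}. (real \<beta> + 3) * C x)"
      unfolding pen_def W_def R_def C_def by (intro sum_mono penalty)
    also have "\<dots> = (real (D - 1) * (real \<beta> + 3)) * C x" by simp
    also have "\<dots> \<le> (4 * real b) * C x"
    proof (intro mult_right_mono C0)
      \<comment> \<open>Here \<open>\<beta> * D \<le> b\<close> enters: the penalties of all levels
        cost at most \<open>4 * b\<close> per probe, comparable with the \<open>3 * b\<close> for
        the contents.\<close>
      have "(D - 1) * (\<beta> + 3) \<le> D * (\<beta> + 3 * \<beta>)" using \<beta>(1) by (intro mult_mono) auto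
      also have "\<dots> \<le> 4 * b" using \<beta>(2) by (simp add: algebra_simps)
      finally have "real ((D - 1) * (\<beta> + 3)) \<le> real (4 * b)" by (rule of_nat_mono)
      then show "real (D - 1) * (real \<beta> + 3) \<le> 4 * real b" by simp
    qed
    finally show "(\<Sum>h\<in>{1..<D}. \<Sum>u\<in>E h. T x h u + pen x h u) \<le> 7 * real b * C x"
      using 1 by (simp add: sum.distrib algebra_simps)
  qed
  also have "\<dots> = 7 * real b * (\<Sum>x\<in>X. C x)" by (simp add: sum_distrib_left)
  finally have main: "real (card X) * (real (D - 1) * real (B ^ D) * real m) * (ln 2 / 8) \<le> 7 * real b * (\<Sum>x\<in>X. C x)" .
  \<comment> \<open>The constant 128 is \<open>8 * 16\<close>: \<open>7\<close> is rounded up to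
    \<open>8\<close> and \<open>ln 2 / 8\<close> down to \<open>1 / 16\<close>.\<close>
  have "real (card X) * (real (D - 1) * real (B ^ D) * real m) * (1 / 16) \<le>
      real (card X) * (real (D - 1) * real (B ^ D) * real m) * (ln 2 / 8)"
    using ln2 by (intro mult_left_mono) auto
  also note main
  also have "7 * real b * (\<Sum>x\<in>X. C x) \<le> 8 * real b * (\<Sum>x\<in>X. C x)"
    using C0 by (intro mult_right_mono sum_nonneg) auto
  finally show ?thesis by (simp add: C_def)
qed

text \<open>The left interval is the node and the right one its later siblings, so the label
  \<open>Reject\<close> of the short side gets the small weight \<open>1 / (2 * B)\<close>. Only
  nodes in the left half of their siblings are used, as these have enough queries to their
  right.\<close>

lemma total_probes_ge_dense_updates:
  assumes N: "N = B ^ D" and B: "B = 2 ^ \<beta>" and \<beta>: "\<beta> \<ge> 1" "\<beta> * D \<le> b"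
    and m: "card V = 2 ^ m" "m \<ge> 2"
    and Y: "\<And>h k u. h \<ge> 1 \<Longrightarrow> D = h + Suc k \<Longrightarrow> u < B ^ Suc k \<Longrightarrow> 2 * (u mod B) + 2 \<le> B \<Longrightarrow>
        \<exists>Y. Y \<subseteq> {u * B ^ h..<(u + 1) * B ^ h} \<and> Y \<subseteq> U \<and> B ^ h \<le> 2 * card Y \<and>
          (\<forall>x\<in>X. \<forall>x'\<in>X. (\<forall>i. i \<notin> Y \<longrightarrow> x i = x' i) \<longrightarrow>
             (\<forall>t\<in>{(u + 1) * B ^ h..<(u div B + 1) * B ^ (h + 1)}. s t x = s t x') \<longrightarrow> x = x')"
  shows "real (card X) * (real (D - 1) * real (B ^ D) * real m) \<le>
      128 * real b * (\<Sum>x\<in>X. real (\<Sum>t<N. card (probes x t)))"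
proof (cases "D = 0")
  case True
  then show ?thesis by (simp add: sum_nonneg)
next
  case False
  then have "\<beta> * 1 \<le> \<beta> * D" by (intro mult_le_mono2) simp
  then have "\<beta> \<le> b" using \<beta>(2) by linarith
  note w = bias_weights[OF \<beta>(1) this]
  define w\<^sub>1 :: real where "w\<^sub>1 = 1 / (2 * 2 ^ \<beta>)"
  define w\<^sub>2 :: real where "w\<^sub>2 = 1 - 1 / 4 ^ b - 1 / (2 * 2 ^ \<beta>)"
  note w = w[folded w\<^sub>1_def w\<^sub>2_def]
  have B0: "B > 0" by (simp add: B)
  define E where "E h = {u. u < B ^ (D - h) \<and> u mod B \<in> {i. i < B \<and> 2 * i + 2 \<le> B}}" for h
  have E: "E h \<subseteq> {..<B ^ (D - h)}" for h by (auto simp: E_def)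
  have bounds: "(u div B) * B ^ (h + 1) \<le> u * B ^ h" "(u + 1) * B ^ h \<le> (u div B + 1) * B ^ (h + 1)"
      "(u div B + 1) * B ^ (h + 1) \<le> N" if "h \<in> {1..<D}" "u \<in> E h" for h u
    using block_bounds[OF B0, of h D u] that E[of h] unfolding N by auto
  show ?thesis
  proof (rule total_probes_ge[OF N B \<beta> m w(1,2), where E = E])
    fix h assume h: "h \<in> {1..<D}"
    obtain \<beta>' where \<beta>': "\<beta> = Suc \<beta>'" using \<beta> by (cases \<beta>) auto
    have BB: "B = 2 * 2 ^ \<beta>'" by (simp add: B \<beta>')
    have "{i. i < B \<and> 2 * i + 2 \<le> B} = {..<2 ^ \<beta>'}" by (auto simp: BB)
    then have "B \<le> 2 * card {i. i < B \<and> 2 * i + 2 \<le> B}" by (simp add: BB)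
    then show "B ^ (D - h) \<le> 2 * card (E h)"
      unfolding E_def by (intro card_last_digit_ge B0) (use h in auto)
  next
    fix h u assume hu: "h \<in> {1..<D}" "u \<in> E h"
    then have u: "u < B ^ (D - h)" "2 * (u mod B) + 2 \<le> B" by (simp_all add: E_def)
    have *: "u * B ^ h \<le> (u + 1) * B ^ h" by simp
    show "u * B ^ h \<le> (u + 1) * B ^ h \<and> (u + 1) * B ^ h \<le> (u div B + 1) * B ^ (h + 1) \<and> (u div B + 1) * B ^ (h + 1) \<le> N"
      using bounds[OF hu] * by (intro conjI) linarith+
    show "\<exists>Y. Y \<subseteq> {u * B ^ h..<(u + 1) * B ^ h} \<and> Y \<subseteq> U \<and> B ^ h \<le> 2 * card Y \<and>
          (\<forall>x\<in>X. \<forall>x'\<in>X. (\<forall>i. i \<notin> Y \<longrightarrow> x i = x' i) \<longrightarrow>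
             (\<forall>t\<in>{(u + 1) * B ^ h..<(u div B + 1) * B ^ (h + 1)}. s t x = s t x') \<longrightarrow> x = x')"
    proof (rule Y)
      show "D = h + Suc (D - Suc h)" using hu by simp
      then have "D - h = Suc (D - Suc h)" by linarith
      then show "u < B ^ Suc (D - Suc h)" using u(1) by (simp only:)
    qed (use hu(1) u(2) in simp_all)
  next
    fix x
    show "(\<Sum>h\<in>{1..<D}. \<Sum>u\<in>E h. card (\<Union>(probes x ` {u * B ^ h..<(u + 1) * B ^ h}) \<inter>
        \<Union>(probes x ` {(u + 1) * B ^ h..<(u div B + 1) * B ^ (h + 1)}))) \<le> (\<Sum>t<N. card (probes x t))"
      unfolding N by (intro sum_transfers_right_le B0 finite_probes E)
  next
    fix x h assume h: "h \<in> {1..<D}"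
    define C where "C = (\<Sum>t<N. card (probes x t))"
    have "(\<Sum>u\<in>E h. card (\<Union>(probes x ` {u * B ^ h..<(u + 1) * B ^ h}) -
        \<Union>(probes x ` {(u + 1) * B ^ h..<(u div B + 1) * B ^ (h + 1)}))) \<le> C"
      unfolding C_def N
      by (rule sum_card_blocks_le[where pr = "probes x" and h = h, OF finite_probes _ E]) (use h in auto)
    then have 1: "real (\<Sum>u\<in>E h. card (\<Union>(probes x ` {u * B ^ h..<(u + 1) * B ^ h}) -
        \<Union>(probes x ` {(u + 1) * B ^ h..<(u div B + 1) * B ^ (h + 1)}))) \<le> real C"
      by (rule of_nat_mono)
    have "(\<Sum>u\<in>E h. card (\<Union>(probes x ` {(u + 1) * B ^ h..<(u div B + 1) * B ^ (h + 1)}) -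
        \<Union>(probes x ` {u * B ^ h..<(u + 1) * B ^ h}))) \<le> B * C"
      unfolding C_def N
    proof (intro sum_card_parent_blocks_le E B0 finite_probes)
      fix u assume u: "u \<in> E h"
      have "{(u + 1) * B ^ h..<(u div B + 1) * B ^ (h + 1)} \<subseteq> {(u div B) * B ^ (h + 1)..<(u div B + 1) * B ^ (h + 1)}"
      proof -
        have "u * B ^ h \<le> (u + 1) * B ^ h" by simp
        then show ?thesis
          using bounds[OF h u] by (intro ivl_subset[THEN iffD2] disjI2 conjI) linarith+
      qed
      then show "\<Union>(probes x ` {(u + 1) * B ^ h..<(u div B + 1) * B ^ (h + 1)}) -
        \<Union>(probes x ` {u * B ^ h..<(u + 1) * B ^ h}) \<subseteq>
          \<Union>(probes x ` {(u div B) * B ^ (h + 1)..<(u div B + 1) * B ^ (h + 1)})"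
        by blast
    qed (use h E[of h] in auto)
    then have 2: "real (\<Sum>u\<in>E h. card (\<Union>(probes x ` {(u + 1) * B ^ h..<(u div B + 1) * B ^ (h + 1)}) -
        \<Union>(probes x ` {u * B ^ h..<(u + 1) * B ^ h}))) \<le> real (B * C)"
      by (rule of_nat_mono)
    have "real C * (- ln w\<^sub>1) \<le> real C * (real \<beta> + 1)" using w by (intro mult_left_mono) auto
    moreover have "real (B * C) * (- ln w\<^sub>2) \<le> real (B * C) * (2 / 2 ^ \<beta>)" using w by (intro mult_left_mono) auto
    moreover have "real (B * C) * (2 / 2 ^ \<beta>) = 2 * real C" by (simp add: B)
    moreover have "(real \<beta> + 3) * real C = real C * (real \<beta> + 1) + 2 * real C" by (simp add: algebra_simps)
    ultimately show "(\<Sum>u\<in>E h.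
        real (card (\<Union>(probes x ` {u * B ^ h..<(u + 1) * B ^ h}) -
        \<Union>(probes x ` {(u + 1) * B ^ h..<(u div B + 1) * B ^ (h + 1)}))) * (- ln w\<^sub>1) +
        real (card (\<Union>(probes x ` {(u + 1) * B ^ h..<(u div B + 1) * B ^ (h + 1)}) -
        \<Union>(probes x ` {u * B ^ h..<(u + 1) * B ^ h}))) * (- ln w\<^sub>2))
        \<le> (real \<beta> + 3) * real (\<Sum>t<N. card (probes x t))"
      using mult_right_mono[OF 1 w(6)] mult_right_mono[OF 2 w(5)]
      by (simp only: sum.distrib sum_distrib_right[symmetric] of_nat_sum C_def[symmetric])
  qed (use E in \<open>simp_all add: w\<^sub>1_def w\<^sub>2_def\<close>)
qed

text \<open>Mirror image: the left interval consists of the earlier siblings and the right one is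
  the node. The weights of \<open>Reject\<close> and \<open>Old\<close> change places because the
  long interval is now the left one.\<close>

lemma total_probes_ge_dense_queries:
  assumes N: "N = B ^ D" and B: "B = 2 ^ \<beta>" and \<beta>: "\<beta> \<ge> 1" "\<beta> * D \<le> b"
    and m: "card V = 2 ^ m" "m \<ge> 2"
    and Y: "\<And>h k u. h \<ge> 1 \<Longrightarrow> D = h + Suc k \<Longrightarrow> u < B ^ Suc k \<Longrightarrow> B \<le> 2 * (u mod B) \<Longrightarrow>
        \<exists>Y. Y \<subseteq> {(u div B) * B ^ (h + 1)..<u * B ^ h} \<and> Y \<subseteq> U \<and> B ^ h \<le> 2 * card Y \<and>
          (\<forall>x\<in>X. \<forall>x'\<in>X. (\<forall>i. i \<notin> Y \<longrightarrow> x i = x' i) \<longrightarrow>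
             (\<forall>t\<in>{u * B ^ h..<(u + 1) * B ^ h}. s t x = s t x') \<longrightarrow> x = x')"
  shows "real (card X) * (real (D - 1) * real (B ^ D) * real m) \<le>
      128 * real b * (\<Sum>x\<in>X. real (\<Sum>t<N. card (probes x t)))"
proof (cases "D = 0")
  case True
  then show ?thesis by (simp add: sum_nonneg)
next
  case False
  then have "\<beta> * 1 \<le> \<beta> * D" by (intro mult_le_mono2) simp
  then have "\<beta> \<le> b" using \<beta>(2) by linarith
  note w = bias_weights[OF \<beta>(1) this]
  define w\<^sub>1 :: real where "w\<^sub>1 = 1 / (2 * 2 ^ \<beta>)"
  define w\<^sub>2 :: real where "w\<^sub>2 = 1 - 1 / 4 ^ b - 1 / (2 * 2 ^ \<beta>)"
  note w = w[folded w\<^sub>1_def w\<^sub>2_def]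
  have B0: "B > 0" by (simp add: B)
  define E where "E h = {u. u < B ^ (D - h) \<and> u mod B \<in> {i. i < B \<and> B \<le> 2 * i}}" for h
  have E: "E h \<subseteq> {..<B ^ (D - h)}" for h by (auto simp: E_def)
  have bounds: "(u div B) * B ^ (h + 1) \<le> u * B ^ h" "(u + 1) * B ^ h \<le> (u div B + 1) * B ^ (h + 1)"
      "(u div B + 1) * B ^ (h + 1) \<le> N" if "h \<in> {1..<D}" "u \<in> E h" for h u
    using block_bounds[OF B0, of h D u] that E[of h] unfolding N by auto
  show ?thesis
  proof (rule total_probes_ge[OF N B \<beta> m w(2,1), where E = E])
    fix h assume h: "h \<in> {1..<D}"
    obtain \<beta>' where \<beta>': "\<beta> = Suc \<beta>'" using \<beta> by (cases \<beta>) auto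
    have BB: "B = 2 * 2 ^ \<beta>'" by (simp add: B \<beta>')
    have "{i. i < B \<and> B \<le> 2 * i} = {2 ^ \<beta>'..<B}" by (auto simp: BB)
    then have "B \<le> 2 * card {i. i < B \<and> B \<le> 2 * i}" by (simp add: BB)
    then show "B ^ (D - h) \<le> 2 * card (E h)"
      unfolding E_def by (intro card_last_digit_ge B0) (use h in auto)
  next
    fix h u assume hu: "h \<in> {1..<D}" "u \<in> E h"
    then have u: "u < B ^ (D - h)" "B \<le> 2 * (u mod B)" by (simp_all add: E_def)
    have *: "u * B ^ h \<le> (u + 1) * B ^ h" by simp
    show "(u div B) * B ^ (h + 1) \<le> u * B ^ h \<and> u * B ^ h \<le> (u + 1) * B ^ h \<and> (u + 1) * B ^ h \<le> N"
      using bounds[OF hu] * by (intro conjI) linarith+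
    show "\<exists>Y. Y \<subseteq> {(u div B) * B ^ (h + 1)..<u * B ^ h} \<and> Y \<subseteq> U \<and> B ^ h \<le> 2 * card Y \<and>
          (\<forall>x\<in>X. \<forall>x'\<in>X. (\<forall>i. i \<notin> Y \<longrightarrow> x i = x' i) \<longrightarrow>
             (\<forall>t\<in>{u * B ^ h..<(u + 1) * B ^ h}. s t x = s t x') \<longrightarrow> x = x')"
    proof (rule Y)
      show "D = h + Suc (D - Suc h)" using hu by simp
      then have "D - h = Suc (D - Suc h)" by linarith
      then show "u < B ^ Suc (D - Suc h)" using u(1) by (simp only:)
    qed (use hu(1) u(2) in simp_all)
  next
    fix x
    show "(\<Sum>h\<in>{1..<D}. \<Sum>u\<in>E h. card (\<Union>(probes x ` {(u div B) * B ^ (h + 1)..<u * B ^ h}) \<inter>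
        \<Union>(probes x ` {u * B ^ h..<(u + 1) * B ^ h}))) \<le> (\<Sum>t<N. card (probes x t))"
      unfolding N by (intro sum_transfers_left_le B0 finite_probes E)
  next
    fix x h assume h: "h \<in> {1..<D}"
    define C where "C = (\<Sum>t<N. card (probes x t))"
    have "(\<Sum>u\<in>E h. card (\<Union>(probes x ` {u * B ^ h..<(u + 1) * B ^ h}) -
        \<Union>(probes x ` {(u div B) * B ^ (h + 1)..<u * B ^ h}))) \<le> C"
      unfolding C_def N
      by (rule sum_card_blocks_le[where pr = "probes x" and h = h, OF finite_probes _ E]) (use h in auto)
    then have 1: "real (\<Sum>u\<in>E h. card (\<Union>(probes x ` {u * B ^ h..<(u + 1) * B ^ h}) -
        \<Union>(probes x ` {(u div B) * B ^ (h + 1)..<u * B ^ h}))) \<le> real C"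
      by (rule of_nat_mono)
    have "(\<Sum>u\<in>E h. card (\<Union>(probes x ` {(u div B) * B ^ (h + 1)..<u * B ^ h}) -
        \<Union>(probes x ` {u * B ^ h..<(u + 1) * B ^ h}))) \<le> B * C"
      unfolding C_def N
    proof (intro sum_card_parent_blocks_le E B0 finite_probes)
      fix u assume u: "u \<in> E h"
      have "{(u div B) * B ^ (h + 1)..<u * B ^ h} \<subseteq> {(u div B) * B ^ (h + 1)..<(u div B + 1) * B ^ (h + 1)}"
      proof -
        have "u * B ^ h \<le> (u + 1) * B ^ h" by simp
        then show ?thesis
          using bounds[OF h u] by (intro ivl_subset[THEN iffD2] disjI2 conjI) linarith+
      qed
      then show "\<Union>(probes x ` {(u div B) * B ^ (h + 1)..<u * B ^ h}) -
        \<Union>(probes x ` {u * B ^ h..<(u + 1) * B ^ h}) \<subseteq>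
          \<Union>(probes x ` {(u div B) * B ^ (h + 1)..<(u div B + 1) * B ^ (h + 1)})"
        by blast
    qed (use h E[of h] in auto)
    then have 2: "real (\<Sum>u\<in>E h. card (\<Union>(probes x ` {(u div B) * B ^ (h + 1)..<u * B ^ h}) -
        \<Union>(probes x ` {u * B ^ h..<(u + 1) * B ^ h}))) \<le> real (B * C)"
      by (rule of_nat_mono)
    have "real C * (- ln w\<^sub>1) \<le> real C * (real \<beta> + 1)" using w by (intro mult_left_mono) auto
    moreover have "real (B * C) * (- ln w\<^sub>2) \<le> real (B * C) * (2 / 2 ^ \<beta>)" using w by (intro mult_left_mono) auto
    moreover have "real (B * C) * (2 / 2 ^ \<beta>) = 2 * real C" by (simp add: B)
    moreover have "(real \<beta> + 3) * real C = real C * (real \<beta> + 1) + 2 * real C" by (simp add: algebra_simps)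
    ultimately show "(\<Sum>u\<in>E h.
        real (card (\<Union>(probes x ` {(u div B) * B ^ (h + 1)..<u * B ^ h}) -
        \<Union>(probes x ` {u * B ^ h..<(u + 1) * B ^ h}))) * (- ln w\<^sub>2) +
        real (card (\<Union>(probes x ` {u * B ^ h..<(u + 1) * B ^ h}) -
        \<Union>(probes x ` {(u div B) * B ^ (h + 1)..<u * B ^ h}))) * (- ln w\<^sub>1))
        \<le> (real \<beta> + 3) * real (\<Sum>t<N. card (probes x t))"
      using mult_right_mono[OF 1 w(6)] mult_right_mono[OF 2 w(5)]
      by (simp only: sum.distrib sum_distrib_right[symmetric] of_nat_sum C_def[symmetric])
  qed (use E in \<open>simp_all add: w\<^sub>1_def w\<^sub>2_def\<close>)
qed

end

section \<open>Testing prefix sums\<close>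

primrec pbind :: "prog \<Rightarrow> (int \<Rightarrow> prog) \<Rightarrow> prog" where
  "pbind (Done r) k = k r"
| "pbind (Read a f) k = Read a (\<lambda>v. pbind (f v) k)"
| "pbind (Write a v p) k = Write a v (pbind p k)"

lemma run_pbind: "run (pbind p k) M = run (k (fst (run p M))) (snd (run p M))"
  by (induction p arbitrary: M) auto

lemma probed_pbind:
  "probed (pbind p k) M = probed p M \<union> probed (k (fst (run p M))) (snd (run p M))"
  by (induction p arbitrary: M) auto

lemma wf_pbind: "wf_prog b p \<Longrightarrow> (\<And>r. wf_prog b (k r)) \<Longrightarrow> wf_prog b (pbind p k)"
  by (induction p) auto

type_synonym test = "operation \<times> (int \<Rightarrow> bool)"

fun testing :: "(operation \<Rightarrow> prog) \<Rightarrow> test list \<Rightarrow> prog" where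
  "testing P [] = Done 1"
| "testing P ((x, \<phi>) # xs) = pbind (P x) (\<lambda>r. if \<phi> r then testing P xs else Done 0)"

lemma wf_testing: "(\<And>x. wf_prog b (P x)) \<Longrightarrow> wf_prog b (testing P xs)"
  by (induction P xs rule: testing.induct) (auto intro: wf_pbind)

primrec exec :: "(operation \<Rightarrow> prog) \<Rightarrow> operation list \<Rightarrow> memory \<Rightarrow> memory" where
  "exec P [] M = M"
| "exec P (x # xs) M = exec P xs (snd (run (P x) M))"

abbreviation apply_ops :: "(nat \<Rightarrow> int) \<Rightarrow> operation list \<Rightarrow> nat \<Rightarrow> int" where
  "apply_ops \<equiv> foldl apply_op"

lemma exec_append: "exec P (xs @ ys) M = exec P ys (exec P xs M)"
  by (induction xs arbitrary: M) auto

lemma seq_cost_append: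
  "seq_cost P (xs @ ys) M = seq_cost P xs M + seq_cost P ys (exec P xs M)"
  by (induction xs arbitrary: M) auto

lemma legal_seq_append:
  "legal_seq Q n b \<delta> (xs @ ys) A \<longleftrightarrow>
     legal_seq Q n b \<delta> xs A \<and> legal_seq Q n b \<delta> ys (apply_ops A xs)"
  by (induction xs arbitrary: A) auto

text \<open>Correct answers form a relation, since the result of an update is arbitrary.
  Completeness of tests therefore quantifies over all correct answers, and soundness only yields
  that some correct answer passes.\<close>

fun surely_passes :: "nat \<Rightarrow> (nat \<Rightarrow> int) \<Rightarrow> test list \<Rightarrow> bool" where
  "surely_passes n A [] \<longleftrightarrow> True"
| "surely_passes n A ((x, \<phi>) # xs) \<longleftrightarrow>
     (\<forall>r. correct_answer n A x r \<longrightarrow> \<phi> r) \<and> surely_passes n (apply_op A x) xs"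

fun possibly_passes :: "nat \<Rightarrow> (nat \<Rightarrow> int) \<Rightarrow> test list \<Rightarrow> bool" where
  "possibly_passes n A [] \<longleftrightarrow> True"
| "possibly_passes n A ((x, \<phi>) # xs) \<longleftrightarrow>
     (\<exists>r. correct_answer n A x r \<and> \<phi> r) \<and> possibly_passes n (apply_op A x) xs"

text \<open>This is the meaning of "the memory \<open>M\<close> represents the array
  \<open>A\<close>": the structure gives no explicit representation, so it is expressed by the
  correctness of all future legal operations.\<close>

definition valid_state ::
  "query_kind set \<Rightarrow> nat \<Rightarrow> nat \<Rightarrow> nat \<Rightarrow> (operation \<Rightarrow> prog) \<Rightarrow> (nat \<Rightarrow> int) \<Rightarrow> memory \<Rightarrow> bool" where
  "valid_state Q n b \<delta> P A M \<longleftrightarrow> (\<forall>x. wf_prog b (P x)) \<and> cells_fit b M \<and>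
     (\<forall>xs. legal_seq Q n b \<delta> xs A \<longrightarrow> correct_seq n P xs A M)"

lemma valid_state_step:
  assumes "valid_state Q n b \<delta> P A M" "legal_op Q n b \<delta> A x"
  shows "correct_answer n A x (fst (run (P x) M))"
    and "valid_state Q n b \<delta> P (apply_op A x) (snd (run (P x) M))"
proof -
  have *: "correct_seq n P (x # xs) A M" if "legal_seq Q n b \<delta> xs (apply_op A x)" for xs
    using assms that unfolding valid_state_def by (metis legal_seq.simps(2))
  show "correct_answer n A x (fst (run (P x) M))"
    using *[of "[]"] by simp
  show "valid_state Q n b \<delta> P (apply_op A x) (snd (run (P x) M))"
    using * assms(1) cells_fit_run by (auto simp: valid_state_def)
qed

lemma valid_state_exec:
  assumes "valid_state Q n b \<delta> P A M" "legal_seq Q n b \<delta> xs A"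
  shows "valid_state Q n b \<delta> P (apply_ops A xs) (exec P xs M)"
  using assms
proof (induction xs arbitrary: A M)
  case (Cons x xs)
  then show ?case using valid_state_step(2)[of Q n b \<delta> P A M x] by simp
qed auto

lemma testing_sound:
  assumes "valid_state Q n b \<delta> P A M" "legal_seq Q n b \<delta> (map fst xs) A"
    "fst (run (testing P xs) M) = 1"
  shows "possibly_passes n A xs"
  using assms
proof (induction n A xs arbitrary: M rule: possibly_passes.induct)
  case (2 n A x \<phi> xs)
  then have x: "legal_op Q n b \<delta> A x" by simp
  note step = valid_state_step[OF 2(2) x]
  have "\<phi> (fst (run (P x) M))" and "fst (run (testing P xs) (snd (run (P x) M))) = 1"
    using 2(4) by (auto simp: run_pbind split: if_splits)
  then show ?case using 2(1)[OF step(2)] 2(3) step(1) by auto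
qed auto

lemma testing_complete:
  assumes "valid_state Q n b \<delta> P A M" "legal_seq Q n b \<delta> (map fst xs) A" "surely_passes n A xs"
  shows "fst (run (testing P xs) M) = 1" "snd (run (testing P xs) M) = exec P (map fst xs) M"
    "card (probed (testing P xs) M) \<le> seq_cost P (map fst xs) M"
proof -
  have "fst (run (testing P xs) M) = 1 \<and> snd (run (testing P xs) M) = exec P (map fst xs) M \<and>
      card (probed (testing P xs) M) \<le> seq_cost P (map fst xs) M"
    using assms
  proof (induction n A xs arbitrary: M rule: surely_passes.induct)
    case (2 n A x \<phi> xs)
    then have x: "legal_op Q n b \<delta> A x" by simp
    note step = valid_state_step[OF 2(2) x]
    have \<phi>: "\<phi> (fst (run (P x) M))" using 2(4) step(1) by simp
    have IH: "fst (run (testing P xs) (snd (run (P x) M))) = 1"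
      "snd (run (testing P xs) (snd (run (P x) M))) = exec P (map fst xs) (snd (run (P x) M))"
      "card (probed (testing P xs) (snd (run (P x) M))) \<le> seq_cost P (map fst xs) (snd (run (P x) M))"
      using 2(1)[OF step(2)] 2(3,4) by auto
    show ?case
      using \<phi> IH card_Un_le[of "probed (P x) M" "probed (testing P xs) (snd (run (P x) M))"]
      by (simp add: run_pbind probed_pbind cost_def)
  qed auto
  then show "fst (run (testing P xs) M) = 1" "snd (run (testing P xs) M) = exec P (map fst xs) M"
    "card (probed (testing P xs) M) \<le> seq_cost P (map fst xs) M" by auto
qed

lemma psum_0 [simp]: "psum A 0 = 0"
  by (simp add: psum_def)

lemma psum_Suc: "psum A (Suc k) = psum A k + A (Suc k)"
  by (simp add: psum_def)

lemma psum_add_card_le: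
  assumes "i \<le> j" "\<And>l. l \<in> {i<..j} \<Longrightarrow> c \<le> A l"
  shows "psum A i + c * int (j - i) \<le> psum A j"
  using assms
proof (induction j rule: dec_induct)
  case (step j)
  then have "psum A i + c * int (j - i) \<le> psum A j" "c \<le> A (Suc j)" by auto
  then show ?case using step(1) by (simp add: psum_Suc Suc_diff_le algebra_simps)
qed auto

lemma psum_mono_index:
  assumes "i \<le> j" "\<And>l. l \<in> {i<..j} \<Longrightarrow> 0 \<le> A l"
  shows "psum A i \<le> psum A j"
  using psum_add_card_le[of i j 0 A] assms by simp

lemma psum_mono: "(\<And>i. i \<in> {1..k} \<Longrightarrow> A i \<le> A' i) \<Longrightarrow> psum A k \<le> psum A' k"
  unfolding psum_def by (rule sum_mono)

text \<open>Two consecutive \<open>select\<close> queries pin down a prefix sum exactly.\<close>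

fun sum_test :: "query_kind \<Rightarrow> nat \<Rightarrow> int \<Rightarrow> test list" where
  "sum_test Sums k \<sigma> = [(Sum k, \<lambda>r. r = \<sigma>)]"
| "sum_test Selects k \<sigma> = [(Select \<sigma>, \<lambda>r. r = int k), (Select (\<sigma> + 1), \<lambda>r. r = int (k + 1))]"

text \<open>For \<open>Selects\<close>, the answer \<open>k\<close> to \<open>\<sigma>\<close> gives
  \<open>\<sigma> \<le> psum A k\<close>, and the answer \<open>k + 1\<close> to
  \<open>\<sigma> + 1\<close> gives \<open>psum A k < \<sigma> + 1\<close>.\<close>

lemma sum_test_sound:
  assumes "possibly_passes n A (sum_test \<kappa> k \<sigma>)"
  shows "psum A k = \<sigma>"
proof (cases \<kappa>)
  case Selects
  have "psum A k < \<sigma> + 1 \<and> \<sigma> \<le> psum A k"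
  proof -
    from assms Selects obtain i j where *: "int k = int i" "psum A (i - 1) < \<sigma>" "\<sigma> \<le> psum A i"
        "int (k + 1) = int j" "psum A (j - 1) < \<sigma> + 1"
      unfolding Selects sum_test.simps possibly_passes.simps correct_answer.simps apply_op.simps
      by metis
    then have "i = k" "j - 1 = k" by linarith+
    then show ?thesis using * by simp
  qed
  then show ?thesis by simp
qed (use assms in auto)

lemma sum_test_complete:
  assumes "\<kappa> = Selects \<Longrightarrow> (\<forall>i\<in>{1..n}. A i \<ge> 1)" "k \<ge> 1" "k < n" "\<sigma> = psum A k"
  shows "surely_passes n A (sum_test \<kappa> k \<sigma>)"
proof (cases \<kappa>)
  case Selects
  have mono: "psum A i + 1 \<le> psum A j" if "i < j" "j \<le> n" for i j
    using psum_add_card_le[of i j 1 A] assms(1)[OF Selects] that by auto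
  have mono': "psum A i \<le> psum A j" if "i \<le> j" "j \<le> n" for i j
    using mono[of i j] that by (cases "i = j") auto
  have 1: "i = k" if i: "i \<in> {1..n}" "psum A (i - 1) < psum A k" "psum A k \<le> psum A i" for i
  proof (rule ccontr)
    assume "i \<noteq> k"
    then consider "i \<le> k - 1" "i < k" | "k \<le> i - 1" "i - 1 \<le> n" using i by force
    then show False
      by cases (use mono[of i k] mono'[of k "i - 1"] i assms(3) in linarith)+
  qed
  have 2: "i = k + 1" if i: "i \<in> {1..n}" "psum A (i - 1) < psum A k + 1" "psum A k + 1 \<le> psum A i" for i
  proof (rule ccontr)
    assume "i \<noteq> k + 1"
    then consider "i \<le> k" | "k < i - 1" "i - 1 \<le> n" using i by force
    then show False
      by cases (use mono'[of i k] mono[of k "i - 1"] i assms(3) in linarith)+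
  qed
  have "r = int k" if "correct_answer n A (Select (psum A k)) r" for r
    using that 1 by auto
  moreover have "r = int (k + 1)" if r: "correct_answer n A (Select (psum A k + 1)) r" for r
  proof -
    obtain i where "i \<in> {1..n}" "r = int i" "psum A (i - 1) < psum A k + 1" "psum A k + 1 \<le> psum A i"
      using r by auto
    then show ?thesis using 2[of i] by simp
  qed
  ultimately show ?thesis by (simp add: Selects assms(4))
qed (use assms in auto)

lemma apply_ops_sum_test [simp]: "apply_ops A (map fst (sum_test \<kappa> k \<sigma>)) = A"
  by (cases \<kappa>) auto

fun test_length :: "query_kind \<Rightarrow> nat" where
  "test_length Sums = 1"
| "test_length Selects = 2"

fun is_query :: "query_kind \<Rightarrow> operation \<Rightarrow> bool" where
  "is_query Sums x \<longleftrightarrow> is_sum x"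
| "is_query Selects x \<longleftrightarrow> is_select x"

text \<open>\<open>K\<close> elements vary over \<open>m\<close>-bit ranges. Their prefix sums are
  at most \<open>2 ^ (\<delta> - 2)\<close>, the last element adds another
  \<open>2 ^ (\<delta> - 2)\<close>, and the others are at most 1; \<open>room\<close> says that
  this total fits when all elements must be positive.\<close>

locale sums_instance =
  fixes Q :: "query_kind set" and n b \<delta> :: nat and P :: "operation \<Rightarrow> prog"
    and \<kappa> :: query_kind and m K :: nat
  assumes \<kappa>: "\<kappa> \<in> Q"
    and \<delta>: "\<delta> \<le> b" "2 * m \<le> \<delta>" "m \<ge> 2"
    and K: "K \<ge> 1" "K < n" "K * 2 ^ m \<le> 2 ^ (\<delta> - 2)"
    and room: "Selects \<in> Q \<Longrightarrow> int n - 1 + 2 ^ (\<delta> - 1) < 2 ^ b"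
begin

definition base :: int where "base = (if Selects \<in> Q then 1 else 0)"

text \<open>
  Only the first \<open>K\<close> elements vary. The last element exceeds all prefix sums of these, so that
  \<open>select\<close> is legal for every candidate that has to be tested.
\<close>

definition lower :: "nat \<Rightarrow> int" where
  "lower i = (if i \<le> K then 1 else if i < n then base else 2 ^ (\<delta> - 2))"

definition upper :: "nat \<Rightarrow> int" where
  "upper i = (if i \<le> K then 2 ^ m else if i < n then base else 2 ^ (\<delta> - 2))"

definition good :: "(nat \<Rightarrow> int) \<Rightarrow> bool" where
  "good A \<longleftrightarrow> (\<forall>i\<in>{1..n}. lower i \<le> A i \<and> A i \<le> upper i)"

abbreviation "valid \<equiv> valid_state Q n b \<delta> P"
abbreviation "legal \<equiv> legal_seq Q n b \<delta>"

lemma delta_ge: "\<delta> \<ge> 4" using \<delta> by linarith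

lemma base_bounds: "0 \<le> base" "base \<le> 1" by (auto simp: base_def)

lemma base_le_lower: "base \<le> lower i"
  using base_bounds by (auto simp: lower_def intro: order_trans[OF _ one_le_power])

lemma lower_le_upper: "lower i \<le> upper i"
  by (auto simp: lower_def upper_def)

lemma upper_less: "upper i < 2 ^ \<delta>"
proof -
  have "m < \<delta>" "\<delta> - 2 < \<delta>" using \<delta> by linarith+
  then have "(2::int) ^ m < 2 ^ \<delta>" "(2::int) ^ (\<delta> - 2) < 2 ^ \<delta>" by (auto intro: power_strict_increasing)
  moreover have "base < 2 ^ \<delta>"
    using base_bounds delta_ge power_increasing[of 1 \<delta> "2::int"] by auto
  ultimately show ?thesis by (auto simp: upper_def)
qed

lemma K_int: "int K * 2 ^ m \<le> 2 ^ (\<delta> - 2)"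
proof -
  have "int (K * 2 ^ m) \<le> int (2 ^ (\<delta> - 2))" using K(3) by (rule of_nat_mono)
  then show ?thesis by simp
qed

lemma psum_upper: "k \<le> K \<Longrightarrow> psum upper k = int k * 2 ^ m"
  by (induction k) (auto simp: psum_Suc upper_def algebra_simps)

lemma psum_upper_less: "psum upper n < 2 ^ b"
proof -
  obtain n' where n': "n = Suc n'" using K by (cases n) auto
  have "psum upper k = int K * 2 ^ m + int (k - K) * base" if "K \<le> k" "k \<le> n'" for k
    using that
  proof (induction k rule: dec_induct)
    case base
    then show ?case by (simp add: psum_upper)
  next
    case (step k)
    then have "Suc k < n" using n' by linarith
    then have "upper (Suc k) = base" using step by (simp add: upper_def)
    moreover have "int (Suc k - K) = int (k - K) + 1" using step by simp
    ultimately show ?case using step by (simp add: psum_Suc algebra_simps)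
  qed
  then have "psum upper n = int K * 2 ^ m + int (n' - K) * base + 2 ^ (\<delta> - 2)"
    using K psum_Suc[of upper n'] by (simp add: upper_def flip: n') (simp add: n')
  also have "int K * 2 ^ m \<le> 2 ^ (\<delta> - 2)"
    by (rule K_int)
  also have "int (n' - K) * base \<le> (int n - 1) * base"
    using base_bounds n' by (intro mult_right_mono) auto
  finally have "psum upper n \<le> 2 ^ (\<delta> - 2) + (int n - 1) * base + 2 ^ (\<delta> - 2)" by simp
  also have "\<dots> = (int n - 1) * base + 2 ^ (\<delta> - 1)"
  proof -
    have "\<delta> - 1 = Suc (\<delta> - 2)" using delta_ge by linarith
    then show ?thesis by simp
  qed
  also have "\<dots> < 2 ^ b"
  proof (cases "Selects \<in> Q")
    case True
    then show ?thesis using room by (simp add: base_def)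
  next
    case False
    have "\<delta> - 1 < b" using \<delta> delta_ge by linarith
    then show ?thesis using False by (simp add: base_def power_strict_increasing)
  qed
  finally show ?thesis .
qed

text \<open>Prefix sums of nonnegative elements increase and dominate the elements, so it is enough
  that the total fits.\<close>

lemma legal_arrayI:
  assumes "\<And>i. i \<in> {1..n} \<Longrightarrow> base \<le> A i" "psum A n < 2 ^ b"
  shows "legal_array Q n b A"
proof -
  have nonneg: "0 \<le> A i" if "i \<in> {1..n}" for i
    using assms(1)[OF that] base_bounds by linarith
  have mono: "psum A i \<le> psum A j" if "i \<le> j" "j \<le> n" for i j
    using that by (intro psum_mono_index nonneg) auto
  have "psum A (i - 1) + A i = psum A i" if "i \<in> {1..n}" for i
    using that by (cases i) (auto simp: psum_Suc)
  then have "A i \<le> psum A i" if "i \<in> {1..n}" for i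
    using mono[of 0 "i - 1"] that by force
  then show ?thesis
    unfolding legal_array_def using assms nonneg mono[of 0] mono[of _ n]
    by (fastforce simp: base_def)
qed

lemma legal_array_between:
  assumes "\<And>i. i \<in> {1..n} \<Longrightarrow> base \<le> A i \<and> A i \<le> upper i"
  shows "legal_array Q n b A"
proof (rule legal_arrayI)
  have "psum A n \<le> psum upper n" using assms by (intro psum_mono) auto
  then show "psum A n < 2 ^ b" using psum_upper_less by linarith
qed (use assms in auto)

lemma good_legal: "good A \<Longrightarrow> legal_array Q n b A"
  unfolding good_def by (intro legal_array_between) (blast intro: order_trans[OF base_le_lower])

lemma good_ge_1:
  assumes "good A" "Selects \<in> Q" "i \<in> {1..n}"
  shows "A i \<ge> 1"
proof -
  have "lower i \<le> A i" using assms(1,3) by (simp add: good_def)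
  then have "base \<le> A i" by (rule order_trans[OF base_le_lower])
  then show ?thesis using assms(2) by (simp add: base_def)
qed

lemma good_psum_bounds:
  assumes "good A" "k \<in> {1..K}"
  shows "1 \<le> psum A k" "psum A k \<le> 2 ^ (\<delta> - 2)"
proof -
  have A: "1 \<le> A i" "A i \<le> upper i" if "i \<in> {1..K}" for i
    using assms(1) that K(2) unfolding good_def lower_def by (auto dest!: bspec[of _ _ i])
  have "int k \<le> psum A k" using psum_add_card_le[of 0 k 1 A] A assms(2) by auto
  then show "1 \<le> psum A k" using assms(2) by auto
  have "psum A k \<le> psum upper k" using A assms(2) by (intro psum_mono) auto
  also have "\<dots> = int k * 2 ^ m" using assms(2) by (simp add: psum_upper)
  also have "\<dots> \<le> int K * 2 ^ m" using assms(2) by (intro mult_right_mono) auto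
  also have "\<dots> \<le> 2 ^ (\<delta> - 2)"
    by (rule K_int)
  finally show "psum A k \<le> 2 ^ (\<delta> - 2)" .
qed

text \<open>The extra 1 keeps \<open>Select (\<sigma> + 1)\<close> legal for the largest candidate
  \<open>\<sigma> = 2 ^ (\<delta> - 2)\<close>.\<close>

lemma good_psum_n:
  assumes "good A"
  shows "2 ^ (\<delta> - 2) + 1 \<le> psum A n"
proof -
  obtain n' where n': "n = Suc n'" using K by (cases n) auto
  have A: "lower i \<le> A i" if "i \<in> {1..n}" for i using assms that by (auto simp: good_def)
  have "0 \<le> A i" if "i \<in> {1..n}" for i
    using A[OF that] base_le_lower[of i] base_bounds by linarith
  then have "psum A 1 \<le> psum A n'" using K n' by (intro psum_mono_index) auto
  moreover have "1 \<le> psum A 1" using A[of 1] K by (simp add: psum_def lower_def)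
  moreover have "2 ^ (\<delta> - 2) \<le> A n" using A[of n] K by (simp add: lower_def)
  ultimately show ?thesis by (simp add: n' psum_Suc)
qed

lemma good_update:
  assumes "good A" "k \<in> {1..K}" "v \<in> {1..2 ^ m}"
  shows "good (A(k := v))"
  using assms K(2) by (auto simp: good_def lower_def upper_def)

lemma legal_update:
  assumes "good A" "k \<in> {1..K}" "v \<in> {1..2 ^ m}"
  shows "legal_op Q n b \<delta> A (Update k v)"
proof -
  have "v \<le> upper k" using assms(2,3) by (simp add: upper_def)
  then have "v < 2 ^ \<delta>" using upper_less[of k] by linarith
  then show ?thesis using assms good_legal[OF good_update[OF assms]] K(2) by auto
qed

lemma legal_sum_test:
  assumes "good A" "k \<in> {1..K}" "1 \<le> \<sigma>" "\<sigma> \<le> 2 ^ (\<delta> - 2)"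
  shows "legal (map fst (sum_test \<kappa> k \<sigma>)) A"
  using \<kappa> assms good_psum_n[OF assms(1)] K(2) by (cases \<kappa>) auto

lemma sum_test_iff:
  assumes "good A" "valid A M" "k \<in> {1..K}" "1 \<le> \<sigma>" "\<sigma> \<le> 2 ^ (\<delta> - 2)"
  shows "fst (run (testing P (sum_test \<kappa> k \<sigma>)) M) = 1 \<longleftrightarrow> psum A k = \<sigma>"
proof
  assume "fst (run (testing P (sum_test \<kappa> k \<sigma>)) M) = 1"
  then show "psum A k = \<sigma>"
    using testing_sound[OF assms(2) legal_sum_test[OF assms(1,3-5)]] by (blast intro: sum_test_sound)
next
  assume \<sigma>: "psum A k = \<sigma>"
  have "surely_passes n A (sum_test \<kappa> k \<sigma>)"
    using assms(3) K(2) good_ge_1[OF assms(1)] \<kappa> \<sigma> by (intro sum_test_complete) auto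
  then show "fst (run (testing P (sum_test \<kappa> k \<sigma>)) M) = 1"
    using testing_complete(1)[OF assms(2) legal_sum_test[OF assms(1,3-5)]] by blast
qed

end

section \<open>Schedules of operations\<close>

abbreviation num_ops :: "(operation \<Rightarrow> bool) \<Rightarrow> operation list \<Rightarrow> nat" where
  "num_ops p xs \<equiv> length (filter p xs)"

lemma count_sum_test [simp]:
  "filter (is_update \<circ> fst) (sum_test \<kappa> k \<sigma>) = []"
  "\<kappa>' \<noteq> \<kappa> \<Longrightarrow> filter (is_query \<kappa>' \<circ> fst) (sum_test \<kappa> k \<sigma>) = []"
  "length (filter (is_query \<kappa> \<circ> fst) (sum_test \<kappa> k \<sigma>)) = test_length \<kappa>"
  "\<not> is_query \<kappa>' (Update k' d)"
  by (cases \<kappa>; cases \<kappa>'; simp)+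

text \<open>One round of \<open>N\<close> steps with updates at the times \<open>U\<close> and
  queries at the times \<open>T\<close>. Positions count from 0, hence the shifts by 1 below. Since
  \<open>up\<close> is injective on \<open>U\<close>, no update is overwritten within the
  round.\<close>

locale sum_schedule = sums_instance +
  fixes A :: "nat \<Rightarrow> int" and M :: memory and N :: nat
    and U T :: "nat set" and up qp :: "nat \<Rightarrow> nat"
  assumes A: "good A" and M: "valid A M" and b_pos: "b \<ge> 1"
    and U: "U \<subseteq> {..<N}" and T: "T \<subseteq> {..<N}"
    and up: "\<And>t. t \<in> U \<Longrightarrow> up t < K" "inj_on up U"
    and qp: "\<And>t. t \<in> T \<Longrightarrow> qp t < K"
begin

definition V :: "int set" where "V = {1..2 ^ m}"

definition tests :: "nat \<Rightarrow> int \<Rightarrow> int \<Rightarrow> test list" where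
  "tests t d \<sigma> = (if t \<in> U then [(Update (up t + 1) d, \<lambda>_. True)] else []) @
     (if t \<in> T then sum_test \<kappa> (qp t + 1) \<sigma> else [])"

primrec arr :: "(nat \<Rightarrow> int) \<Rightarrow> nat \<Rightarrow> nat \<Rightarrow> int" where
  "arr x 0 = A"
| "arr x (Suc t) = (if t \<in> U then (arr x t)(up t + 1 := x t) else arr x t)"

text \<open>\<open>Suc t\<close> appears because a step performs its update before its query. The
  default 0 makes the answers of steps without a query agree for all inputs, so these steps satisfy
  \<open>verify\<close> trivially.\<close>

definition answer :: "nat \<Rightarrow> (nat \<Rightarrow> int) \<Rightarrow> int" where
  "answer t x = (if t \<in> T then psum (arr x (Suc t)) (qp t + 1) else 0)"

primrec ops :: "(nat \<Rightarrow> int) \<Rightarrow> nat \<Rightarrow> operation list" where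
  "ops x 0 = []"
| "ops x (Suc t) = ops x t @ map fst (tests t (x t) (answer t x))"

abbreviation "step t d \<sigma> \<equiv> testing P (tests t d \<sigma>)"
abbreviation "state x \<equiv> memory_at (\<lambda>t. step t (x t) (answer t x)) M"
abbreviation "touched x \<equiv> probes_at (\<lambda>t. step t (x t) (answer t x)) M"

lemma good_arr: "x \<in> U \<rightarrow>\<^sub>E V \<Longrightarrow> good (arr x t)"
proof (induction t)
  case (Suc t)
  show ?case
  proof (cases "t \<in> U")
    case True
    then have "up t + 1 \<in> {1..K}" "x t \<in> {1..2 ^ m}"
      using Suc.prems up(1)[of t] by (auto simp: V_def PiE_iff)
    then have "good ((arr x t)(up t + 1 := x t))" by (intro good_update Suc.IH Suc.prems)
    then show ?thesis using True by (simp only: arr.simps if_True)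
  qed (use Suc in simp)
qed (use A in simp)

lemma arr_cong: "(\<And>i. i < t \<Longrightarrow> up i + 1 = p \<Longrightarrow> x i = x' i) \<Longrightarrow> arr x t p = arr x' t p"
  by (induction t) auto

lemma arr_updated:
  assumes "i \<in> U" "i < t"
  shows "arr x t (up i + 1) = x i"
  using assms(2)
proof (induction t)
  case (Suc t)
  then show ?case using assms(1) up(2) by (cases "i = t") (auto dest: inj_onD)
qed auto

lemma answer_bounds:
  assumes "x \<in> U \<rightarrow>\<^sub>E V" "t \<in> T"
  shows "1 \<le> answer t x" "answer t x \<le> 2 ^ (\<delta> - 2)"
  using good_psum_bounds[OF good_arr[OF assms(1)], of "qp t + 1" "Suc t"] qp[OF assms(2)] assms(2)
  by (auto simp: answer_def simp del: arr.simps)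

lemma apply_tests: "apply_ops (arr x t) (map fst (tests t (x t) \<sigma>)) = arr x (Suc t)"
  by (simp add: tests_def)

lemma legal_tests:
  assumes "x \<in> U \<rightarrow>\<^sub>E V" "t \<in> T \<Longrightarrow> 1 \<le> \<sigma> \<and> \<sigma> \<le> 2 ^ (\<delta> - 2)"
  shows "legal (map fst (tests t (x t) \<sigma>)) (arr x t)"
proof -
  have "legal_op Q n b \<delta> (arr x t) (Update (up t + 1) (x t))" if "t \<in> U"
    using that assms(1) up(1)[of t] by (intro legal_update good_arr) (auto simp: V_def PiE_iff)
  moreover have "legal (map fst (sum_test \<kappa> (qp t + 1) \<sigma>)) (arr x (Suc t))" if "t \<in> T"
    using that assms qp[of t] by (intro legal_sum_test good_arr) auto
  ultimately show ?thesis by (auto simp: tests_def legal_seq_append)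
qed

lemma tests_pass:
  assumes "x \<in> U \<rightarrow>\<^sub>E V"
  shows "surely_passes n (arr x t) (tests t (x t) (answer t x))"
proof -
  have "surely_passes n (arr x (Suc t)) (sum_test \<kappa> (qp t + 1) (answer t x))" if "t \<in> T"
    using that qp[of t] K(2) good_ge_1[OF good_arr[OF assms]] \<kappa>
    by (intro sum_test_complete) (auto simp: answer_def simp del: arr.simps)
  then show ?thesis by (auto simp: tests_def)
qed

text \<open>A wrong candidate \<open>answer t x'\<close> is a prefix sum of another good array and
  hence lies in the range where its test is legal on the present one. So correctness of the
  structure applies to the test and makes it fail.\<close>

lemma tests_pass_iff:
  assumes "x \<in> U \<rightarrow>\<^sub>E V" "x' \<in> U \<rightarrow>\<^sub>E V" "valid (arr x t) M'"
  shows "fst (run (step t (x t) (answer t x')) M') = 1 \<longleftrightarrow> answer t x' = answer t x"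
proof
  assume "fst (run (step t (x t) (answer t x')) M') = 1"
  moreover have "legal (map fst (tests t (x t) (answer t x'))) (arr x t)"
    using answer_bounds[OF assms(2)] by (intro legal_tests assms) auto
  ultimately have "possibly_passes n (arr x t) (tests t (x t) (answer t x'))"
    using testing_sound[OF assms(3)] by blast
  then have "possibly_passes n (arr x (Suc t)) (sum_test \<kappa> (qp t + 1) (answer t x'))" if "t \<in> T"
    using that by (auto simp: tests_def split: if_splits)
  then have "psum (arr x (Suc t)) (qp t + 1) = answer t x'" if "t \<in> T"
    using that sum_test_sound by blast
  then show "answer t x' = answer t x" by (simp add: answer_def del: arr.simps)
next
  assume eq: "answer t x' = answer t x"
  have "legal (map fst (tests t (x t) (answer t x))) (arr x t)"
    using answer_bounds[OF assms(1)] by (intro legal_tests assms) auto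
  then show "fst (run (step t (x t) (answer t x')) M') = 1"
    unfolding eq using testing_complete(1)[OF assms(3)] tests_pass[OF assms(1)] by blast
qed

lemma execution:
  assumes x: "x \<in> U \<rightarrow>\<^sub>E V"
  shows "legal (ops x t) A" "apply_ops A (ops x t) = arr x t" "state x t = exec P (ops x t) M"
    "valid (arr x t) (state x t)" "(\<Sum>i<t. card (touched x i)) \<le> seq_cost P (ops x t) M"
proof -
  have "legal (ops x t) A \<and> apply_ops A (ops x t) = arr x t \<and> state x t = exec P (ops x t) M \<and>
    valid (arr x t) (state x t) \<and> (\<Sum>i<t. card (touched x i)) \<le> seq_cost P (ops x t) M"
  proof (induction t)
    case (Suc t)
    then have IH: "legal (ops x t) A" "apply_ops A (ops x t) = arr x t" "state x t = exec P (ops x t) M"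
      "valid (arr x t) (state x t)" "(\<Sum>i<t. card (touched x i)) \<le> seq_cost P (ops x t) M" by auto
    define ts where "ts = tests t (x t) (answer t x)"
    have legal: "legal (map fst ts) (arr x t)"
      unfolding ts_def using answer_bounds[OF x] by (intro legal_tests x) auto
    note run = testing_complete[OF IH(4) legal tests_pass[OF x, of t, folded ts_def]]
    have array: "apply_ops (arr x t) (map fst ts) = arr x (Suc t)"
      unfolding ts_def by (rule apply_tests)
    have ops: "ops x (Suc t) = ops x t @ map fst ts" by (simp add: ts_def)
    have mem: "state x (Suc t) = exec P (map fst ts) (state x t)"
      using run(2) by (simp add: ts_def)
    have probes: "card (touched x t) \<le> seq_cost P (map fst ts) (state x t)"
      using run(3) by (simp add: probes_at_def ts_def)
    show ?case
    proof (intro conjI)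
      show "legal (ops x (Suc t)) A" using IH legal by (simp only: ops legal_seq_append)
      show "apply_ops A (ops x (Suc t)) = arr x (Suc t)" using IH(2) array by (simp only: ops foldl_append)
      show "state x (Suc t) = exec P (ops x (Suc t)) M" unfolding mem ops exec_append IH(3) ..
      show "valid (arr x (Suc t)) (state x (Suc t))"
        unfolding mem array[symmetric] by (rule valid_state_exec[OF IH(4) legal])
      show "(\<Sum>i<Suc t. card (touched x i)) \<le> seq_cost P (ops x (Suc t)) M"
        using IH(5) probes unfolding ops seq_cost_append IH(3)[symmetric] by simp
    qed
  qed (use M in auto)
  then show "legal (ops x t) A" "apply_ops A (ops x t) = arr x t" "state x t = exec P (ops x t) M"
    "valid (arr x t) (state x t)" "(\<Sum>i<t. card (touched x i)) \<le> seq_cost P (ops x t) M" by auto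
qed

lemma P_wf: "wf_prog b (P x)" and M_fit: "cells_fit b M"
  using M by (auto simp: valid_state_def)

sublocale verified_steps step answer M b N U V
proof
  show "wf_prog b (step t d \<sigma>)" for t d \<sigma> by (intro wf_testing P_wf)
  show "cells_fit b M" by (rule M_fit)
  show "finite U" using U finite_subset by blast
  show "answer t x = answer t x'" if "\<And>i. i \<le> t \<Longrightarrow> x i = x' i" for x x' t
  proof -
    have "arr x (Suc t) = arr x' (Suc t)"
      by (rule ext, rule arr_cong) (use that in auto)
    then show ?thesis by (simp add: answer_def del: arr.simps)
  qed
  show "fst (run (step t (x t) (answer t x')) (state x t)) = 1 \<longleftrightarrow> answer t x' = answer t x"
    if "x \<in> U \<rightarrow>\<^sub>E V" "x' \<in> U \<rightarrow>\<^sub>E V" for x x' t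
    using that by (intro tests_pass_iff execution)
qed (use b_pos in \<open>auto simp: V_def\<close>)

lemma card_V: "card V = 2 ^ m"
  by (simp add: V_def nat_power_eq)

text \<open>Solves the triangular system. Among the updates that differ, take the one with the
  smallest position, \<open>y\<close>, and the query that has \<open>up y\<close> as the largest
  position of \<open>Y\<close> in its prefix. All other elements of that prefix agree, so equal
  answers force \<open>x y = x' y\<close>.\<close>

lemma recoverable:
  assumes Y: "Y \<subseteq> U" "Y \<subseteq> {..<c}" and sep: "separates up qp Y (I \<inter> T)" and I: "I \<subseteq> {c..}"
    and x: "\<And>i. i \<notin> Y \<Longrightarrow> x i = x' i"
    and eq: "\<And>t. t \<in> I \<Longrightarrow> answer t x = answer t x'"
  shows "x = x'"
proof (rule ccontr)
  define D where "D = {y \<in> Y. x y \<noteq> x' y}"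
  assume "x \<noteq> x'"
  then have "D \<noteq> {}" using x by (auto simp: D_def fun_eq_iff)
  moreover have "finite D" using Y(2) by (auto simp: D_def intro: finite_subset)
  ultimately obtain y where y: "y \<in> D" "\<And>y'. y' \<in> D \<Longrightarrow> up y \<le> up y'"
    using ex_min_if_finite[of "up ` D"] by (metis (no_types, lifting) finite_imageI image_iff image_is_empty leI)
  then have yY: "y \<in> Y" "y \<in> U" "y < c" using Y by (auto simp: D_def)
  obtain t where t: "t \<in> I" "t \<in> T" "up y \<le> qp t" "\<And>y'. y' \<in> Y \<Longrightarrow> up y' \<le> qp t \<Longrightarrow> up y' \<le> up y"
    using sep yY unfolding separates_def by blast
  have "c \<le> t" using t(1) I by auto
  have other: "arr x (Suc t) p = arr x' (Suc t) p" if p: "p \<in> {1..qp t + 1} - {up y + 1}" for p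
  proof (rule arr_cong)
    fix i assume i: "i < Suc t" "up i + 1 = p"
    show "x i = x' i"
    proof (rule ccontr)
      assume "x i \<noteq> x' i"
      then have "i \<in> D" using x by (auto simp: D_def)
      then have "up y \<le> up i" "i \<in> Y" using y by (auto simp: D_def)
      moreover have "up i \<le> up y" using t(4)[OF \<open>i \<in> Y\<close>] i p by simp
      ultimately show False using i p by simp
    qed
  qed
  have "psum (arr x (Suc t)) (qp t + 1) = psum (arr x' (Suc t)) (qp t + 1)"
    using eq[OF t(1)] t(2) by (simp add: answer_def del: arr.simps)
  moreover have "psum (arr z (Suc t)) (qp t + 1) = z y + (\<Sum>p\<in>{1..qp t + 1} - {up y + 1}. arr z (Suc t) p)" for z
    unfolding psum_def using t(3) arr_updated[OF yY(2), of "Suc t" z] yY(3) \<open>c \<le> t\<close>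
    by (subst sum.remove[of _ "up y + 1"]) (auto simp del: arr.simps)
  moreover have "(\<Sum>p\<in>{1..qp t + 1} - {up y + 1}. arr x (Suc t) p) =
      (\<Sum>p\<in>{1..qp t + 1} - {up y + 1}. arr x' (Suc t) p)"
    using other by (rule sum.cong[OF refl])
  ultimately have "x y = x' y" by (simp del: arr.simps)
  then show False using y(1) by (simp add: D_def)
qed

lemma count_ops:
  "num_ops is_update (ops x t) = card (U \<inter> {..<t})"
  "num_ops (is_query \<kappa>) (ops x t) = test_length \<kappa> * card (T \<inter> {..<t})"
  "\<kappa>' \<noteq> \<kappa> \<Longrightarrow> num_ops (is_query \<kappa>') (ops x t) = 0"
proof -
  have ins: "card (S \<inter> {..<Suc t}) = (if t \<in> S then 1 else 0) + card (S \<inter> {..<t})" for S :: "nat set" and t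
    by (simp add: lessThan_Suc Int_insert_right)
  show "num_ops is_update (ops x t) = card (U \<inter> {..<t})"
    by (induction t) (simp_all add: tests_def ins)
  show "num_ops (is_query \<kappa>) (ops x t) = test_length \<kappa> * card (T \<inter> {..<t})"
    by (induction t) (simp_all add: tests_def ins)
  show "\<kappa>' \<noteq> \<kappa> \<Longrightarrow> num_ops (is_query \<kappa>') (ops x t) = 0"
    by (induction t) (simp_all add: tests_def)
qed

end

section \<open>Amortized running times\<close>

lemma exists_ge_average:
  fixes f :: "'a \<Rightarrow> real"
  assumes "finite X" "X \<noteq> {}" "real (card X) * c \<le> (\<Sum>x\<in>X. f x)"
  shows "\<exists>x\<in>X. c \<le> f x"
proof (rule ccontr)
  assume "\<not> ?thesis"
  then have "(\<Sum>x\<in>X. f x) < (\<Sum>x\<in>X. c)"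
    using assms by (intro sum_strict_mono) auto
  then show False using assms by simp
qed

lemma card_multiples_below_power:
  fixes B :: nat
  assumes "B > 0" "D > 0"
  shows "card {t \<in> {..<B ^ D}. B dvd t} = B ^ (D - 1)"
proof -
  have BD: "B ^ D = B ^ (D - 1) * B" using assms by (cases D) auto
  have "{t \<in> {..<B ^ D}. B dvd t} = (\<lambda>i. i * B) ` {..<B ^ (D - 1)}"
    using assms by (auto simp: BD mult.commute elim!: dvdE)
  moreover have "inj_on (\<lambda>i. i * B) {..<B ^ (D - 1)}" using assms by (auto simp: inj_on_def)
  ultimately show ?thesis by (simp add: card_image)
qed

lemma initial_memories_finite_nonempty:
  assumes "finite (random_cells D)"
  shows "finite (initial_memories b D)" "initial_memories b D \<noteq> {}"
proof -
  let ?R = "random_cells D"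
  let ?F = "\<lambda>f a. if a \<in> ?R then f a else fixed_content D a"
  have "M = ?F (restrict M ?R)" "restrict M ?R \<in> (?R \<rightarrow>\<^sub>E {..<2 ^ b})" if "M \<in> initial_memories b D" for M
    using that by (auto simp: initial_memories_def)
  then have "initial_memories b D \<subseteq> ?F ` (?R \<rightarrow>\<^sub>E {..<2 ^ b})" by (intro subsetI image_eqI)
  then show "finite (initial_memories b D)"
    by (rule finite_subset) (use assms in \<open>auto intro!: finite_imageI finite_PiE\<close>)
  have "?F (\<lambda>_. 0) \<in> initial_memories b D" by (simp add: initial_memories_def)
  then show "initial_memories b D \<noteq> {}" by blast
qed

lemma updates_legal:
  assumes Inv: "Inv A" "\<And>A. Inv A \<Longrightarrow> legal_array Q n b A"
      "\<And>A k. Inv A \<Longrightarrow> k \<in> {1..n} \<Longrightarrow> Inv (A(k := v k))"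
    and v: "\<And>k. k \<in> {1..n} \<Longrightarrow> 0 \<le> v k \<and> v k < 2 ^ \<delta>" and ks: "set ks \<subseteq> {1..n}"
  shows "legal_seq Q n b \<delta> (map (\<lambda>k. Update k (v k)) ks) A"
    "apply_ops A (map (\<lambda>k. Update k (v k)) ks) = (\<lambda>i. if i \<in> set ks then v i else A i)"
    "Inv (apply_ops A (map (\<lambda>k. Update k (v k)) ks))"
proof -
  have "legal_seq Q n b \<delta> (map (\<lambda>k. Update k (v k)) ks) A \<and>
    apply_ops A (map (\<lambda>k. Update k (v k)) ks) = (\<lambda>i. if i \<in> set ks then v i else A i) \<and>
    Inv (apply_ops A (map (\<lambda>k. Update k (v k)) ks))"
    using Inv(1) ks
  proof (induction ks arbitrary: A)
    case (Cons k ks)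
    define A' where "A' = A(k := v k)"
    have k: "k \<in> {1..n}" "Inv A'" using Cons.prems Inv(3) by (auto simp: A'_def)
    have step: "apply_op A (Update k (v k)) = A'" by (simp add: A'_def)
    have legal: "legal_op Q n b \<delta> A (Update k (v k))"
      using k v[OF k(1)] Inv(2)[OF k(2)] by (simp add: A'_def)
    have "set ks \<subseteq> {1..n}" using Cons.prems by simp
    note IH = Cons.IH[OF k(2) this]
    have eq: "(\<lambda>i. if i \<in> set ks then v i else A' i) = (\<lambda>i. if i \<in> set (k # ks) then v i else A i)"
      by (auto simp: fun_eq_iff A'_def)
    show ?case
      unfolding list.map legal_seq.simps foldl.simps step using IH legal unfolding eq by blast
  qed auto
  then show "legal_seq Q n b \<delta> (map (\<lambda>k. Update k (v k)) ks) A"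
    "apply_ops A (map (\<lambda>k. Update k (v k)) ks) = (\<lambda>i. if i \<in> set ks then v i else A i)"
    "Inv (apply_ops A (map (\<lambda>k. Update k (v k)) ks))" by auto
qed

section \<open>The cost of one random round\<close>

context sum_schedule
begin

lemma sum_probes_le_seq_cost:
  assumes "x \<in> X"
  shows "real (\<Sum>t<N. card (probes x t)) \<le> real (seq_cost P (ops x N) M)"
  using execution(5)[OF assms, of N] unfolding probes_def by (rule of_nat_mono)

lemma seq_cost_ge_dense_updates:
  assumes N: "N = B ^ D" and B: "B = 2 ^ \<beta>" and \<beta>: "\<beta> \<ge> 1" "\<beta> * D \<le> b"
    and sched: "U = {..<N}" "T = {t \<in> {..<N}. B dvd t}" "up = dense_pos B D" "qp = sparse_pos B D"
  shows "real (card X) * (real (D - 1) * real (B ^ D) * real m) \<le>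
    128 * real b * (\<Sum>x\<in>X. real (seq_cost P (ops x N) M))"
proof -
  have B0: "B > 0" by (simp add: B)
  have "real (card X) * (real (D - 1) * real (B ^ D) * real m) \<le>
      128 * real b * (\<Sum>x\<in>X. real (\<Sum>t<N. card (probes x t)))"
  proof (rule total_probes_ge_dense_updates[OF N B \<beta> card_V \<delta>(3)])
    fix h k u
    assume h: "h \<ge> 1" "D = h + Suc k" and u: "u < B ^ Suc k" "2 * (u mod B) + 2 \<le> B"
    let ?I = "{u * B ^ h..<(u + 1) * B ^ h}" and ?J = "{(u + 1) * B ^ h..<(u div B + 1) * B ^ (h + 1)}"
    obtain Y where Y: "Y \<subseteq> ?I" "B ^ h \<le> 2 * card Y" "separates up qp Y {t \<in> ?J. B dvd t}"
      using separated_dense_updates[OF B0 h(1) u(2), of k] unfolding sched h(2) .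
    have hD: "h < D" "u < B ^ (D - h)" using h(2) u(1) by simp_all
    note bounds = block_bounds[OF B0 hD]
    have J: "?J \<subseteq> {..<N}" using bounds(3) by (auto simp: N)
    have "{t \<in> ?J. B dvd t} = ?J \<inter> T" using J by (auto simp: sched(2))
    note sep = Y(3)[unfolded this]
    have Y': "Y \<subseteq> {..<(u + 1) * B ^ h}" using Y(1) by auto
    have "(u + 1) * B ^ h \<le> N" using bounds(2,3) unfolding N by (rule order_trans)
    then have YU: "Y \<subseteq> U" using Y' unfolding sched(1) by (meson lessThan_subset_iff subset_trans)
    have "\<forall>x\<in>X. \<forall>x'\<in>X. (\<forall>i. i \<notin> Y \<longrightarrow> x i = x' i) \<longrightarrow>
             (\<forall>t\<in>?J. answer t x = answer t x') \<longrightarrow> x = x'"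
    proof (intro ballI impI)
      fix x x' assume "\<forall>i. i \<notin> Y \<longrightarrow> x i = x' i" "\<forall>t\<in>?J. answer t x = answer t x'"
      then show "x = x'"
        by (intro recoverable[OF YU Y' sep]) auto
    qed
    then show "\<exists>Y. Y \<subseteq> ?I \<and> Y \<subseteq> U \<and> B ^ h \<le> 2 * card Y \<and> (\<forall>x\<in>X. \<forall>x'\<in>X. (\<forall>i. i \<notin> Y \<longrightarrow> x i = x' i) \<longrightarrow>
             (\<forall>t\<in>?J. answer t x = answer t x') \<longrightarrow> x = x')"
      using Y(1,2) YU by (intro exI[of _ Y] conjI)
  qed
  also have "\<dots> \<le> 128 * real b * (\<Sum>x\<in>X. real (seq_cost P (ops x N) M))"
    by (intro mult_left_mono sum_mono sum_probes_le_seq_cost) auto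
  finally show ?thesis .
qed

lemma seq_cost_ge_dense_queries:
  assumes N: "N = B ^ D" and B: "B = 2 ^ \<beta>" and \<beta>: "\<beta> \<ge> 1" "\<beta> * D \<le> b"
    and sched: "U = {t \<in> {..<N}. B dvd t}" "T = {..<N}" "up = sparse_pos B D" "qp = dense_pos B D"
  shows "real (card X) * (real (D - 1) * real (B ^ D) * real m) \<le>
    128 * real b * (\<Sum>x\<in>X. real (seq_cost P (ops x N) M))"
proof -
  have B0: "B > 0" by (simp add: B)
  have "real (card X) * (real (D - 1) * real (B ^ D) * real m) \<le>
      128 * real b * (\<Sum>x\<in>X. real (\<Sum>t<N. card (probes x t)))"
  proof (rule total_probes_ge_dense_queries[OF N B \<beta> card_V \<delta>(3)])
    fix h k u
    assume h: "h \<ge> 1" "D = h + Suc k" and u: "u < B ^ Suc k" "B \<le> 2 * (u mod B)"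
    let ?I = "{(u div B) * B ^ (h + 1)..<u * B ^ h}" and ?J = "{u * B ^ h..<(u + 1) * B ^ h}"
    obtain Y where Y: "Y \<subseteq> {t \<in> ?I. B dvd t}" "B ^ h \<le> 2 * card Y" "separates up qp Y ?J"
      using separated_sparse_updates[OF B0 h(1) u(2), of k] unfolding sched h(2) .
    have hD: "h < D" "u < B ^ (D - h)" using h(2) u(1) by simp_all
    note bounds = block_bounds[OF B0 hD]
    have le: "(u + 1) * B ^ h \<le> N" using bounds(2,3) unfolding N by (rule order_trans)
    then have "?J \<inter> T = ?J" by (auto simp: sched(2))
    with Y(3) have sep: "separates up qp Y (?J \<inter> T)" by simp
    have Y': "Y \<subseteq> {..<u * B ^ h}" "Y \<subseteq> ?I" using Y(1) by auto
    have "u * B ^ h \<le> (u + 1) * B ^ h" by simp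
    then have "{..<u * B ^ h} \<subseteq> {..<N}" using le by (simp only: lessThan_subset_iff)
    with Y'(1) have "Y \<subseteq> {..<N}" by (rule subset_trans)
    moreover have "B dvd t" if "t \<in> Y" for t using subsetD[OF Y(1) that] by simp
    ultimately have YU: "Y \<subseteq> U" unfolding sched(1) by (intro subsetI CollectI conjI) (rule subsetD)
    have "\<forall>x\<in>X. \<forall>x'\<in>X. (\<forall>i. i \<notin> Y \<longrightarrow> x i = x' i) \<longrightarrow>
             (\<forall>t\<in>?J. answer t x = answer t x') \<longrightarrow> x = x'"
    proof (intro ballI impI)
      fix x x' assume "\<forall>i. i \<notin> Y \<longrightarrow> x i = x' i" "\<forall>t\<in>?J. answer t x = answer t x'"
      then show "x = x'"
        by (intro recoverable[OF YU Y'(1) sep]) auto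
    qed
    then show "\<exists>Y. Y \<subseteq> ?I \<and> Y \<subseteq> U \<and> B ^ h \<le> 2 * card Y \<and> (\<forall>x\<in>X. \<forall>x'\<in>X. (\<forall>i. i \<notin> Y \<longrightarrow> x i = x' i) \<longrightarrow>
             (\<forall>t\<in>?J. answer t x = answer t x') \<longrightarrow> x = x')"
      using Y(2) Y'(2) YU by (intro exI[of _ Y] conjI)
  qed
  also have "\<dots> \<le> 128 * real b * (\<Sum>x\<in>X. real (seq_cost P (ops x N) M))"
    by (intro mult_left_mono sum_mono sum_probes_le_seq_cost) auto
  finally show ?thesis .
qed

end

section \<open>Hard rounds for a family of memories\<close>

context sums_instance
begin

text \<open>Writing the values \<open>lower\<close> directly might overflow \<open>2 ^ b\<close>
  while old large elements remain. Lowering every element to \<open>base\<close>, the least legal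
  value, is always legal; after that, raising the elements to \<open>lower\<close> keeps the array
  below \<open>upper\<close>.\<close>

lemma reach_good:
  assumes "legal_array Q n b A"
  obtains xs where "legal xs A" "good (apply_ops A xs)" "\<forall>x\<in>set xs. is_update x"
proof -
  define xs where "xs = map (\<lambda>k. Update k base) [1..<Suc n]"
  define ys where "ys = map (\<lambda>k. Update k (lower k)) [1..<Suc n]"
  have base: "0 \<le> base \<and> base < 2 ^ \<delta>"
    using base_bounds base_le_lower[of 1] lower_le_upper[of 1] upper_less[of 1] by linarith
  have lower: "0 \<le> lower k \<and> lower k < 2 ^ \<delta>" for k
    using base base_le_lower[of k] lower_le_upper[of k] upper_less[of k] by linarith
  have ks: "set [1..<Suc n] \<subseteq> {1..n}" by auto
  have lowered: "legal_array Q n b (A(k := base))" if "legal_array Q n b A" "k \<in> {1..n}" for A k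
  proof (rule legal_arrayI)
    have ge: "base \<le> A i" if "i \<in> {1..n}" for i
      using \<open>legal_array Q n b A\<close> that by (force simp: legal_array_def base_def)
    then show "base \<le> (A(k := base)) i" if "i \<in> {1..n}" for i using that by simp
    have "psum (A(k := base)) n \<le> psum A n" using ge that by (intro psum_mono) auto
    also have "psum A n < 2 ^ b" using that(1) K by (auto simp: legal_array_def)
    finally show "psum (A(k := base)) n < 2 ^ b" .
  qed
  have X: "legal xs A" "apply_ops A xs = (\<lambda>i. if i \<in> set [1..<Suc n] then base else A i)"
    unfolding xs_def
    by (rule updates_legal[where Inv = "legal_array Q n b" and v = "\<lambda>_. base", OF assms _ lowered base ks]; assumption)+
  define A' where "A' = apply_ops A xs"
  have A': "A' i = base" if "i \<in> {1..n}" for i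
    using X(2) that by (simp add: A'_def)
  have up: "base \<le> lower i" "lower i \<le> upper i" "base \<le> upper i" for i
    using base_le_lower[of i] lower_le_upper[of i] by linarith+
  have Inv: "\<forall>i\<in>{1..n}. base \<le> A' i \<and> A' i \<le> upper i"
    using A' up(3) by simp
  have Inv': "\<forall>i\<in>{1..n}. base \<le> (A(k := lower k)) i \<and> (A(k := lower k)) i \<le> upper i"
    if "\<forall>i\<in>{1..n}. base \<le> A i \<and> A i \<le> upper i" for A :: "nat \<Rightarrow> int" and k
    using that up by auto
  have between: "legal_array Q n b A" if "\<forall>i\<in>{1..n}. base \<le> A i \<and> A i \<le> upper i" for A
    using that by (intro legal_array_between) simp
  have Y: "legal ys A'" "apply_ops A' ys = (\<lambda>i. if i \<in> set [1..<Suc n] then lower i else A' i)"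
    unfolding ys_def
    by (rule updates_legal[where Inv = "\<lambda>A. \<forall>i\<in>{1..n}. base \<le> A i \<and> A i \<le> upper i" and v = lower,
      OF Inv between Inv' lower ks]; assumption)+
  show ?thesis
  proof (rule that[of "xs @ ys"])
    show "legal (xs @ ys) A"
      unfolding legal_seq_append A'_def[symmetric] using X(1) Y(1) by (rule conjI)
    show "good (apply_ops A (xs @ ys))"
      unfolding foldl_append A'_def[symmetric] Y(2) good_def using up by simp
    show "\<forall>x\<in>set (xs @ ys). is_update x" by (auto simp: xs_def ys_def)
  qed
qed

text \<open>
  The operations must not depend on the random initial memory, so a hard round has to be expensive
  on average over a whole family of memories.
\<close>

definition hard :: "real \<Rightarrow> nat \<Rightarrow> nat \<Rightarrow> bool" where
  "hard L u q \<longleftrightarrow> (\<forall>A (\<M> :: memory set) g. good A \<longrightarrow> finite \<M> \<longrightarrow> \<M> \<noteq> {} \<longrightarrow> (\<forall>M\<in>\<M>. valid A (g M)) \<longrightarrow>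
     (\<exists>xs. legal xs A \<and> good (apply_ops A xs) \<and> num_ops is_update xs = u \<and> num_ops (is_query \<kappa>) xs = q \<and>
       (\<forall>\<kappa>'. \<kappa>' \<noteq> \<kappa> \<longrightarrow> num_ops (is_query \<kappa>') xs = 0) \<and>
       L * real (card \<M>) \<le> (\<Sum>M\<in>\<M>. real (seq_cost P xs (g M)))))"

lemma hardE:
  fixes \<M> :: "memory set" and g :: "memory \<Rightarrow> memory"
  assumes "hard L u q" "good A" "finite \<M>" "\<M> \<noteq> {}" "\<forall>M\<in>\<M>. valid A (g M)"
  obtains xs where "legal xs A" "good (apply_ops A xs)" "num_ops is_update xs = u"
    "num_ops (is_query \<kappa>) xs = q" "\<forall>\<kappa>'. \<kappa>' \<noteq> \<kappa> \<longrightarrow> num_ops (is_query \<kappa>') xs = 0"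
    "L * real (card \<M>) \<le> (\<Sum>M\<in>\<M>. real (seq_cost P xs (g M)))"
  using assms(1)[unfolded hard_def, THEN spec, THEN spec, THEN spec, THEN mp, THEN mp, THEN mp, THEN mp,
      OF assms(2-5)] that
  by (elim exE conjE)

text \<open>The next round is chosen for the memories reached so far. They stay indexed by the
  original family through \<open>g\<close>, so memories that have become equal keep their
  multiplicity in the average.\<close>

lemma hard_repeat:
  assumes "hard L u q"
  shows "hard (real R * L) (R * u) (R * q)"
proof (induction R)
  case 0
  show ?case unfolding hard_def
    by (intro allI impI exI[of _ "[]"]) auto
next
  case (Suc R)
  show ?case unfolding hard_def
  proof (intro allI impI)
    fix A and \<M> :: "memory set" and g
    assume A: "good A" "finite \<M>" "\<M> \<noteq> {}" "\<forall>M\<in>\<M>. valid A (g M)"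
    obtain xs where xs: "legal xs A" "good (apply_ops A xs)" "num_ops is_update xs = u"
      "num_ops (is_query \<kappa>) xs = q" "\<forall>\<kappa>'. \<kappa>' \<noteq> \<kappa> \<longrightarrow> num_ops (is_query \<kappa>') xs = 0"
      "L * real (card \<M>) \<le> (\<Sum>M\<in>\<M>. real (seq_cost P xs (g M)))"
      by (rule hardE[OF assms A])
    have valid: "\<forall>M\<in>\<M>. valid (apply_ops A xs) (exec P xs (g M))"
      using A(4) xs(1) valid_state_exec by blast
    obtain ys where ys: "legal ys (apply_ops A xs)" "good (apply_ops (apply_ops A xs) ys)"
      "num_ops is_update ys = R * u" "num_ops (is_query \<kappa>) ys = R * q"
      "\<forall>\<kappa>'. \<kappa>' \<noteq> \<kappa> \<longrightarrow> num_ops (is_query \<kappa>') ys = 0"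
      "real R * L * real (card \<M>) \<le> (\<Sum>M\<in>\<M>. real (seq_cost P ys (exec P xs (g M))))"
      by (rule hardE[OF Suc.IH xs(2) A(2,3) valid])
    have "real (Suc R) * L * real (card \<M>) \<le> (\<Sum>M\<in>\<M>. real (seq_cost P (xs @ ys) (g M)))"
      using xs(6) ys(6) by (simp add: seq_cost_append sum.distrib algebra_simps)
    then show "\<exists>xs. legal xs A \<and> good (apply_ops A xs) \<and> num_ops is_update xs = Suc R * u \<and>
        num_ops (is_query \<kappa>) xs = Suc R * q \<and> (\<forall>\<kappa>'. \<kappa>' \<noteq> \<kappa> \<longrightarrow> num_ops (is_query \<kappa>') xs = 0) \<and>
        real (Suc R) * L * real (card \<M>) \<le> (\<Sum>M\<in>\<M>. real (seq_cost P xs (g M)))"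
      using xs ys by (intro exI[of _ "xs @ ys"]) (simp add: legal_seq_append)
  qed
qed

lemma first_other_value:
  fixes A :: "nat \<Rightarrow> int"
  obtains v where "v \<in> {1..2 ^ m}" "v \<noteq> A 1"
proof -
  have "(2::int) ^ 1 \<le> 2 ^ m" using \<delta>(3) by (intro power_increasing) auto
  then show ?thesis using that[of 1] that[of 2] by (cases "A 1 = 1") auto
qed

text \<open>An update without probes would leave a memory that represents two arrays with different
  first elements, while one test of the first prefix sum can accept only one of them.\<close>

lemma hard_update: "hard 1 1 0"
  unfolding hard_def
proof (intro allI impI)
  fix A and \<M> :: "memory set" and g
  assume A: "good A" "finite \<M>" "\<M> \<noteq> {}" "\<forall>M\<in>\<M>. valid A (g M)"
  obtain v where v: "v \<in> {1..2 ^ m}" "v \<noteq> A 1" by (rule first_other_value)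
  have 1: "1 \<in> {1..K}" using K by simp
  note legal = legal_update[OF A(1) 1 v(1)] and good' = good_update[OF A(1) 1 v(1)]
  have "1 \<le> real (seq_cost P [Update 1 v] (g M))" if M: "M \<in> \<M>" for M
  proof (rule ccontr)
    assume "\<not> ?thesis"
    then have "probed (P (Update 1 v)) (g M) = {}"
      by (auto simp: cost_def finite_probed Suc_le_eq card_gt_0_iff)
    then have "snd (run (P (Update 1 v)) (g M)) = g M" by (metis probed_empty_run snd_conv)
    then have valid': "valid (A(1 := v)) (g M)"
      using valid_state_step(2)[OF _ legal] A(4) M by fastforce
    note iff = sum_test_iff[OF _ _ 1 good_psum_bounds[OF A(1) 1], of _ "g M"]
    have "psum (A(1 := v)) 1 = psum A 1"
      using iff[OF A(1)] iff[OF good' valid'] A(4) M by simp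
    then show False using v(2) by (simp add: psum_def)
  qed
  then have "(\<Sum>M\<in>\<M>. 1) \<le> (\<Sum>M\<in>\<M>. real (seq_cost P [Update 1 v] (g M)))"
    by (intro sum_mono)
  then show "\<exists>xs. legal xs A \<and> good (apply_ops A xs) \<and> num_ops is_update xs = 1 \<and>
        num_ops (is_query \<kappa>) xs = 0 \<and> (\<forall>\<kappa>'. \<kappa>' \<noteq> \<kappa> \<longrightarrow> num_ops (is_query \<kappa>') xs = 0) \<and>
        1 * real (card \<M>) \<le> (\<Sum>M\<in>\<M>. real (seq_cost P xs (g M)))"
    using legal good' by (intro exI[of _ "[Update 1 v]"]) auto
qed

text \<open>Without probes, the test of the first prefix sum would accept the same candidate after
  the first element has been changed.\<close>

lemma hard_query: "hard 1 0 (test_length \<kappa>)"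
  unfolding hard_def
proof (intro allI impI)
  fix A and \<M> :: "memory set" and g
  assume A: "good A" "finite \<M>" "\<M> \<noteq> {}" "\<forall>M\<in>\<M>. valid A (g M)"
  obtain v where v: "v \<in> {1..2 ^ m}" "v \<noteq> A 1" by (rule first_other_value)
  have 1: "1 \<in> {1..K}" using K by simp
  define xs where "xs = sum_test \<kappa> 1 (psum A 1)"
  note legal = legal_update[OF A(1) 1 v(1)] and good' = good_update[OF A(1) 1 v(1)]
  have test: "legal (map fst xs) A"
    unfolding xs_def by (intro legal_sum_test A 1 good_psum_bounds)
  have pass: "surely_passes n A xs"
    unfolding xs_def using K good_ge_1[OF A(1)] \<kappa> by (intro sum_test_complete) auto
  have "1 \<le> real (seq_cost P (map fst xs) (g M))" if M: "M \<in> \<M>" for M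
  proof (rule ccontr)
    assume "\<not> ?thesis"
    moreover have valid: "valid A (g M)" using A(4) M by simp
    ultimately have "card (probed (testing P xs) (g M)) = 0"
      using testing_complete(3)[OF valid test pass] by linarith
    then have "probed (testing P xs) (g M) = {}" by (simp add: finite_probed)
    then have run: "fst (run (testing P xs) M') = fst (run (testing P xs) (g M))" for M'
      by (metis probed_empty_run fst_conv)
    note iff = sum_test_iff[OF _ _ 1 good_psum_bounds[OF A(1) 1], folded xs_def]
    have "psum (A(1 := v)) 1 = psum A 1"
      using iff[OF A(1) valid] iff[OF good'] valid_state_step(2)[OF valid legal] run by simp
    then show False using v(2) by (simp add: psum_def)
  qed
  then have "(\<Sum>M\<in>\<M>. 1) \<le> (\<Sum>M\<in>\<M>. real (seq_cost P (map fst xs) (g M)))"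
    by (intro sum_mono)
  then show "\<exists>xs. legal xs A \<and> good (apply_ops A xs) \<and> num_ops is_update xs = 0 \<and>
        num_ops (is_query \<kappa>) xs = test_length \<kappa> \<and> (\<forall>\<kappa>'. \<kappa>' \<noteq> \<kappa> \<longrightarrow> num_ops (is_query \<kappa>') xs = 0) \<and>
        1 * real (card \<M>) \<le> (\<Sum>M\<in>\<M>. real (seq_cost P xs (g M)))"
    using test A(1) by (intro exI[of _ "map fst xs"]) (simp add: xs_def)
qed

text \<open>The operations of a round depend on \<open>x\<close> and the array, but not on the
  memory. Averages over \<open>x\<close> and over the family can thus be exchanged, and one
  \<open>x\<close> is expensive on average for the whole family.\<close>

lemma hard_schedule:
  assumes sched: "\<And>A M. good A \<Longrightarrow> valid A M \<Longrightarrow> sum_schedule Q n b \<delta> P \<kappa> m K A M N U T up qp"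
    and bound: "\<And>A M. good A \<Longrightarrow> valid A M \<Longrightarrow> real (card (U \<rightarrow>\<^sub>E {1..2 ^ m :: int})) * L \<le>
      (\<Sum>x\<in>U \<rightarrow>\<^sub>E {1..2 ^ m}. real (seq_cost P (sum_schedule.ops \<kappa> A U T up qp x N) M))"
    and UT: "U \<subseteq> {..<N}" "T \<subseteq> {..<N}"
  shows "hard L (card U) (test_length \<kappa> * card T)"
  unfolding hard_def
proof (intro allI impI)
  fix A and \<M> :: "memory set" and g
  assume A: "good A" "finite \<M>" "\<M> \<noteq> {}" "\<forall>M\<in>\<M>. valid A (g M)"
  define X where "X = U \<rightarrow>\<^sub>E {1..2 ^ m :: int}"
  define xops where "xops x = sum_schedule.ops \<kappa> A U T up qp x N" for x
  have "finite U" using UT finite_subset by blast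
  then have X: "finite X" "X \<noteq> {}" by (auto simp: X_def finite_PiE PiE_eq_empty_iff)
  have "real (card X) * (L * real (card \<M>)) = (\<Sum>M\<in>\<M>. real (card X) * L)" by simp
  also have "\<dots> \<le> (\<Sum>M\<in>\<M>. \<Sum>x\<in>X. real (seq_cost P (xops x) (g M)))"
    unfolding X_def xops_def using A(1,4) by (intro sum_mono bound) auto
  also have "\<dots> = (\<Sum>x\<in>X. \<Sum>M\<in>\<M>. real (seq_cost P (xops x) (g M)))" by (rule sum.swap)
  finally obtain x where x: "x \<in> X" "L * real (card \<M>) \<le> (\<Sum>M\<in>\<M>. real (seq_cost P (xops x) (g M)))"
    using exists_ge_average[OF X] by blast
  obtain M where "M \<in> \<M>" using A(3) by blast
  then interpret sum_schedule Q n b \<delta> P \<kappa> m K A "g M" N U T up qp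
    using A(1,4) by (intro sched) auto
  have xV: "x \<in> U \<rightarrow>\<^sub>E V" using x(1) by (simp add: X_def V_def)
  have "U \<inter> {..<N} = U" "T \<inter> {..<N} = T" using UT by auto
  then show "\<exists>xs. legal xs A \<and> good (apply_ops A xs) \<and> num_ops is_update xs = card U \<and>
        num_ops (is_query \<kappa>) xs = test_length \<kappa> * card T \<and> (\<forall>\<kappa>'. \<kappa>' \<noteq> \<kappa> \<longrightarrow> num_ops (is_query \<kappa>') xs = 0) \<and>
        L * real (card \<M>) \<le> (\<Sum>M\<in>\<M>. real (seq_cost P xs (g M)))"
    using x(2) execution(1,2)[OF xV, of N] good_arr[OF xV, of N] count_ops(1,2)[of x N] count_ops(3)[of _ x N]
    by (intro exI[of _ "xops x"]) (simp add: xops_def)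
qed

lemma hard_dense_updates:
  assumes "K = B ^ D" and B: "B = 2 ^ \<beta>" and \<beta>: "\<beta> \<ge> 1" "\<beta> * D \<le> b" and "D > 0"
  shows "hard (real (D - 1) * real (B ^ D) * real m / (128 * real b)) (B ^ D) (test_length \<kappa> * B ^ (D - 1))"
proof -
  have B0: "B > 0" by (simp add: B)
  have b: "b > 0" using \<delta> by linarith
  let ?N = "B ^ D" and ?T = "{t \<in> {..<B ^ D}. B dvd t}"
  have sched: "sum_schedule Q n b \<delta> P \<kappa> m K A M ?N {..<?N} ?T (dense_pos B D) (sparse_pos B D)"
    if "good A" "valid A M" for A M
  proof unfold_locales
    show "inj_on (dense_pos B D) {..<?N}" by (rule dense_pos_inj[OF B0])
  qed (use that b in \<open>auto simp: assms(1) dense_pos_less[OF B0] sparse_pos_less[OF B0 \<open>D > 0\<close>]\<close>)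
  have "hard (real (D - 1) * real (B ^ D) * real m / (128 * real b)) (card {..<?N}) (test_length \<kappa> * card ?T)"
  proof (rule hard_schedule[OF sched])
    fix A M assume A: "good A" "valid A M"
    interpret sum_schedule Q n b \<delta> P \<kappa> m K A M ?N "{..<?N}" ?T "dense_pos B D" "sparse_pos B D"
      by (rule sched[OF A])
    show "real (card ({..<?N} \<rightarrow>\<^sub>E {1..2 ^ m :: int})) * (real (D - 1) * real (B ^ D) * real m / (128 * real b)) \<le>
      (\<Sum>x\<in>{..<?N} \<rightarrow>\<^sub>E {1..2 ^ m}. real (seq_cost P (ops x ?N) M))"
      using seq_cost_ge_dense_updates[OF refl B \<beta> refl refl refl refl] b unfolding V_def
      by (simp add: field_simps)
  qed auto
  then show ?thesis by (simp only: card_multiples_below_power[OF B0 \<open>D > 0\<close>] card_lessThan)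
qed

lemma hard_dense_queries:
  assumes "K = B ^ D" and B: "B = 2 ^ \<beta>" and \<beta>: "\<beta> \<ge> 1" "\<beta> * D \<le> b" and "D > 0"
  shows "hard (real (D - 1) * real (B ^ D) * real m / (128 * real b)) (B ^ (D - 1)) (test_length \<kappa> * B ^ D)"
proof -
  have B0: "B > 0" by (simp add: B)
  have b: "b > 0" using \<delta> by linarith
  let ?N = "B ^ D" and ?U = "{t \<in> {..<B ^ D}. B dvd t}"
  have sched: "sum_schedule Q n b \<delta> P \<kappa> m K A M ?N ?U {..<?N} (sparse_pos B D) (dense_pos B D)"
    if "good A" "valid A M" for A M
  proof unfold_locales
    show "inj_on (sparse_pos B D) ?U" by (rule sparse_pos_inj[OF B0 \<open>D > 0\<close>])
  qed (use that b in \<open>auto simp: assms(1) dense_pos_less[OF B0] sparse_pos_less[OF B0 \<open>D > 0\<close>]\<close>)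
  have "hard (real (D - 1) * real (B ^ D) * real m / (128 * real b)) (card ?U) (test_length \<kappa> * card {..<?N})"
  proof (rule hard_schedule[OF sched])
    fix A M assume A: "good A" "valid A M"
    interpret sum_schedule Q n b \<delta> P \<kappa> m K A M ?N ?U "{..<?N}" "sparse_pos B D" "dense_pos B D"
      by (rule sched[OF A])
    show "real (card (?U \<rightarrow>\<^sub>E {1..2 ^ m :: int})) * (real (D - 1) * real (B ^ D) * real m / (128 * real b)) \<le>
      (\<Sum>x\<in>?U \<rightarrow>\<^sub>E {1..2 ^ m}. real (seq_cost P (ops x ?N) M))"
      using seq_cost_ge_dense_queries[OF refl B \<beta> refl refl refl refl] b unfolding V_def
      by (simp add: field_simps)
  qed auto
  then show ?thesis by (simp only: card_multiples_below_power[OF B0 \<open>D > 0\<close>] card_lessThan)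
qed

text \<open>Repeating a hard round makes the cost of reaching a good array negligible.\<close>

lemma amortized:
  assumes hard: "hard L u q" and D: "P = op_prog D"
    and solves: "solves_partial_sums Q n b \<delta> A\<^sub>0 D"
    and times: "running_times Q n b \<delta> A\<^sub>0 D t\<^sub>u t\<^sub>q t\<^sub>s"
  shows "L \<le> t\<^sub>u * real u + (case \<kappa> of Sums \<Rightarrow> t\<^sub>q | Selects \<Rightarrow> t\<^sub>s) * real q"
proof -
  define \<M> where "\<M> = initial_memories b D"
  have wfD: "wf_structure b D" and A\<^sub>0: "legal_array Q n b A\<^sub>0"
    using solves by (auto simp: solves_partial_sums_def)
  then have "finite (random_cells D)" by (auto simp: wf_structure_def intro: finite_subset)
  then have \<M>: "finite \<M>" "\<M> \<noteq> {}"
    unfolding \<M>_def by (rule initial_memories_finite_nonempty)+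
  have valid\<^sub>0: "valid A\<^sub>0 M" if "M \<in> \<M>" for M
  proof -
    have "cells_fit b M"
      using that wfD by (auto simp: \<M>_def initial_memories_def cells_fit_def wf_structure_def)
    then show ?thesis
      using that solves wfD by (auto simp: valid_state_def D \<M>_def solves_partial_sums_def wf_structure_def)
  qed
  obtain zs where zs: "legal zs A\<^sub>0" "good (apply_ops A\<^sub>0 zs)" "\<forall>x\<in>set zs. is_update x"
    using reach_good[OF A\<^sub>0] by blast
  have "\<not> is_sum x \<and> \<not> is_select x" if "x \<in> set zs" for x
    using bspec[OF zs(3) that] by (cases x) simp_all
  then have no_queries: "num_ops is_sum zs = 0" "num_ops is_select zs = 0"
    by (simp_all add: filter_empty_conv)
  have all_updates: "num_ops is_update zs = length zs"
    using zs(3) by simp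
  define t where "t = (case \<kappa> of Sums \<Rightarrow> t\<^sub>q | Selects \<Rightarrow> t\<^sub>s)"
  have bound: "real R * (L - (t\<^sub>u * real u + t * real q)) \<le> t\<^sub>u * real (length zs)" for R
  proof -
    have valid: "\<forall>M\<in>\<M>. valid (apply_ops A\<^sub>0 zs) (exec P zs M)"
      using valid\<^sub>0 zs(1) valid_state_exec by blast
    obtain xs where xs: "legal xs (apply_ops A\<^sub>0 zs)" "num_ops is_update xs = R * u"
      "num_ops (is_query \<kappa>) xs = R * q" "\<forall>\<kappa>'. \<kappa>' \<noteq> \<kappa> \<longrightarrow> num_ops (is_query \<kappa>') xs = 0"
      "real R * L * real (card \<M>) \<le> (\<Sum>M\<in>\<M>. real (seq_cost P xs (exec P zs M)))"
      by (rule hardE[OF hard_repeat[OF hard, of R] zs(2) \<M> valid])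
    have queries: "t\<^sub>q * real (num_ops is_sum xs) + t\<^sub>s * real (num_ops is_select xs) = t * real (R * q)"
    proof -
      have "is_query Sums = is_sum" "is_query Selects = is_select" by (auto simp: fun_eq_iff)
      then show ?thesis
        using xs(3) spec[OF xs(4), of Selects] spec[OF xs(4), of Sums] by (cases \<kappa>) (simp_all add: t_def)
    qed
    have "real R * L * real (card \<M>) \<le> (\<Sum>M\<in>\<M>. real (seq_cost P (zs @ xs) M))"
      using xs(5) by (simp add: seq_cost_append sum.distrib sum_nonneg add_increasing)
    also have "\<dots> = expected_cost b D (zs @ xs) * real (card \<M>)"
      using \<M> by (simp add: expected_cost_def integral_pmf_of_set D flip: \<M>_def)
    finally have "real R * L \<le> expected_cost b D (zs @ xs)"
      using \<M> by (simp add: card_gt_0_iff)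
    also have "\<dots> \<le> t\<^sub>u * real (num_ops is_update (zs @ xs)) + t\<^sub>q * real (num_ops is_sum (zs @ xs)) +
        t\<^sub>s * real (num_ops is_select (zs @ xs))"
      using times legal_seq_append[of Q n b \<delta> zs xs A\<^sub>0] zs(1) xs(1) unfolding running_times_def by blast
    also have "\<dots> = t\<^sub>u * real (length zs) + real R * (t\<^sub>u * real u + t * real q)"
      using no_queries all_updates queries xs(2) by (simp add: algebra_simps)
    finally show ?thesis by (simp add: algebra_simps)
  qed
  show ?thesis
  proof (rule ccontr)
    assume "\<not> ?thesis"
    then have "0 < L - (t\<^sub>u * real u + t * real q)" by (simp add: t_def)
    then obtain R where "t\<^sub>u * real (length zs) < real R * (L - (t\<^sub>u * real u + t * real q))"
      using reals_Archimedean3 by blast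
    then show False using bound[of R] by simp
  qed
qed

end

text \<open>After the update with a large argument, the other \<open>n - 1\<close> elements are
  still at least 1 and the total still fits. This is exactly the space that the hard arrays
  need.\<close>

lemma bits_needed_room:
  assumes "bits_needed Q n b \<delta>" "Selects \<in> Q"
  shows "int n - 1 + 2 ^ (\<delta> - 1) < 2 ^ b"
proof -
  obtain A k \<Delta> where k: "k \<in> {1..n}" and legal: "legal_array Q n b (A(k := \<Delta>))" and \<Delta>: "2 ^ (\<delta> - 1) \<le> \<Delta>"
    using assms(1) by (auto simp: bits_needed_def)
  have pos: "(A(k := \<Delta>)) i \<ge> 1" if "i \<in> {1..n}" for i
    using legal that assms(2) unfolding legal_array_def by force
  have "int n - 1 = (\<Sum>i\<in>{1..n} - {k}. 1)" using k by (simp add: of_nat_diff)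
  also have "\<dots> \<le> (\<Sum>i\<in>{1..n} - {k}. (A(k := \<Delta>)) i)" by (intro sum_mono pos) simp
  finally have "int n - 1 + \<Delta> \<le> psum (A(k := \<Delta>)) n"
    unfolding psum_def using k by (subst sum.remove[of _ k]) auto
  also have "\<dots> < 2 ^ b" using legal k by (auto simp: legal_array_def)
  finally show ?thesis using \<Delta> by linarith
qed

text \<open>The choice is \<open>m = \<delta> div 2\<close> and
  \<open>K = 2 ^ (\<beta> * d)\<close>, and the condition on \<open>k\<close> leaves room for sums
  of up to \<open>2 ^ k\<close> such values. Dividing the cost of a round by its number of steps
  leaves the time of the dense operation plus a \<open>1 / 2 ^ \<beta>\<close> part of the sparse
  one. A test may take two \<open>select\<close> calls, whence the factors 2; both bounds get the
  same shape so that one optimisation serves both.\<close>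

lemma running_time_bounds:
  assumes \<kappa>: "\<kappa> \<in> Q" and \<delta>: "\<delta> \<le> b" "\<delta> div 2 \<ge> 2" "k + \<delta> div 2 \<le> \<delta> - 2" and n: "2 ^ k < n"
    and bits: "bits_needed Q n b \<delta>"
    and solves: "solves_partial_sums Q n b \<delta> A\<^sub>0 D"
    and times: "running_times Q n b \<delta> A\<^sub>0 D t\<^sub>u t\<^sub>q t\<^sub>s"
  defines "t \<equiv> case \<kappa> of Sums \<Rightarrow> t\<^sub>q | Selects \<Rightarrow> t\<^sub>s"
  shows "t\<^sub>u \<ge> 1" "t \<ge> 1 / 2"
    and "\<And>\<beta> d. \<beta> \<ge> 1 \<Longrightarrow> d > 0 \<Longrightarrow> \<beta> * d \<le> k \<Longrightarrow>
      real (d - 1) * (real (\<delta> div 2) / (128 * real b)) \<le> 2 * t\<^sub>u + 2 * (t / 2 ^ \<beta>)"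
    and "\<And>\<beta> d. \<beta> \<ge> 1 \<Longrightarrow> d > 0 \<Longrightarrow> \<beta> * d \<le> k \<Longrightarrow>
      real (d - 1) * (real (\<delta> div 2) / (128 * real b)) \<le> 2 * t + 2 * (t\<^sub>u / 2 ^ \<beta>)"
proof -
  have kb: "k \<le> b" using \<delta> by linarith
  have inst: "sums_instance Q n b \<delta> \<kappa> (\<delta> div 2) (2 ^ e)" if "e \<le> k" for e
  proof
    have "(2::nat) ^ e \<le> 2 ^ k" using that by (intro power_increasing) auto
    then show "(2::nat) ^ e < n" using n by linarith
    have "(2::nat) ^ e * 2 ^ (\<delta> div 2) = 2 ^ (e + \<delta> div 2)" by (simp add: power_add)
    also have "\<dots> \<le> 2 ^ (\<delta> - 2)" using that \<delta>(3) by (intro power_increasing) auto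
    finally show "(2::nat) ^ e * 2 ^ (\<delta> div 2) \<le> 2 ^ (\<delta> - 2)" .
    show "int n - 1 + 2 ^ (\<delta> - 1) < 2 ^ b" if "Selects \<in> Q"
      by (rule bits_needed_room[OF bits that])
  qed (use \<kappa> \<delta> in auto)
  have len: "1 \<le> real (test_length \<kappa>)" "real (test_length \<kappa>) \<le> 2" by (cases \<kappa>; simp)+
  \<comment> \<open>A single varying element suffices for the constant lower bounds on the running
    times.\<close>
  interpret base: sums_instance Q n b \<delta> "op_prog D" \<kappa> "\<delta> div 2" "2 ^ 0"
    by (rule inst) simp
  show tu: "t\<^sub>u \<ge> 1"
    using base.amortized[OF base.hard_update refl solves times] by simp
  have "1 \<le> t * real (test_length \<kappa>)"
    using base.amortized[OF base.hard_query refl solves times] by (simp add: t_def)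
  moreover have "t * real (test_length \<kappa>) \<le> t * 2" if "t > 0" using that len by (intro mult_left_mono) auto
  moreover have "t * real (test_length \<kappa>) \<le> 0" if "t \<le> 0" using that len by (intro mult_nonpos_nonneg) auto
  ultimately show t: "t \<ge> 1 / 2" by (cases "t > 0") linarith+
  fix \<beta> d :: nat assume \<beta>: "\<beta> \<ge> 1" "d > 0" "\<beta> * d \<le> k"
  define B :: nat where "B = 2 ^ \<beta>"
  interpret sums_instance Q n b \<delta> "op_prog D" \<kappa> "\<delta> div 2" "2 ^ (\<beta> * d)"
    by (rule inst[OF \<beta>(3)])
  have K: "2 ^ (\<beta> * d) = B ^ d" by (simp add: B_def power_mult)
  have b: "\<beta> * d \<le> b" using \<beta>(3) kb by linarith
  have B: "real B > 0" "real B = 2 ^ \<beta>" by (simp_all add: B_def)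
  have Bd: "real (B ^ d) = real (B ^ (d - 1)) * real B" using \<beta>(2) by (cases d) auto
  have tlen: "t * real (test_length \<kappa>) \<le> 2 * t" "0 \<le> t * real (test_length \<kappa>)"
    using t len mult_left_mono[of "real (test_length \<kappa>)" 2 t] by auto
  define \<gamma> where "\<gamma> = real (\<delta> div 2) / (128 * real b)"
  have pos: "real (B ^ (d - 1)) > 0" using B by simp
  {
    have "real (d - 1) * real (B ^ d) * real (\<delta> div 2) / (128 * real b) \<le>
        t\<^sub>u * real (B ^ d) + t * real (test_length \<kappa> * B ^ (d - 1))"
      using amortized[OF hard_dense_updates[OF K B_def \<beta>(1) b \<beta>(2)] refl solves times] by (simp add: t_def)
    then have "real (B ^ (d - 1)) * (real (d - 1) * \<gamma> * real B) \<le>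
        real (B ^ (d - 1)) * (t\<^sub>u * real B + t * real (test_length \<kappa>))"
      by (simp add: \<gamma>_def Bd algebra_simps del: of_nat_power)
    then have "real (d - 1) * \<gamma> * real B \<le> t\<^sub>u * real B + t * real (test_length \<kappa>)"
      using pos by (simp only: mult_le_cancel_left_pos)
    also have "\<dots> \<le> (2 * t\<^sub>u + 2 * (t / real B)) * real B"
    proof -
      have "0 \<le> t\<^sub>u * real B" using tu B(1) by simp
      moreover have "(2 * t\<^sub>u + 2 * (t / real B)) * real B = 2 * (t\<^sub>u * real B) + 2 * t"
        using B(1) by (simp add: distrib_right)
      ultimately show ?thesis using tlen by linarith
    qed
    finally show "real (d - 1) * (real (\<delta> div 2) / (128 * real b)) \<le> 2 * t\<^sub>u + 2 * (t / 2 ^ \<beta>)"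
      using B by (simp only: mult_le_cancel_right_pos \<gamma>_def)
  }
  {
    have "real (d - 1) * real (B ^ d) * real (\<delta> div 2) / (128 * real b) \<le>
        t\<^sub>u * real (B ^ (d - 1)) + t * real (test_length \<kappa> * B ^ d)"
      using amortized[OF hard_dense_queries[OF K B_def \<beta>(1) b \<beta>(2)] refl solves times] by (simp add: t_def)
    then have "real (B ^ (d - 1)) * (real (d - 1) * \<gamma> * real B) \<le>
        real (B ^ (d - 1)) * (t\<^sub>u + t * real (test_length \<kappa>) * real B)"
      by (simp add: \<gamma>_def Bd algebra_simps del: of_nat_power)
    then have "real (d - 1) * \<gamma> * real B \<le> t\<^sub>u + t * real (test_length \<kappa>) * real B"
      using pos by (simp only: mult_le_cancel_left_pos)
    also have "\<dots> \<le> t\<^sub>u + 2 * t * real B"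
      using tlen B by (intro add_left_mono mult_right_mono) auto
    also have "\<dots> \<le> (2 * t + 2 * (t\<^sub>u / real B)) * real B"
      using tu B by (simp add: distrib_right)
    finally show "real (d - 1) * (real (\<delta> div 2) / (128 * real b)) \<le> 2 * t + 2 * (t\<^sub>u / 2 ^ \<beta>)"
      using B by (simp only: mult_le_cancel_right_pos \<gamma>_def)
  }
qed

section \<open>Optimising the branching factor and the constants\<close>

lemma lg_ge_1: "x \<ge> 0 \<Longrightarrow> lg x \<ge> 1"
  by (simp add: lg_def le_log_iff)

text \<open>The branching factor is the least power of two that is at least the ratio of the two running times plus \<open>2\<close>.\<close>

lemma tradeoff:
  fixes p q \<gamma> :: real and k :: nat
  assumes p: "p \<ge> 1 / 2" and q: "q \<ge> 1 / 2" and \<gamma>: "0 \<le> \<gamma>" "\<gamma> \<le> 1"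
    and bound: "\<And>\<beta> d. \<beta> \<ge> 1 \<Longrightarrow> d > 0 \<Longrightarrow> \<beta> * d \<le> k \<Longrightarrow> real (d - 1) * \<gamma> \<le> 2 * p + 2 * (q / 2 ^ \<beta>)"
  shows "p * lg (q / p) \<ge> \<gamma> * real k / 32"
proof -
  have r: "q / p > 0" using p q by simp
  have lg: "lg (q / p) \<ge> 1" using r by (intro lg_ge_1) simp
  define \<beta> where "\<beta> = nat \<lceil>lg (q / p)\<rceil>"
  have \<beta>: "real \<beta> \<ge> lg (q / p)" "real \<beta> \<le> 2 * lg (q / p)" "\<beta> \<ge> 1"
    using lg unfolding \<beta>_def by linarith+
  have "q / p \<le> 2 powr lg (q / p)" using r by (simp add: lg_def)
  also have "\<dots> \<le> 2 powr real \<beta>" using \<beta>(1) by (intro powr_mono) auto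
  finally have "q / 2 ^ \<beta> \<le> p" using p by (simp add: powr_realpow field_simps)
  then have bound': "real (d - 1) * \<gamma> \<le> 4 * p" if "d > 0" "\<beta> * d \<le> k" for d
    using bound[OF \<beta>(3) that] by linarith
  show ?thesis
  proof (cases "2 * \<beta> \<le> k")
    \<comment> \<open>The constant 32 is \<open>2 * 4 * 4\<close>: 2 for rounding
      \<open>lg (q / p)\<close> up to \<open>\<beta>\<close>, 4 for replacing
      \<open>k / \<beta>\<close> by \<open>d - 1\<close>, and 4 from \<open>bound'\<close>.\<close>
    case True
    define d where "d = k div \<beta>"
    have d: "d \<ge> 2" using True \<beta>(3) div_le_mono[of "2 * \<beta>" k \<beta>] by (simp add: d_def)
    have "k < \<beta> * d + \<beta>" using \<beta>(3) dividend_less_times_div[of \<beta> k] by (simp add: d_def)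
    also have "\<dots> \<le> \<beta> * (4 * (d - 1))"
    proof -
      have "d + 1 \<le> 4 * (d - 1)" using d by linarith
      then have "\<beta> * (d + 1) \<le> \<beta> * (4 * (d - 1))" by (rule mult_le_mono2)
      then show ?thesis by simp
    qed
    finally have "real k \<le> real (\<beta> * (4 * (d - 1)))" by (intro of_nat_mono) simp
    then have "real k * \<gamma> \<le> real \<beta> * 4 * (real (d - 1) * \<gamma>)"
      using \<gamma>(1) mult_right_mono by fastforce
    also have "\<dots> \<le> real \<beta> * 4 * (4 * p)"
      using d by (intro mult_left_mono bound') (simp_all add: d_def)
    also have "\<dots> \<le> (2 * lg (q / p)) * 4 * (4 * p)"
      using \<beta>(2) p by (intro mult_right_mono) auto
    finally show ?thesis by (simp add: algebra_simps)
  next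
    \<comment> \<open>The tree is too shallow for a bound, but then \<open>lg (q / p)\<close> is
      itself of order \<open>k\<close>, and \<open>p \<ge> 1 / 2\<close> suffices.\<close>
    case False
    then have "real k < 2 * real \<beta>" by linarith
    then have "real k / 8 \<le> 1 / 2 * lg (q / p)" using \<beta>(2) by linarith
    also have "\<dots> \<le> p * lg (q / p)" using p lg by (intro mult_right_mono) auto
    finally have "real k / 8 \<le> p * lg (q / p)" .
    moreover have "\<gamma> * real k / 32 \<le> 1 * real k / 8"
      using \<gamma> mult_right_mono[OF \<gamma>(2), of "real k"] by simp
    ultimately show ?thesis by simp
  qed
qed

theorem theorem2p1:
  fixes c\<^sub>b c\<^sub>\<delta> :: real
  assumes "c\<^sub>b > 0" and "c\<^sub>\<delta> > 0"
  shows "\<exists>c>0. \<exists>N. \<forall>(n::nat) (b::nat) (\<delta>::nat) (Q::query_kind set) (A\<^sub>0::nat \<Rightarrow> int)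
           (D::data_structure) (t\<^sub>u::real) (t\<^sub>q::real) (t\<^sub>s::real).
           n \<ge> N \<longrightarrow>
           real b \<ge> c\<^sub>b * lg (real n) \<longrightarrow>
           \<delta> \<le> b \<longrightarrow> bits_needed Q n b \<delta> \<longrightarrow>
           real \<delta> \<ge> c\<^sub>\<delta> * real b \<longrightarrow>
           solves_partial_sums Q n b \<delta> A\<^sub>0 D \<longrightarrow>
           running_times Q n b \<delta> A\<^sub>0 D t\<^sub>u t\<^sub>q t\<^sub>s \<longrightarrow>
           (Sums \<in> Q \<longrightarrow>
             t\<^sub>q * lg (t\<^sub>u / t\<^sub>q) \<ge> c * lg (real n) \<and>
             t\<^sub>u * lg (t\<^sub>q / t\<^sub>u) \<ge> c * lg (real n)) \<and>
           (Selects \<in> Q \<longrightarrow>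
             t\<^sub>s * lg (t\<^sub>u / t\<^sub>s) \<ge> c * lg (real n) \<and>
             t\<^sub>u * lg (t\<^sub>s / t\<^sub>u) \<ge> c * lg (real n))"
proof -
  \<comment> \<open>\<open>\<epsilon>\<close> bounds the ratio of \<open>\<delta>\<close> to
    \<open>lg n\<close> from below. With \<open>k\<close> the floor of \<open>g * lg n\<close>,
    \<open>g \<le> 1 / 2\<close> yields \<open>4 ^ k \<le> n + 2 < n ^ 2\<close>, and
    \<open>g \<le> \<epsilon> / 4\<close> yields \<open>4 * k \<le> \<delta>\<close>.
    \<open>\<Lambda>\<close> ensures \<open>\<delta> \<ge> 8\<close> and that the floor loses at
    most half.\<close>
  define \<epsilon> where "\<epsilon> = c\<^sub>b * c\<^sub>\<delta>"
  define g where "g = min (1 / 2) (\<epsilon> / 4)"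
  \<comment> \<open>The 512 is \<open>4 * 128\<close>, with 4 from
    \<open>\<delta> div 2 \<ge> \<delta> / 4\<close>; \<open>g / 2\<close> accounts for the floor in
    \<open>k\<close>, and 32 comes from \<open>tradeoff\<close>.\<close>
  define c where "c = c\<^sub>\<delta> / 512 * (g / 2) / 32"
  define \<Lambda> where "\<Lambda> = max (8 / \<epsilon>) (2 / g)"
  define N where "N = nat \<lceil>2 powr \<Lambda>\<rceil> + 3"
  have \<epsilon>: "\<epsilon> > 0" using assms by (simp add: \<epsilon>_def)
  then have g: "g > 0" "g \<le> 1 / 2" "g \<le> \<epsilon> / 4" by (auto simp: g_def)
  have "c > 0" using assms g by (simp add: c_def)
  moreover have bounds: "t * lg (t\<^sub>u / t) \<ge> c * lg (real n) \<and> t\<^sub>u * lg (t / t\<^sub>u) \<ge> c * lg (real n)"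
    if n: "n \<ge> N" and b: "real b \<ge> c\<^sub>b * lg (real n)" and \<delta>: "\<delta> \<le> b" "real \<delta> \<ge> c\<^sub>\<delta> * real b"
      and bits: "bits_needed Q n b \<delta>" and solves: "solves_partial_sums Q n b \<delta> A\<^sub>0 D"
      and times: "running_times Q n b \<delta> A\<^sub>0 D t\<^sub>u t\<^sub>q t\<^sub>s"
      and \<kappa>: "\<kappa> \<in> Q" and t: "t = (case \<kappa> of Sums \<Rightarrow> t\<^sub>q | Selects \<Rightarrow> t\<^sub>s)"
    for n b \<delta> Q A\<^sub>0 D t\<^sub>u t\<^sub>q t\<^sub>s \<kappa> t
  proof -
    define l where "l = lg (real n)"
    define k where "k = nat \<lfloor>g * l\<rfloor>"
    have n3: "n \<ge> 3" using n by (simp add: N_def)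
    have "2 powr \<Lambda> \<le> 2 + real n" using n unfolding N_def by linarith
    then have "\<Lambda> \<le> l" by (simp add: l_def lg_def le_log_iff)
    then have l: "8 / \<epsilon> \<le> l" "2 / g \<le> l" by (simp_all add: \<Lambda>_def)
    have l\<epsilon>: "8 \<le> \<epsilon> * l" "2 \<le> g * l"
      using l \<epsilon> g by (simp_all add: field_simps)
    have l0: "l > 0" using l(2) g by (meson divide_pos_pos less_le_trans zero_less_numeral)
    have k: "real k \<le> g * l" "g * l / 2 \<le> real k"
      using l\<epsilon>(2) unfolding k_def by linarith+
    have "\<epsilon> * l \<le> c\<^sub>\<delta> * real b"
      using mult_left_mono[OF b, of c\<^sub>\<delta>] assms by (simp add: \<epsilon>_def l_def algebra_simps)
    then have \<delta>l: "\<epsilon> * l \<le> real \<delta>" using \<delta>(2) by linarith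
    have "g * l \<le> \<epsilon> / 4 * l" using g l0 by (intro mult_right_mono) auto
    then have "4 * real k \<le> real \<delta>" "8 \<le> real \<delta>" using k(1) \<delta>l l\<epsilon>(1) by linarith+
    then have \<delta>k: "4 * k \<le> \<delta>" "8 \<le> \<delta>" by linarith+
    have half: "\<delta> div 2 \<ge> 2" "k + \<delta> div 2 \<le> \<delta> - 2" using \<delta>k by linarith+
    have "2 ^ k < n"
    proof -
      have "g * l \<le> 1 / 2 * l" using g l0 by (intro mult_right_mono) auto
      then have "2 * real k \<le> l" using k(1) by linarith
      then have "2 powr (2 * real k) \<le> 2 + real n"
        by (simp add: l_def lg_def le_log_iff)
      moreover have "2 powr (2 * real k) = (2 ^ k)\<^sup>2"
        by (simp add: powr_realpow[symmetric] powr_powr power2_eq_square powr_add[symmetric])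
      moreover have "2 + real n < (real n)\<^sup>2"
      proof -
        have "3 * real n \<le> real n * real n" using n3 by (intro mult_right_mono) auto
        moreover have "real n \<ge> 3" using n3 by simp
        ultimately show ?thesis unfolding power2_eq_square by linarith
      qed
      ultimately have "(2 ^ k)\<^sup>2 < (real n)\<^sup>2" by linarith
      then have "2 ^ k < real n" by (rule power_less_imp_less_base) simp
      then show ?thesis by (metis of_nat_less_iff of_nat_numeral of_nat_power)
    qed
    note rt = running_time_bounds[OF \<kappa> \<delta>(1) half this bits solves times, folded t]
    define \<gamma> where "\<gamma> = real (\<delta> div 2) / (128 * real b)"
    have b0: "real b > 0" using \<delta>(1) \<delta>k by linarith
    have "real \<delta> / 4 \<le> real (\<delta> div 2)" using \<delta>k by linarith
    then have "c\<^sub>\<delta> * real b / 4 \<le> real (\<delta> div 2)" using \<delta>(2) by linarith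
    then have \<gamma>: "c\<^sub>\<delta> / 512 \<le> \<gamma>" using b0 by (simp add: \<gamma>_def field_simps)
    have "real (\<delta> div 2) \<le> real b" using \<delta>(1) by linarith
    then have \<gamma>1: "0 \<le> \<gamma>" "\<gamma> \<le> 1" using b0 by (simp_all add: \<gamma>_def field_simps)
    have "c * l = c\<^sub>\<delta> / 512 * (g * l / 2) / 32" by (simp add: c_def)
    also have "\<dots> \<le> \<gamma> * real k / 32"
      using \<gamma> k(2) \<gamma>1 g l0 by (intro divide_right_mono mult_mono) auto
    finally have c: "c * l \<le> \<gamma> * real k / 32" .
    have half': "t\<^sub>u \<ge> 1 / 2" using rt(1) by linarith
    \<comment> \<open>The operation whose time stands outside the logarithm is the dense one:
      queries here, updates in the next bound.\<close>
    have "\<gamma> * real k / 32 \<le> t * lg (t\<^sub>u / t)"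
      by (rule tradeoff[OF rt(2) half' \<gamma>1]) (unfold \<gamma>_def, rule rt(4))
    moreover have "\<gamma> * real k / 32 \<le> t\<^sub>u * lg (t / t\<^sub>u)"
      by (rule tradeoff[OF half' rt(2) \<gamma>1]) (unfold \<gamma>_def, rule rt(3))
    ultimately show ?thesis using c unfolding l_def by linarith
  qed
  ultimately show ?thesis
  proof (intro exI[of _ c] conjI exI[of _ N] allI impI)
    fix n b \<delta> Q A\<^sub>0 D t\<^sub>u t\<^sub>q t\<^sub>s
    assume *: "N \<le> n" "c\<^sub>b * lg (real n) \<le> real b" "\<delta> \<le> b" "bits_needed Q n b \<delta>" "c\<^sub>\<delta> * real b \<le> real \<delta>"
      "solves_partial_sums Q n b \<delta> A\<^sub>0 D" "running_times Q n b \<delta> A\<^sub>0 D t\<^sub>u t\<^sub>q t\<^sub>s"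
    note bound = bounds[OF *(1-3,5,4,6,7)]
    show "c * lg (real n) \<le> t\<^sub>q * lg (t\<^sub>u / t\<^sub>q)" "c * lg (real n) \<le> t\<^sub>u * lg (t\<^sub>q / t\<^sub>u)" if "Sums \<in> Q"
      using bound[OF that] by auto
    show "c * lg (real n) \<le> t\<^sub>s * lg (t\<^sub>u / t\<^sub>s)" "c * lg (real n) \<le> t\<^sub>u * lg (t\<^sub>s / t\<^sub>u)" if "Selects \<in> Q"
      using bound[OF that] by auto
  qed
qed

end
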